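(* Let $G$ be a simple planar graph with $\Delta(G)\ge 15$. If $H$ is the line graph of $G$ and $L$ is a $\Delta(G)$-assignment for $H$, then all $L$-colorings of $H$ are $L$-equivalent.
   Context: A list assignment $L$ for a graph $H$ assigns to each vertex $v$ a set $L(v)$ of colors; it is a $k$-assignment if $|L(v)|=k$ for all $v$. An $L$-coloring is a proper coloring $\varphi$ with $\varphi(v)\in L(v)$ for all $v$. For a proper coloring and distinct colors $\alpha,\beta$, an $\alpha,\beta$-Kempe swap interchanges the colors $\alpha$ and $\beta$ on one connected component of the subgraph induced by the vertices colored $\alpha$ or $\beta$. A Kempe swap is $L$-valid for an $L$-coloring $\varphi$ if performing it on $\varphi$ yields another $L$-coloring. Two $L$-colorings are $L$-equivalent if one can be transformed into the other by a sequence of $L$-valid Kempe swaps. The line graph of $G$ has vertex set $E(G)$, two edges adjacent iff they share an endpoint. $\Delta(G)$ is the maximum degree. *)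

theory Defs
  imports "HOL-Analysis.Analysis" "HOL-Combinatorics.Transposition"
begin

text \<open>A graph is given by its vertex set and its set of edges, each edge being a
  two-element set of vertices.\<close>

definition simple_graph :: "'a set \<Rightarrow> 'a set set \<Rightarrow> bool" where
  "simple_graph V E \<longleftrightarrow> finite V \<and> (\<forall>e\<in>E. e \<subseteq> V \<and> card e = 2)"

definition vertex_degree :: "'a set set \<Rightarrow> 'a \<Rightarrow> nat" where
  "vertex_degree E v = card {e \<in> E. v \<in> e}"

text \<open>The inserted 0 only matters for the graph without vertices.\<close>

definition max_degree :: "'a set \<Rightarrow> 'a set set \<Rightarrow> nat" where
  "max_degree V E = Max (insert 0 (vertex_degree E ` V))"

text \<open>The vertices of the line graph are the elements of \<open>E\<close>; the following is its edge set.\<close>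

definition line_graph_edges :: "'a set set \<Rightarrow> 'a set set set" where
  "line_graph_edges E = {{e, f} | e f. e \<in> E \<and> f \<in> E \<and> e \<noteq> f \<and> e \<inter> f \<noteq> {}}"

definition induced_edges :: "'a set set \<Rightarrow> 'a set \<Rightarrow> 'a set set" where
  "induced_edges E S = {e \<in> E. e \<subseteq> S}"

definition component_of :: "'a set \<Rightarrow> 'a set set \<Rightarrow> 'a \<Rightarrow> 'a set" where
  "component_of V E v = {w \<in> V. (v, w) \<in> {(x, y). {x, y} \<in> E}\<^sup>*}"

definition components_of :: "'a set \<Rightarrow> 'a set set \<Rightarrow> 'a set set" where
  "components_of V E = component_of V E ` V"

text \<open>A drawing in the plane: \<open>p\<close> places the vertices at distinct points, \<open>\<gamma> e\<close> is a simple
  arc joining the two ends of \<open>e\<close> and passing through no other vertex, and two distinct edges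
  meet only in common ends.\<close>

definition plane_drawing ::
    "'a set \<Rightarrow> 'a set set \<Rightarrow> ('a \<Rightarrow> real ^ 2) \<Rightarrow> ('a set \<Rightarrow> real \<Rightarrow> real ^ 2) \<Rightarrow> bool" where
  "plane_drawing V E p \<gamma> \<longleftrightarrow>
     inj_on p V \<and>
     (\<forall>e\<in>E. arc (\<gamma> e) \<and> {pathstart (\<gamma> e), pathfinish (\<gamma> e)} = p ` e \<and>
        path_image (\<gamma> e) \<inter> p ` V = p ` e) \<and>
     (\<forall>e\<in>E. \<forall>f\<in>E. e \<noteq> f \<longrightarrow> path_image (\<gamma> e) \<inter> path_image (\<gamma> f) = p ` (e \<inter> f))"

definition planar :: "'a set \<Rightarrow> 'a set set \<Rightarrow> bool" where
  "planar V E \<longleftrightarrow> (\<exists>p \<gamma>. plane_drawing V E p \<gamma>)"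

definition list_assignment :: "'a set \<Rightarrow> nat \<Rightarrow> ('a \<Rightarrow> 'c set) \<Rightarrow> bool" where
  "list_assignment V k L \<longleftrightarrow> (\<forall>v\<in>V. finite (L v) \<and> card (L v) = k)"

definition proper_coloring :: "'a set set \<Rightarrow> ('a \<Rightarrow> 'c) \<Rightarrow> bool" where
  "proper_coloring E \<phi> \<longleftrightarrow> (\<forall>v w. {v, w} \<in> E \<longrightarrow> v \<noteq> w \<longrightarrow> \<phi> v \<noteq> \<phi> w)"

text \<open>Colorings are extensional functions, so that two colorings are equal iff they agree on
  the vertex set.\<close>

definition list_coloring :: "'a set \<Rightarrow> 'a set set \<Rightarrow> ('a \<Rightarrow> 'c set) \<Rightarrow> ('a \<Rightarrow> 'c) \<Rightarrow> bool" where
  "list_coloring V E L \<phi> \<longleftrightarrow> \<phi> \<in> (\<Pi>\<^sub>E v\<in>V. L v) \<and> proper_coloring E \<phi>"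

definition kempe_components ::
    "'a set \<Rightarrow> 'a set set \<Rightarrow> ('a \<Rightarrow> 'c) \<Rightarrow> 'c \<Rightarrow> 'c \<Rightarrow> 'a set set" where
  "kempe_components V E \<phi> \<alpha> \<beta> =
     (let S = {v \<in> V. \<phi> v = \<alpha> \<or> \<phi> v = \<beta>} in components_of S (induced_edges E S))"

definition kempe_swap :: "'a set \<Rightarrow> 'a set set \<Rightarrow> ('a \<Rightarrow> 'c) \<Rightarrow> ('a \<Rightarrow> 'c) \<Rightarrow> bool" where
  "kempe_swap V E \<phi> \<psi> \<longleftrightarrow>
     (\<exists>\<alpha> \<beta>. \<alpha> \<noteq> \<beta> \<and> (\<exists>C \<in> kempe_components V E \<phi> \<alpha> \<beta>.
        \<psi> = (\<lambda>v. if v \<in> C then Transposition.transpose \<alpha> \<beta> (\<phi> v) else \<phi> v)))"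

definition valid_kempe_swap ::
    "'a set \<Rightarrow> 'a set set \<Rightarrow> ('a \<Rightarrow> 'c set) \<Rightarrow> ('a \<Rightarrow> 'c) \<Rightarrow> ('a \<Rightarrow> 'c) \<Rightarrow> bool" where
  "valid_kempe_swap V E L \<phi> \<psi> \<longleftrightarrow>
     list_coloring V E L \<phi> \<and> kempe_swap V E \<phi> \<psi> \<and> list_coloring V E L \<psi>"

definition kempe_equivalent ::
    "'a set \<Rightarrow> 'a set set \<Rightarrow> ('a \<Rightarrow> 'c set) \<Rightarrow> ('a \<Rightarrow> 'c) \<Rightarrow> ('a \<Rightarrow> 'c) \<Rightarrow> bool" where
  "kempe_equivalent V E L = (valid_kempe_swap V E L)\<^sup>*\<^sup>*"

end

theory Submission
  imports Defs
begin

text \<open>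
  Colorings are recolored by moves that interchange two colors on any set of vertices; every such
  move is a sequence of Kempe swaps. The proof is by induction on the number of edges, for a fixed
  \<open>k \<ge> 15\<close> bounding all degrees and with all lists of size \<open>k\<close>. An edge with fewer than \<open>k\<close>
  neighbours in the line graph can be deleted and put back. Otherwise every edge has degree sum at
  least \<open>k + 2\<close>, and Euler's bounds (for the graph without its 2-vertices, and for the bipartite
  graphs between the vertices of degree 3, 3-4, 3-5 and their neighbours) show that the 2-vertices,
  viewed as edges of a multigraph on the vertices of degree \<open>k\<close>, have density more than 3/2.

  In a minimal sub-multigraph of density more than 3/2 take a vertex \<open>w\<close> of degree at least 4. The
  half edges at \<open>w\<close> form a clique in the line graph, and the components of the multigraph minus
  \<open>w\<close> hang on it. A suitable set \<open>S\<close> consisting of some of these half edges and some of these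
  components is reducible: any two colorings of \<open>S\<close> from lists as large as the degrees are
  equivalent, and any move outside \<open>S\<close> extends to \<open>S\<close>. The first property rests on the fact that in
  every coloring some vertex of the clique has a color missing in the list of a fixed vertex \<open>s\<close> of
  the clique without further neighbours, so that the rest is colored with slack.
\<close>

section \<open>Edge bounds for planar graphs\<close>

text \<open>A half edge has exactly \<open>k\<close> neighbors in the line graph and a list of
  \<open>k\<close> colors. A coloring outside \<open>S\<close> therefore guarantees on
  \<open>S\<close> only lists as large as the degrees inside \<open>S\<close>, and all slack must be
  created by the choice of colors. Density above 3/2 means average degree above 3, which provides
  \<open>w\<close>. A smallest dense multigraph gives
  \<open>3 * card C + 1 \<le> 2 * (inner edges + edges to w)\<close> for each component
  \<open>C\<close> at \<open>w\<close>, so most components contain a cycle. Cutting edges into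
  halves doubles the cycle to an even one, and even cycles are colorable from lists of size 2; this
  is why such components can be colored after everything around them. Two families of colorings,
  each fixing the color of one clique vertex, are joined by a coloring that lies in both. The
  obstacles are equal colors at the two vertices, and a component without a cycle attached to
  exactly these two; the first is met by using that the clique has at least 4 vertices, the second
  by detours through a third vertex. The bound 15 makes neighbors of vertices of degree at most 5
  have degree at least 12, which is what the weighted count of planar edges requires.\<close>

abbreviation edge_rel :: "'a set set \<Rightarrow> ('a \<times> 'a) set" where
  "edge_rel E \<equiv> {(x, y). {x, y} \<in> E}"

text \<open>No cycle is ever named: that the ends stay connected after deletion of \<open>e\<close>
  is all that the splitting at bridges and the construction of a Jordan curve use. The notion is
  meant for two-element edges; for \<open>x = y\<close> the empty walk would qualify.\<close>

definition on_cycle :: "'a set set \<Rightarrow> 'a set \<Rightarrow> bool" where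
  "on_cycle E e \<longleftrightarrow> (\<exists>x y. e = {x, y} \<and> (x, y) \<in> (edge_rel (E - {e}))\<^sup>*)"

lemma on_cycle_mono: "on_cycle E e \<Longrightarrow> E \<subseteq> E' \<Longrightarrow> on_cycle E' e"
proof -
  assume "on_cycle E e" and "E \<subseteq> E'"
  moreover have "edge_rel (E - {e}) \<subseteq> edge_rel (E' - {e})" using \<open>E \<subseteq> E'\<close> by auto
  ultimately show ?thesis unfolding on_cycle_def using rtrancl_mono by blast
qed

lemma finite_edges: "simple_graph V E \<Longrightarrow> finite E"
  unfolding simple_graph_def by (meson PowI finite_Pow_iff finite_subset subsetI)

text \<open>\<open>V1\<close> is what \<open>x\<close> still reaches once the bridge is deleted,
  \<open>V2\<close> the rest. No other edge crosses, since it would extend reachability.\<close>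

lemma bridge_split:
  assumes G: "simple_graph V E" and e: "e \<in> E" "\<not> on_cycle E e"
  obtains x y V1 V2 E1 E2 where "e = {x, y}" "x \<in> V1" "y \<in> V2" "V1 \<union> V2 = V" "V1 \<inter> V2 = {}"
    "E1 \<union> E2 = E - {e}" "E1 \<inter> E2 = {}" "simple_graph V1 E1" "simple_graph V2 E2"
proof -
  obtain x y where xy: "e = {x, y}" "x \<noteq> y"
    using G e unfolding simple_graph_def by (meson card_2_iff)
  have V: "x \<in> V" "y \<in> V" using G e xy unfolding simple_graph_def by auto
  let ?R = "(edge_rel (E - {e}))\<^sup>*"
  define V1 where "V1 = {v \<in> V. (x, v) \<in> ?R}"
  define V2 where "V2 = V - V1"
  define E1 where "E1 = {f \<in> E - {e}. f \<subseteq> V1}"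
  define E2 where "E2 = {f \<in> E - {e}. f \<subseteq> V2}"
  have "y \<notin> V1" using e(2) xy unfolding on_cycle_def V1_def by blast
  have or: "f \<subseteq> V1 \<or> f \<subseteq> V2" if f: "f \<in> E - {e}" for f
  proof -
    have "card f = 2" "f \<subseteq> V" using G f unfolding simple_graph_def by auto
    then obtain a b where ab: "f = {a, b}" by (meson card_2_iff)
    have abV: "a \<in> V" "b \<in> V" using \<open>f \<subseteq> V\<close> ab by auto
    have "(a, b) \<in> edge_rel (E - {e})" "(b, a) \<in> edge_rel (E - {e})"
      using f ab by (auto simp: insert_commute)
    then have "a \<in> V1 \<longleftrightarrow> b \<in> V1"
      using abV unfolding V1_def by (auto intro: rtrancl.rtrancl_into_rtrancl)
    then show ?thesis using ab abV unfolding V2_def by auto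
  qed
  have ne: "f \<noteq> {}" if "f \<in> E" for f using G that unfolding simple_graph_def by auto
  show ?thesis
  proof (rule that[of x y V1 V2 E1 E2])
    show "E1 \<union> E2 = E - {e}" using or unfolding E1_def E2_def by blast
    show "E1 \<inter> E2 = {}" using ne unfolding E1_def E2_def V2_def by blast
    show "simple_graph V1 E1" "simple_graph V2 E2"
      using G unfolding simple_graph_def E1_def E2_def V1_def V2_def by auto
  qed (use xy V \<open>y \<notin> V1\<close> in \<open>auto simp: V2_def V1_def\<close>)
qed

text \<open>Every edge is a bridge and splits the forest into two nonempty forests; one of their two
  surplus vertices pays for the deleted edge.\<close>

lemma forest_card:
  assumes "simple_graph V E" "V \<noteq> {}" "\<And>e. e \<in> E \<Longrightarrow> \<not> on_cycle E e"
  shows "card E + 1 \<le> card V"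
  using assms
proof (induction "card E" arbitrary: V E rule: less_induct)
  case less
  have finV: "finite V" using less.prems unfolding simple_graph_def by blast
  have finE: "finite E" using finite_edges[OF less.prems(1)] .
  show ?case
  proof (cases "E = {}")
    case True
    then show ?thesis using finV less.prems(2) by (simp add: Suc_leI card_gt_0_iff)
  next
    case False
    then obtain e where e: "e \<in> E" by blast
    obtain x y V1 V2 E1 E2 where s: "e = {x, y}" "x \<in> V1" "y \<in> V2" "V1 \<union> V2 = V" "V1 \<inter> V2 = {}"
      "E1 \<union> E2 = E - {e}" "E1 \<inter> E2 = {}" "simple_graph V1 E1" "simple_graph V2 E2"
      by (rule bridge_split[OF less.prems(1) e less.prems(3)[OF e]])
    have sub: "E1 \<subset> E" "E2 \<subset> E" using s(6) e by auto
    have c: "card E1 < card E" "card E2 < card E" using sub finE psubset_card_mono by auto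
    have 1: "card E1 + 1 \<le> card V1"
      by (rule less.hyps[OF c(1) s(8)]) (use s(2) less.prems(3) on_cycle_mono sub in blast)+
    have 2: "card E2 + 1 \<le> card V2"
      by (rule less.hyps[OF c(2) s(9)]) (use s(3) less.prems(3) on_cycle_mono sub in blast)+
    have "card (E - {e}) = card E1 + card E2"
      using s(6,7) finE by (metis card_Un_disjoint finite_Diff finite_Un)
    then have "card E = card E1 + card E2 + 1" using e finE by (metis Suc_eq_plus1 card_Suc_Diff1)
    moreover have "card V = card V1 + card V2"
      using s(4,5) finV by (metis card_Un_disjoint finite_Un)
    ultimately show ?thesis using 1 2 by linarith
  qed
qed

section \<open>Plane drawings, their faces and Euler's inequality\<close>

definition cdrawing :: "'a set \<Rightarrow> 'a set set \<Rightarrow> ('a \<Rightarrow> complex) \<Rightarrow> ('a set \<Rightarrow> real \<Rightarrow> complex) \<Rightarrow> bool" where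
  "cdrawing V E p \<gamma> \<longleftrightarrow> simple_graph V E \<and> inj_on p V \<and>
     (\<forall>e\<in>E. arc (\<gamma> e) \<and> {pathstart (\<gamma> e), pathfinish (\<gamma> e)} = p ` e \<and>
        path_image (\<gamma> e) \<inter> p ` V = p ` e) \<and>
     (\<forall>e\<in>E. \<forall>f\<in>E. e \<noteq> f \<longrightarrow> path_image (\<gamma> e) \<inter> path_image (\<gamma> f) = p ` (e \<inter> f))"

definition carrier :: "'a set \<Rightarrow> 'a set set \<Rightarrow> ('a \<Rightarrow> complex) \<Rightarrow> ('a set \<Rightarrow> real \<Rightarrow> complex) \<Rightarrow> complex set" where
  "carrier V E p \<gamma> = p ` V \<union> (\<Union>e\<in>E. path_image (\<gamma> e))"

lemma cdrawingD:
  assumes "cdrawing V E p \<gamma>"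
  shows "simple_graph V E" "inj_on p V" "finite V" "finite E"
    "\<And>e. e \<in> E \<Longrightarrow> arc (\<gamma> e)"
    "\<And>e. e \<in> E \<Longrightarrow> {pathstart (\<gamma> e), pathfinish (\<gamma> e)} = p ` e"
    "\<And>e. e \<in> E \<Longrightarrow> path_image (\<gamma> e) \<inter> p ` V = p ` e"
    "\<And>e f. e \<in> E \<Longrightarrow> f \<in> E \<Longrightarrow> e \<noteq> f \<Longrightarrow> path_image (\<gamma> e) \<inter> path_image (\<gamma> f) = p ` (e \<inter> f)"
    "\<And>e. e \<in> E \<Longrightarrow> e \<subseteq> V"
proof -
  show g: "simple_graph V E" using assms by (simp add: cdrawing_def)
  then show "finite V" "finite E" "\<And>e. e \<in> E \<Longrightarrow> e \<subseteq> V"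
    using finite_edges[OF g] by (simp_all add: simple_graph_def)
qed (use assms in \<open>simp_all add: cdrawing_def\<close>)

lemma cdrawing_subgraph:
  assumes "cdrawing V E p \<gamma>" "V' \<subseteq> V" "E' \<subseteq> E" "simple_graph V' E'"
  shows "cdrawing V' E' p \<gamma>"
proof -
  note d = cdrawingD[OF assms(1)]
  have "path_image (\<gamma> e) \<inter> p ` V' = p ` e" if e: "e \<in> E'" for e
  proof -
    have "e \<subseteq> V'" using assms(4) e by (simp add: simple_graph_def)
    moreover have "path_image (\<gamma> e) \<inter> p ` V = p ` e" using d(7) assms(3) e by blast
    ultimately show ?thesis using assms(2) by blast
  qed
  moreover have "inj_on p V'" using d(2) assms(2) by (rule inj_on_subset)
  moreover have "arc (\<gamma> e)" "{pathstart (\<gamma> e), pathfinish (\<gamma> e)} = p ` e" if "e \<in> E'" for e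
    using d(5,6) assms(3) that by blast+
  moreover have "path_image (\<gamma> e) \<inter> path_image (\<gamma> f) = p ` (e \<inter> f)"
    if "e \<in> E'" "f \<in> E'" "e \<noteq> f" for e f using d(8)[of e f] assms(3) that by blast
  ultimately show ?thesis using assms(4) unfolding cdrawing_def by simp
qed

lemma cdrawing_remove: "cdrawing V E p \<gamma> \<Longrightarrow> F \<subseteq> E \<Longrightarrow> cdrawing V F p \<gamma>"
  using cdrawing_subgraph[of V E p \<gamma> V F] cdrawingD(1)[of V E p \<gamma>] by (auto simp: simple_graph_def)

lemma compact_carrier:
  assumes "cdrawing V E p \<gamma>"
  shows "compact (carrier V E p \<gamma>)"
  unfolding carrier_def using cdrawingD[OF assms]
  by (intro compact_Un compact_UN) (auto intro: finite_imp_compact simp: compact_path_image arc_imp_path)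

lemma edge_interior:
  assumes d: "cdrawing V E p \<gamma>" and e: "e \<in> E"
  defines "X \<equiv> path_image (\<gamma> e) - p ` e"
  shows "X \<noteq> {}" "connected X" "X \<inter> carrier V (E - {e}) p \<gamma> = {}"
    "carrier V E p \<gamma> = carrier V (E - {e}) p \<gamma> \<union> path_image (\<gamma> e)"
    "p ` e \<subseteq> carrier V (E - {e}) p \<gamma>"
proof -
  note a = cdrawingD(5-7)[OF d e] and b = cdrawingD(8)[OF d e]
  have s: "simple_path (\<gamma> e)" using a(1) arc_imp_simple_path by blast
  show "X \<noteq> {}" "connected X"
    unfolding X_def a(2)[symmetric]
    using nonempty_simple_path_endless[OF s] connected_simple_path_endless[OF s] by auto
  show "X \<inter> carrier V (E - {e}) p \<gamma> = {}" using a(3) b unfolding X_def carrier_def by blast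
  show "carrier V E p \<gamma> = carrier V (E - {e}) p \<gamma> \<union> path_image (\<gamma> e)"
    using e unfolding carrier_def by blast
  show "p ` e \<subseteq> carrier V (E - {e}) p \<gamma>" using a(3) unfolding carrier_def by blast
qed

lemma carrier_path:
  assumes d: "cdrawing V E p \<gamma>" and xy: "(x, y) \<in> (edge_rel E)\<^sup>*"
  shows "x = y \<or> (\<exists>g. path g \<and> pathstart g = p x \<and> pathfinish g = p y \<and>
    path_image g \<subseteq> (\<Union>e\<in>E. path_image (\<gamma> e)))"
  using xy
proof (induction rule: rtrancl_induct)
  case (step y z)
  have e: "{y, z} \<in> E" using step.hyps by auto
  then have a: "path (\<gamma> {y, z})" "{pathstart (\<gamma> {y, z}), pathfinish (\<gamma> {y, z})} = {p y, p z}"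
    using cdrawingD(5,6)[OF d e] by (auto intro: arc_imp_path)
  obtain h where h: "path h" "pathstart h = p y" "pathfinish h = p z" "path_image h = path_image (\<gamma> {y, z})"
  proof (cases "pathstart (\<gamma> {y, z}) = p y")
    case True
    then show ?thesis using that[of "\<gamma> {y, z}"] a by (auto simp: doubleton_eq_iff)
  next
    case False
    then show ?thesis using that[of "reversepath (\<gamma> {y, z})"] a by (auto simp: doubleton_eq_iff)
  qed
  have hE: "path_image h \<subseteq> (\<Union>e\<in>E. path_image (\<gamma> e))" using h(4) e by auto
  from step.IH show ?case
  proof (elim disjE exE conjE)
    assume "x = y"
    then show ?thesis using h hE by blast
  next
    fix g assume "path g" "pathstart g = p x" "pathfinish g = p y" "path_image g \<subseteq> (\<Union>e\<in>E. path_image (\<gamma> e))"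
    then show ?thesis using h hE
      by (intro disjI2 exI[of _ "g +++ h"]) (simp add: path_image_join)
  qed
qed simp

text \<open>A walk closing the cycle yields an arc \<open>A\<close> in the drawing of the other
  edges, and \<open>\<gamma> e\<close> with \<open>A\<close> is a Jordan curve with inside
  \<open>I\<close> and outside \<open>J\<close>. The last conclusion drives all face counting:
  adding \<open>e\<close> separates no two points of one old face that lie on the same side.\<close>

lemma cycle_sides:
  assumes d: "cdrawing V E p \<gamma>" and e: "e \<in> E" "on_cycle E e"
  obtains I J where "open I" "open J" "I \<inter> J = {}" "path_image (\<gamma> e) \<subseteq> closure I"
    "path_image (\<gamma> e) \<subseteq> closure J" "(I \<union> J) \<inter> path_image (\<gamma> e) = {}"
    "- carrier V E p \<gamma> \<subseteq> I \<union> J"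
    "\<And>a b. a \<in> I \<and> b \<in> I \<or> a \<in> J \<and> b \<in> J \<Longrightarrow> connected_component (- carrier V (E - {e}) p \<gamma>) a b \<Longrightarrow>
       connected_component (- carrier V E p \<gamma>) a b"
proof -
  let ?K = "carrier V E p \<gamma>" and ?Ke = "carrier V (E - {e}) p \<gamma>"
  obtain x y where xy: "e = {x, y}" "(x, y) \<in> (edge_rel (E - {e}))\<^sup>*"
    using e(2) unfolding on_cycle_def by blast
  have "card e = 2" "e \<subseteq> V" using cdrawingD(1)[OF d] e(1) by (auto simp: simple_graph_def)
  then have xyV: "x \<in> V" "y \<in> V" "x \<noteq> y" using xy(1) by auto
  have pxy: "p x \<noteq> p y" using cdrawingD(2)[OF d] xyV by (meson inj_onD)
  have a: "arc (\<gamma> e)" "{pathstart (\<gamma> e), pathfinish (\<gamma> e)} = {p x, p y}"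
    using cdrawingD(5,6)[OF d e(1)] xy(1) by auto
  note b = cdrawingD(8)[OF d e(1)]
  have d': "cdrawing V (E - {e}) p \<gamma>"
    by (rule cdrawing_remove[OF d]) blast
  obtain g where g: "path g" "pathstart g = p x" "pathfinish g = p y"
    "path_image g \<subseteq> (\<Union>f\<in>E - {e}. path_image (\<gamma> f))"
    using carrier_path[OF d' xy(2)] xyV by blast
  \<comment> \<open>The walk may repeat vertices, so its path is thinned to an arc before the curve
    is closed.\<close>
  obtain q where q: "arc q" "path_image q \<subseteq> path_image g" "pathstart q = p x" "pathfinish q = p y"
    using path_contains_arc[OF g(1-3) pxy] by blast
  obtain A where A: "arc A" "path_image A \<subseteq> path_image g" "pathstart A = pathfinish (\<gamma> e)"
    "pathfinish A = pathstart (\<gamma> e)"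
  proof (cases "pathstart (\<gamma> e) = p y")
    case True
    then show ?thesis using that[of q] q a by (auto simp: doubleton_eq_iff)
  next
    case False
    then show ?thesis using that[of "reversepath q"] q a arc_reversepath[OF q(1)] by (auto simp: doubleton_eq_iff)
  qed
  have AE: "path_image A \<subseteq> (\<Union>f\<in>E - {e}. path_image (\<gamma> f))" using A(2) g(4) by blast
  have pe: "p ` e \<subseteq> path_image A"
  proof -
    have "{pathstart A, pathfinish A} \<subseteq> path_image A" by auto
    then have "{p x, p y} \<subseteq> path_image A" unfolding A(3,4) a(2)[symmetric] by blast
    then show ?thesis using xy(1) by simp
  qed
  have int: "path_image (\<gamma> e) \<inter> path_image A = p ` e"
  proof
    show "path_image (\<gamma> e) \<inter> path_image A \<subseteq> p ` e" using AE b by blast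
    show "p ` e \<subseteq> path_image (\<gamma> e) \<inter> path_image A"
      using pe cdrawingD(7)[OF d e(1)] by blast
  qed
  define c where "c = \<gamma> e +++ A"
  have sc: "simple_path c"
    unfolding c_def by (rule simple_path_join_loop[OF a(1) A(1)]) (use A int a(2) xy(1) in auto)
  have pc: "path_image c = path_image (\<gamma> e) \<union> path_image A"
    unfolding c_def using A(3) by (simp add: path_image_join)
  have "pathfinish c = pathstart c" using A by (simp add: c_def)
  note J = Jordan_inside_outside[OF sc this]
  let ?I = "inside (path_image c)" and ?J = "outside (path_image c)"
  have AKe: "path_image A \<subseteq> ?Ke" using AE unfolding carrier_def by blast
  have cK: "path_image c \<union> ?Ke = ?K"
    using AKe edge_interior(4)[OF d e(1)] unfolding pc by blast
  have cKe: "path_image c \<inter> ?Ke = path_image A"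
    using AKe edge_interior(3)[OF d e(1)] pe unfolding pc by blast
  have fr: "path_image c \<subseteq> closure ?I" "path_image c \<subseteq> closure ?J"
    using J by (metis Diff_subset frontier_def)+
  show ?thesis
  proof (rule that[of ?I ?J])
    show "open ?I" "open ?J" "?I \<inter> ?J = {}" using J by blast+
    show "path_image (\<gamma> e) \<subseteq> closure ?I" "path_image (\<gamma> e) \<subseteq> closure ?J" using fr pc by blast+
    show "(?I \<union> ?J) \<inter> path_image (\<gamma> e) = {}" using J pc by blast
    show "- ?K \<subseteq> ?I \<union> ?J" using J cK by blast
    fix u v assume uv: "u \<in> ?I \<and> v \<in> ?I \<or> u \<in> ?J \<and> v \<in> ?J" "connected_component (- ?Ke) u v"
    have "connected_component (- path_image c) u v"
      using uv(1)
    proof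
      assume "u \<in> ?I \<and> v \<in> ?I"
      then show ?thesis unfolding connected_component_def using J by (intro exI[of _ ?I]) blast
    next
      assume "u \<in> ?J \<and> v \<in> ?J"
      then show ?thesis unfolding connected_component_def using J by (intro exI[of _ ?J]) blast
    qed
    \<comment> \<open>Janiszewski's theorem: the curve and the old drawing meet exactly in the
      connected set \<open>path_image A\<close>, so points separated by neither are not separated by
      the union, which is the drawing with \<open>e\<close>.\<close>
    then have "connected_component (- (path_image c \<union> ?Ke)) u v"
    proof (rule Janiszewski[rotated 3])
      show "connected_component (- ?Ke) u v" by fact
      show "compact (path_image c)" using sc by (simp add: compact_path_image simple_path_imp_path)
      show "closed ?Ke" using compact_carrier[OF d'] compact_imp_closed by blast
      show "connected (path_image c \<inter> ?Ke)" unfolding cKe using A(1) by (simp add: arc_imp_path connected_path_image)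
    qed
    then show "connected_component (- ?K) u v" unfolding cK .
  qed
qed

text \<open>The ends are removed because a face that reaches \<open>e\<close> only at an end vertex
  must not count; otherwise an edge could touch many faces.\<close>

definition touches :: "('a \<Rightarrow> complex) \<Rightarrow> ('a set \<Rightarrow> real \<Rightarrow> complex) \<Rightarrow> 'a set \<Rightarrow> complex set \<Rightarrow> bool" where
  "touches p \<gamma> e f \<longleftrightarrow> (path_image (\<gamma> e) - p ` e) \<inter> closure f \<noteq> {}"

text \<open>All faces at the interior of \<open>e\<close> lie in one face of the drawing without
  \<open>e\<close>. By \<open>cycle_sides\<close> each is then determined by its side of the curve,
  an injection into \<open>bool\<close>.\<close>

lemma edge_faces_le_2:
  assumes d: "cdrawing V E p \<gamma>" and e: "e \<in> E" "on_cycle E e"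
    and F: "\<F> \<subseteq> components (- carrier V E p \<gamma>)" "\<And>f. f \<in> \<F> \<Longrightarrow> touches p \<gamma> e f"
  shows "card \<F> \<le> 2"
proof -
  let ?K = "carrier V E p \<gamma>" and ?Ke = "carrier V (E - {e}) p \<gamma>"
  note ei = edge_interior[OF d e(1)]
  have d': "cdrawing V (E - {e}) p \<gamma>"
    by (rule cdrawing_remove[OF d]) blast
  have op: "open (- ?Ke)" using compact_carrier[OF d'] compact_imp_closed by blast
  obtain x0 where x0: "x0 \<in> path_image (\<gamma> e) - p ` e" using ei(1) by blast
  have Om: "connected_component (- ?Ke) x0 a" if f: "f \<in> \<F>" "a \<in> f" for f a
  proof -
    obtain x where x: "x \<in> path_image (\<gamma> e) - p ` e" "x \<in> closure f"
      using F(2)[OF f(1)] unfolding touches_def by blast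
    have "x \<in> - ?Ke" using ei(3) x by blast
    then obtain r where r: "r > 0" "ball x r \<subseteq> - ?Ke" using op open_contains_ball by blast
    obtain y where y: "y \<in> f" "dist y x < r" using x(2) r(1) closure_approachable by blast
    have 1: "connected_component (- ?Ke) x0 x"
      unfolding connected_component_def
      by (rule exI[of _ "path_image (\<gamma> e) - p ` e"]) (use ei(2,3) x(1) x0 in auto)
    have 2: "connected_component (- ?Ke) x y"
      unfolding connected_component_def
      by (rule exI[of _ "ball x r"]) (use r y in \<open>auto simp: dist_commute\<close>)
    have fc: "f \<in> components (- ?K)" using F(1) f(1) by blast
    have "f \<subseteq> - ?Ke" using in_components_subset[OF fc] ei(4) by blast
    then have 3: "connected_component (- ?Ke) y a"
      unfolding connected_component_def
      by (intro exI[of _ f]) (use in_components_connected[OF fc] f y in auto)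
    show ?thesis using 1 2 3 connected_component_trans by metis
  qed
  obtain I J where IJ: "open I" "open J" "I \<inter> J = {}" "- ?K \<subseteq> I \<union> J"
    "\<And>a b. a \<in> I \<and> b \<in> I \<or> a \<in> J \<and> b \<in> J \<Longrightarrow> connected_component (- ?Ke) a b \<Longrightarrow>
       connected_component (- ?K) a b"
    using cycle_sides[OF d e] by metis
  define pick where "pick f = (SOME a. a \<in> f)" for f :: "complex set"
  have pick: "pick f \<in> f" if "f \<in> \<F>" for f
    using F(1) that in_components_nonempty unfolding pick_def by (metis some_in_eq subsetD)
  have "inj_on (\<lambda>f. pick f \<in> I) \<F>"
  proof (rule inj_onI)
    fix f f' assume f: "f \<in> \<F>" "f' \<in> \<F>" and eq: "(pick f \<in> I) = (pick f' \<in> I)"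
    have fc: "f \<in> components (- ?K)" "f' \<in> components (- ?K)" using F(1) f by auto
    have "pick f \<in> I \<union> J" "pick f' \<in> I \<union> J"
      using pick f fc in_components_subset IJ(4) by blast+
    then have "pick f \<in> I \<and> pick f' \<in> I \<or> pick f \<in> J \<and> pick f' \<in> J" using eq by blast
    moreover have "connected_component (- ?Ke) (pick f) (pick f')"
      using Om pick f by (meson connected_component_sym connected_component_trans)
    ultimately have cc: "connected_component (- ?K) (pick f) (pick f')" using IJ(5) by blast
    have "f = connected_component_set (- ?K) (pick f)" "f' = connected_component_set (- ?K) (pick f')"
      using pick f fc by (metis components_iff connected_component_eq)+
    then show "f = f'" using cc connected_component_eq by (metis mem_Collect_eq)
  qed
  then have "card \<F> \<le> card (UNIV :: bool set)" by (rule card_inj_on_le) auto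
  then show ?thesis by simp
qed

text \<open>The old face \<open>Om\<close> around the interior of \<open>e\<close> is replaced by
  two faces, one on each side of the curve, and the other faces survive. Working with finite
  families avoids any claim that the set of all faces is finite.\<close>

lemma add_face:
  assumes d: "cdrawing V E p \<gamma>" and e: "e \<in> E" "on_cycle E e"
    and F: "\<F> \<subseteq> components (- carrier V (E - {e}) p \<gamma>)" "finite \<F>"
  shows "\<exists>\<G> \<subseteq> components (- carrier V E p \<gamma>). finite \<G> \<and> card \<F> + 1 \<le> card \<G>"
proof -
  let ?K = "carrier V E p \<gamma>" and ?Ke = "carrier V (E - {e}) p \<gamma>"
  note ei = edge_interior[OF d e(1)]
  have d': "cdrawing V (E - {e}) p \<gamma>"
    by (rule cdrawing_remove[OF d]) blast
  have op: "open (- ?Ke)" using compact_carrier[OF d'] compact_imp_closed by blast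
  obtain I J where IJ: "open I" "open J" "I \<inter> J = {}" "path_image (\<gamma> e) \<subseteq> closure I"
    "path_image (\<gamma> e) \<subseteq> closure J" "(I \<union> J) \<inter> path_image (\<gamma> e) = {}" "- ?K \<subseteq> I \<union> J"
    using cycle_sides[OF d e] by metis
  obtain x0 where x0: "x0 \<in> path_image (\<gamma> e) - p ` e" using ei(1) by blast
  have x0K: "x0 \<in> - ?Ke" using ei(3) x0 by blast
  then obtain r where r: "r > 0" "ball x0 r \<subseteq> - ?Ke" using op open_contains_ball by blast
  define Om where "Om = connected_component_set (- ?Ke) x0"
  have OmC: "Om \<in> components (- ?Ke)" using x0K unfolding Om_def components_def by blast
  have XOm: "path_image (\<gamma> e) - p ` e \<subseteq> Om"
    unfolding Om_def by (rule connected_component_maximal[OF x0 ei(2)]) (use ei(3) in blast)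
  have ballOm: "ball x0 r \<subseteq> Om"
    unfolding Om_def by (rule connected_component_maximal) (use r in auto)
  have "x0 \<in> closure I" "x0 \<in> closure J" using IJ x0 by blast+
  then obtain a b where ab: "a \<in> I" "dist a x0 < r" "b \<in> J" "dist b x0 < r"
    using r(1) closure_approachable by (metis (no_types, opaque_lifting))
  have abB: "a \<in> ball x0 r" "b \<in> ball x0 r" using ab by (auto simp: dist_commute)
  have abK: "a \<in> - ?K" "b \<in> - ?K" using abB r(2) ab IJ(6) ei(4) by blast+
  define fa where "fa = connected_component_set (- ?K) a"
  define fb where "fb = connected_component_set (- ?K) b"
  have fc: "fa \<in> components (- ?K)" "fb \<in> components (- ?K)"
    using abK unfolding fa_def fb_def components_def by blast+
  have mem: "a \<in> fa" "b \<in> fb" using abK unfolding fa_def fb_def by auto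
  have side: "C \<subseteq> I \<or> C \<subseteq> J" if "C \<in> components (- ?K)" for C
  proof (rule ccontr)
    assume n: "\<not> (C \<subseteq> I \<or> C \<subseteq> J)"
    have C: "connected C" "C \<subseteq> I \<union> J" using that in_components_connected in_components_subset IJ(7) by blast+
    have "I \<inter> C \<noteq> {}" "J \<inter> C \<noteq> {}" using n C(2) by blast+
    moreover have "I \<inter> J \<inter> C = {}" using IJ(3) by blast
    ultimately show False using connectedD[OF C(1) IJ(1,2)] C(2) by blast
  qed
  have ne: "fa \<noteq> fb" using side[OF fc(1)] mem ab IJ(3) by blast
  have KeK: "- ?K \<subseteq> - ?Ke" using ei(4) by blast
  have sub: "fa \<subseteq> Om" "fb \<subseteq> Om"
  proof -
    show "fa \<subseteq> Om"
      by (rule components_maximal[OF OmC in_components_connected[OF fc(1)]])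
        (use in_components_subset[OF fc(1)] KeK mem abB ballOm in blast)+
    show "fb \<subseteq> Om"
      by (rule components_maximal[OF OmC in_components_connected[OF fc(2)]])
        (use in_components_subset[OF fc(2)] KeK mem abB ballOm in blast)+
  qed
  \<comment> \<open>A face disjoint from \<open>Om\<close> misses the new arc, whose interior lies
    in \<open>Om\<close>, and a maximal connected subset of the old complement stays maximal in the
    smaller one.\<close>
  have other: "C \<in> components (- ?K) \<and> C \<inter> Om = {}" if C: "C \<in> \<F> - {Om}" for C
  proof -
    have Cc: "C \<in> components (- ?Ke)" using C F(1) by blast
    have dis: "C \<inter> Om = {}" using components_nonoverlap[OF Cc OmC] C by blast
    then have "C \<subseteq> - ?K"
      using in_components_subset[OF Cc] XOm ei(4,5) by blast
    then have "C \<in> components (- ?K)"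
      using in_components_maximal[THEN iffD1, OF Cc] KeK
      unfolding in_components_maximal by (meson subset_trans)
    then show ?thesis using dis by blast
  qed
  let ?G = "(\<F> - {Om}) \<union> {fa, fb}"
  have "fa \<notin> \<F> - {Om}" "fb \<notin> \<F> - {Om}" using other sub mem by blast+
  then have "card ?G = card (\<F> - {Om}) + 2" using F(2) ne by (simp add: card_insert_if)
  moreover have "card \<F> \<le> card (\<F> - {Om}) + 1"
    using F(2) by (metis card_Diff_singleton_if le_diff_conv order_refl diff_le_self add.commute trans_le_add1)
  ultimately have "card \<F> + 1 \<le> card ?G" by linarith
  moreover have "?G \<subseteq> components (- ?K)" using other fc by blast
  ultimately show ?thesis using F(2) by (intro exI[of _ ?G]) auto
qed

text \<open>One half of Euler's formula: each edge on a cycle adds a face when it is put back, and a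
  forest has a face and more vertices than edges.\<close>

lemma many_faces:
  assumes "cdrawing V E p \<gamma>" "V \<noteq> {}"
  shows "\<exists>\<F> \<subseteq> components (- carrier V E p \<gamma>). finite \<F> \<and> card E + 2 \<le> card \<F> + card V"
  using assms
proof (induction "card E" arbitrary: E rule: less_induct)
  case less
  have g: "simple_graph V E" using cdrawingD(1)[OF less.prems(1)] .
  have finE: "finite E" using finite_edges[OF g] .
  show ?case
  proof (cases "\<exists>e\<in>E. on_cycle E e")
    case True
    then obtain e where e: "e \<in> E" "on_cycle E e" by blast
    have c: "card (E - {e}) < card E" using finE e(1) by (rule card_Diff1_less)
    have "cdrawing V (E - {e}) p \<gamma>"
      by (rule cdrawing_remove[OF less.prems(1)]) blast
    then obtain \<F> where F: "\<F> \<subseteq> components (- carrier V (E - {e}) p \<gamma>)" "finite \<F>"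
       "card (E - {e}) + 2 \<le> card \<F> + card V" using less.hyps[OF c] less.prems(2) by blast
    obtain \<G> where "\<G> \<subseteq> components (- carrier V E p \<gamma>)" "finite \<G>" "card \<F> + 1 \<le> card \<G>"
      using add_face[OF less.prems(1) e F(1,2)] by blast
    moreover have "card E = card (E - {e}) + 1" using e finE by (metis Suc_eq_plus1 card_Suc_Diff1)
    ultimately show ?thesis using F(3) by (intro exI[of _ \<G>]) auto
  next
    case False
    have "card E + 1 \<le> card V" using forest_card[OF g less.prems(2)] False by blast
    moreover have "- carrier V E p \<gamma> \<noteq> {}"
      using compact_carrier[OF less.prems(1)] not_compact_UNIV by (metis Compl_empty_eq double_compl)
    then obtain f where "f \<in> components (- carrier V E p \<gamma>)" by (metis components_eq_empty equals0I)
    ultimately show ?thesis by (intro exI[of _ "{f}"]) auto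
  qed
qed

text \<open>A bridge cuts the drawing into \<open>?K1\<close>, the arc \<open>?P\<close> and
  \<open>?K2\<close>, glued at the single points \<open>p x\<close> and \<open>p y\<close>. None of
  the three separates the plane, so by Janiszewski's theorem neither does their union.\<close>

lemma forest_complement_connected:
  assumes "cdrawing V E p \<gamma>" "\<And>e. e \<in> E \<Longrightarrow> \<not> on_cycle E e"
  shows "connected (- carrier V E p \<gamma>)"
  using assms
proof (induction "card E" arbitrary: V E rule: less_induct)
  case less
  have g: "simple_graph V E" using cdrawingD(1)[OF less.prems(1)] .
  have finE: "finite E" using finite_edges[OF g] .
  show ?case
  proof (cases "E = {}")
    case True
    have "finite (p ` V)" using g unfolding simple_graph_def by blast
    then have "connected (- (p ` V))"
      by (intro path_connected_imp_connected path_connected_complement_countable)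
        (auto simp: countable_finite)
    then show ?thesis using True unfolding carrier_def by simp
  next
    case False
    then obtain e where e: "e \<in> E" by blast
    obtain x y V1 V2 E1 E2 where s: "e = {x, y}" "x \<in> V1" "y \<in> V2" "V1 \<union> V2 = V" "V1 \<inter> V2 = {}"
      "E1 \<union> E2 = E - {e}" "E1 \<inter> E2 = {}" "simple_graph V1 E1" "simple_graph V2 E2"
      by (rule bridge_split[OF g e less.prems(2)[OF e]])
    have sub: "E1 \<subset> E" "E2 \<subset> E" using s(6) e by auto
    have c: "card E1 < card E" "card E2 < card E" using sub finE psubset_card_mono by auto
    have d1: "cdrawing V1 E1 p \<gamma>" and d2: "cdrawing V2 E2 p \<gamma>"
      using cdrawing_subgraph[OF less.prems(1)] s(4,8,9) sub by blast+
    let ?K1 = "carrier V1 E1 p \<gamma>" and ?K2 = "carrier V2 E2 p \<gamma>" and ?P = "path_image (\<gamma> e)"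
    have k1: "connected (- ?K1)"
      by (rule less.hyps[OF c(1) d1]) (use less.prems(2) on_cycle_mono sub in blast)
    have k2: "connected (- ?K2)"
      by (rule less.hyps[OF c(2) d2]) (use less.prems(2) on_cycle_mono sub in blast)
    note dr = cdrawingD[OF less.prems(1)]
    note D = dr(2) dr(5)[OF e] dr(7)[OF e] dr(7) dr(8)
    have f1: "f \<subseteq> V1" if "f \<in> E1" for f using s(8) that unfolding simple_graph_def by blast
    have f2: "f \<subseteq> V2" if "f \<in> E2" for f using s(9) that unfolding simple_graph_def by blast
    have K: "carrier V E p \<gamma> = (?K1 \<union> ?P) \<union> ?K2"
    proof -
      have "E = insert e (E1 \<union> E2)" using s(6) e by blast
      then show ?thesis using s(4) unfolding carrier_def by auto
    qed
    have pdis: "p ` V1 \<inter> p ` V2 = {}" using D(1) s(4,5) unfolding inj_on_def by blast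
    have eV: "e \<inter> V1 = {x}" "e \<inter> V2 = {y}" using s(1-3,5) by auto
    have PV: "?P \<inter> p ` V1 = {p x}" "?P \<inter> p ` V2 = {p y}"
    proof -
      have "?P \<inter> p ` V1 = p ` e \<inter> p ` V1" "?P \<inter> p ` V2 = p ` e \<inter> p ` V2" using D(3) s(4) by blast+
      then show "?P \<inter> p ` V1 = {p x}" "?P \<inter> p ` V2 = {p y}" using s(1-3) pdis by auto
    qed
    have 1: "?K1 \<inter> ?P = {p x}"
    proof
      have "path_image (\<gamma> f) \<inter> ?P \<subseteq> {p x}" if "f \<in> E1" for f
      proof -
        have "path_image (\<gamma> f) \<inter> ?P = p ` (f \<inter> e)" using D(5)[of f e] that s(6) e by blast
        moreover have "f \<inter> e \<subseteq> {x}" using f1[OF that] eV by blast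
        ultimately show ?thesis by auto
      qed
      then show "?K1 \<inter> ?P \<subseteq> {p x}" using PV(1) unfolding carrier_def by blast
      show "{p x} \<subseteq> ?K1 \<inter> ?P" using PV(1) s(2) unfolding carrier_def by blast
    qed
    have 2: "?K2 \<inter> ?P = {p y}"
    proof
      have "path_image (\<gamma> f) \<inter> ?P \<subseteq> {p y}" if "f \<in> E2" for f
      proof -
        have "path_image (\<gamma> f) \<inter> ?P = p ` (f \<inter> e)" using D(5)[of f e] that s(6) e by blast
        moreover have "f \<inter> e \<subseteq> {y}" using f2[OF that] eV by blast
        ultimately show ?thesis by auto
      qed
      then show "?K2 \<inter> ?P \<subseteq> {p y}" using PV(2) unfolding carrier_def by blast
      show "{p y} \<subseteq> ?K2 \<inter> ?P" using PV(2) s(3) unfolding carrier_def by blast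
    qed
    have 3: "?K1 \<inter> ?K2 = {}"
    proof -
      have a: "path_image (\<gamma> f) \<inter> p ` V2 = {}" if "f \<in> E1" for f
        using D(4)[of f] that f1[OF that] sub pdis s(4) by blast
      have b: "path_image (\<gamma> f) \<inter> p ` V1 = {}" if "f \<in> E2" for f
        using D(4)[of f] that f2[OF that] sub pdis s(4) by blast
      have c: "path_image (\<gamma> f) \<inter> path_image (\<gamma> f') = {}" if "f \<in> E1" "f' \<in> E2" for f f'
      proof -
        have "f \<inter> f' = {}" using f1 f2 that s(5) by blast
        moreover have "path_image (\<gamma> f) \<inter> path_image (\<gamma> f') = p ` (f \<inter> f')"
          by (rule D(5)) (use that sub s(7) in blast)+
        ultimately show ?thesis by simp
      qed
      show ?thesis unfolding carrier_def using a b c pdis by blast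
    qed
    have comp1: "compact ?K1" "compact ?K2" using compact_carrier d1 d2 by blast+
    have comp2: "compact ?P" using D(2) by (simp add: arc_imp_path compact_path_image)
    have "connected_component (- ((?K1 \<union> ?P) \<union> ?K2)) a b" if "a \<in> - carrier V E p \<gamma>" "b \<in> - carrier V E p \<gamma>" for a b
    proof (rule Janiszewski)
      have ab: "a \<in> - ?K1" "b \<in> - ?K1" "a \<in> - ?K2" "b \<in> - ?K2" "a \<in> - ?P" "b \<in> - ?P"
        using that unfolding K by blast+
      show "compact (?K1 \<union> ?P)" using comp1 comp2 by blast
      show "closed ?K2" using comp1 compact_imp_closed by blast
      have "(?K1 \<union> ?P) \<inter> ?K2 = {p y}" using 2 3 by blast
      then show "connected ((?K1 \<union> ?P) \<inter> ?K2)" by simp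
      show "connected_component (- ?K2) a b" using k2 ab connected_iff_connected_component by blast
      show "connected_component (- (?K1 \<union> ?P)) a b"
      proof (rule Janiszewski)
        show "compact ?K1" "closed ?P" using comp1 comp2 compact_imp_closed by blast+
        show "connected (?K1 \<inter> ?P)" using 1 by simp
        show "connected_component (- ?K1) a b" using k1 ab connected_iff_connected_component by blast
        have "connected (- ?P)" using connected_arc_complement[OF D(2)] by simp
        then show "connected_component (- ?P) a b" using ab connected_iff_connected_component by blast
      qed
    qed
    then show ?thesis unfolding connected_iff_connected_component K by blast
  qed
qed

text \<open>If the edges touching \<open>f\<close> formed a forest, their drawing would have a
  connected complement that contains \<open>f\<close> and misses its frontier, hence equals
  \<open>f\<close>. Then the whole drawing lies in theirs, so every edge touches \<open>f\<close>
  and the forest is all of \<open>E\<close>, against \<open>cyc\<close>.\<close>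

lemma face_contains_cycle:
  assumes d: "cdrawing V E p \<gamma>" and cyc: "\<And>e. e \<in> E \<Longrightarrow> on_cycle E e" and "E \<noteq> {}"
    and f: "f \<in> components (- carrier V E p \<gamma>)"
  shows "\<exists>e. e \<in> {e \<in> E. touches p \<gamma> e f} \<and> on_cycle {e \<in> E. touches p \<gamma> e f} e"
proof (rule ccontr)
  assume n: "\<not> ?thesis"
  let ?F = "{e \<in> E. touches p \<gamma> e f}"
  let ?K = "carrier V E p \<gamma>" and ?KF = "carrier V ?F p \<gamma>"
  have dF: "cdrawing V ?F p \<gamma>"
    by (rule cdrawing_remove[OF d]) blast
  have conn: "connected (- ?KF)" by (rule forest_complement_connected[OF dF]) (use n in blast)
  have KF: "?KF \<subseteq> ?K" unfolding carrier_def by auto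
  have fK: "f \<subseteq> - ?KF" "f \<noteq> {}" using in_components_subset[OF f] in_components_nonempty[OF f] KF by blast+
  have cl: "closed ?K" using compact_carrier[OF d] compact_imp_closed by blast
  have "frontier f \<inter> - ?KF = {}"
  proof (rule ccontr)
    assume "frontier f \<inter> - ?KF \<noteq> {}"
    then obtain z where z: "z \<in> frontier f" "z \<notin> ?KF" by blast
    have "z \<in> ?K" using frontier_of_components_closed_complement[OF cl f] z by blast
    then obtain e where e: "e \<in> E" "z \<in> path_image (\<gamma> e)" using z(2) unfolding carrier_def by blast
    have "e \<notin> ?F" using e z(2) unfolding carrier_def by blast
    then have "z \<in> p ` e" using e z(1) unfolding touches_def frontier_def by blast
    moreover have "e \<subseteq> V" using cdrawingD(9)[OF d e(1)] .
    ultimately show False using z(2) unfolding carrier_def by blast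
  qed
  then have "- ?KF \<subseteq> f" using connected_Int_frontier[OF conn, of f] fK by blast
  then have KKF: "?K \<subseteq> ?KF" using in_components_subset[OF f] by blast
  have "?F \<noteq> E"
  proof
    assume eq: "?F = E"
    obtain e where e: "e \<in> E" using \<open>E \<noteq> {}\<close> by blast
    then have "e \<in> ?F \<and> on_cycle ?F e" using cyc[OF e] unfolding eq by simp
    then show False using n by blast
  qed
  then obtain e where e: "e \<in> E" "e \<notin> ?F" by blast
  have "?KF \<subseteq> carrier V (E - {e}) p \<gamma>" using e unfolding carrier_def by blast
  moreover have "path_image (\<gamma> e) \<subseteq> ?K" using e unfolding carrier_def by blast
  ultimately show False using edge_interior(1,3)[OF d e(1)] KKF by blast
qed

text \<open>Double counting of touching pairs: at least \<open>g\<close> edges for each face, at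
  most two faces for each edge. Both facts concern edges on cycles, so bridges are split off first.
  Euler's inequality would give \<open>2 * g\<close> on the left; the weaker \<open>g\<close> also
  covers a single vertex and adds up exactly when two parts are joined by a bridge.\<close>

lemma cdrawing_card:
  assumes "cdrawing V E p \<gamma>" "V \<noteq> {}"
    and girth: "\<And>F e. F \<subseteq> E \<Longrightarrow> e \<in> F \<Longrightarrow> on_cycle F e \<Longrightarrow> g \<le> card F"
  shows "g * card E + g \<le> g * card V + 2 * card E"
  using assms
proof (induction "card E" arbitrary: V E rule: less_induct)
  case less
  have gr: "simple_graph V E" using cdrawingD(1)[OF less.prems(1)] .
  have finE: "finite E" using finite_edges[OF gr] .
  have finV: "finite V" using gr unfolding simple_graph_def by blast
  show ?case
  proof (cases "\<exists>e\<in>E. \<not> on_cycle E e")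
    case True
    then obtain e where e: "e \<in> E" "\<not> on_cycle E e" by blast
    obtain x y V1 V2 E1 E2 where s: "e = {x, y}" "x \<in> V1" "y \<in> V2" "V1 \<union> V2 = V" "V1 \<inter> V2 = {}"
      "E1 \<union> E2 = E - {e}" "E1 \<inter> E2 = {}" "simple_graph V1 E1" "simple_graph V2 E2"
      by (rule bridge_split[OF gr e])
    have sub: "E1 \<subset> E" "E2 \<subset> E" using s(6) e by auto
    have c: "card E1 < card E" "card E2 < card E" using sub finE psubset_card_mono by auto
    have d1: "cdrawing V1 E1 p \<gamma>" and d2: "cdrawing V2 E2 p \<gamma>"
      using cdrawing_subgraph[OF less.prems(1)] s(4,8,9) sub by blast+
    have 1: "g * card E1 + g \<le> g * card V1 + 2 * card E1"
    proof (rule less.hyps[OF c(1) d1])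
      show "g \<le> card F" if "F \<subseteq> E1" "e \<in> F" "on_cycle F e" for F e
        by (rule less.prems(3)[OF _ that(2,3)]) (use that(1) sub in auto)
    qed (use s(2) in auto)
    have 2: "g * card E2 + g \<le> g * card V2 + 2 * card E2"
    proof (rule less.hyps[OF c(2) d2])
      show "g \<le> card F" if "F \<subseteq> E2" "e \<in> F" "on_cycle F e" for F e
        by (rule less.prems(3)[OF _ that(2,3)]) (use that(1) sub in auto)
    qed (use s(3) in auto)
    have "card (E - {e}) = card E1 + card E2"
      using s(6,7) finE by (metis card_Un_disjoint finite_Diff finite_Un)
    then have 3: "card E = card E1 + card E2 + 1" using e finE by (metis Suc_eq_plus1 card_Suc_Diff1)
    have 4: "card V = card V1 + card V2"
      using s(4,5) finV by (metis card_Un_disjoint finite_Un)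
    show ?thesis using 1 2 unfolding 3 4 by (simp add: algebra_simps)
  next
    case False
    then have cyc: "\<And>e. e \<in> E \<Longrightarrow> on_cycle E e" by blast
    show ?thesis
    proof (cases "E = {}")
      case True
      then show ?thesis using finV less.prems(2) by (simp add: Suc_leI card_gt_0_iff)
    next
      case False
      obtain \<F> where F: "\<F> \<subseteq> components (- carrier V E p \<gamma>)" "finite \<F>" "card E + 2 \<le> card \<F> + card V"
        using many_faces[OF less.prems(1,2)] by blast
      have "g * card \<F> \<le> (\<Sum>f\<in>\<F>. card {e \<in> E. touches p \<gamma> e f})"
      proof -
        have "g \<le> card {e \<in> E. touches p \<gamma> e f}" if "f \<in> \<F>" for f
        proof -
          have "f \<in> components (- carrier V E p \<gamma>)" using F(1) that by blast
          from face_contains_cycle[OF less.prems(1) cyc False this] show ?thesis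
            using less.prems(3)[of "{e \<in> E. touches p \<gamma> e f}"] by blast
        qed
        then have "(\<Sum>f\<in>\<F>. g) \<le> (\<Sum>f\<in>\<F>. card {e \<in> E. touches p \<gamma> e f})" by (intro sum_mono) blast
        then show ?thesis by (simp add: mult.commute)
      qed
      also have "\<dots> = (\<Sum>e\<in>E. card {f \<in> \<F>. touches p \<gamma> e f})"
        using F(2) finE by (intro sum_multicount_gen) auto
      also have "\<dots> \<le> (\<Sum>e\<in>E. 2)"
        by (intro sum_mono edge_faces_le_2[OF less.prems(1)]) (use cyc F(1) in auto)
      finally have 5: "g * card \<F> \<le> 2 * card E" by simp
      have "g * (card E + 2) \<le> g * (card \<F> + card V)" using F(3) by (rule mult_le_mono2)
      then show ?thesis using 5 by (simp add: algebra_simps)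
    qed
  qed
qed

text \<open>An injective linear map carries the drawing from \<open>real ^ 2\<close> to
  \<open>complex\<close>, the type in which the Jordan curve theorem and Janiszewski's theorem are
  stated.\<close>

lemma planar_cdrawing:
  assumes "simple_graph V E" "planar V E"
  obtains p \<gamma> where "cdrawing V E p \<gamma>"
proof -
  obtain p \<gamma> where d: "plane_drawing V E p \<gamma>" using assms(2) unfolding planar_def by blast
  define h where "h v = Complex (v $ 1) (v $ 2)" for v :: "real ^ 2"
  have lin: "linear h"
    by (rule linearI) (auto simp: h_def complex_eq_iff)
  have inj: "inj h"
    by (rule injI) (auto simp: h_def vec_eq_iff forall_2)
  have inj': "h x = h y \<longleftrightarrow> x = y" for x y using inj by (auto dest: injD)
  have im: "h ` A \<inter> h ` B = h ` (A \<inter> B)" for A B using inj by (simp add: image_Int)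
  have "cdrawing V E (h \<circ> p) (\<lambda>e. h \<circ> \<gamma> e)"
    unfolding cdrawing_def
  proof (intro conjI ballI impI)
    show "simple_graph V E" by fact
    show "inj_on (h \<circ> p) V" using d inj unfolding plane_drawing_def inj_on_def by (auto simp: inj')
    fix e assume e: "e \<in> E"
    have e': "arc (\<gamma> e)" "{pathstart (\<gamma> e), pathfinish (\<gamma> e)} = p ` e"
        "path_image (\<gamma> e) \<inter> p ` V = p ` e"
      using d e unfolding plane_drawing_def by blast+
    show "arc (h \<circ> \<gamma> e)" using e'(1) arc_linear_image_eq[OF lin inj] by blast
    have "{pathstart (h \<circ> \<gamma> e), pathfinish (h \<circ> \<gamma> e)} = h ` {pathstart (\<gamma> e), pathfinish (\<gamma> e)}"
      by (simp add: pathstart_def pathfinish_def)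
    then show "{pathstart (h \<circ> \<gamma> e), pathfinish (h \<circ> \<gamma> e)} = (h \<circ> p) ` e"
      unfolding e'(2) by (simp add: image_comp)
    show "path_image (h \<circ> \<gamma> e) \<inter> (h \<circ> p) ` V = (h \<circ> p) ` e"
      unfolding path_image_compose image_comp[symmetric] im e'(3) ..
    fix f assume "f \<in> E" "e \<noteq> f"
    then have "path_image (\<gamma> e) \<inter> path_image (\<gamma> f) = p ` (e \<inter> f)"
      using d e unfolding plane_drawing_def by blast
    then show "path_image (h \<circ> \<gamma> e) \<inter> path_image (h \<circ> \<gamma> f) = (h \<circ> p) ` (e \<inter> f)"
      unfolding path_image_compose im by (simp add: image_comp)
  qed
  then show ?thesis using that by blast
qed

section \<open>Cycle lengths and edge bounds of planar graphs\<close>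

lemma edge_rel_ends:
  assumes "(x, y) \<in> (edge_rel F)\<^sup>*" "x \<noteq> y"
  obtains z z' where "{x, z} \<in> F" "{z', y} \<in> F"
  using assms by (metis (no_types, lifting) case_prodD converse_rtranclE mem_Collect_eq rtranclE)

text \<open>The closing walk leaves \<open>x\<close> and enters \<open>y\<close> by edges other than
  \<open>e\<close>, and these differ, since a single edge doing both would be
  \<open>e\<close>.\<close>

lemma cycle_card_3:
  assumes g: "simple_graph V E" and F: "F \<subseteq> E" "e \<in> F" "on_cycle F e"
  shows "3 \<le> card F"
proof -
  obtain x y where xy: "e = {x, y}" "(x, y) \<in> (edge_rel (F - {e}))\<^sup>*"
    using F(3) unfolding on_cycle_def by blast
  have ne: "x \<noteq> y" using g F xy(1) unfolding simple_graph_def by fastforce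
  obtain z z' where z: "{x, z} \<in> F - {e}" "{z', y} \<in> F - {e}" using edge_rel_ends[OF xy(2) ne] by blast
  have 1: "{x, z} \<noteq> {z', y}" using z xy(1) ne by (auto simp: doubleton_eq_iff insert_commute)
  have finF: "finite F" using finite_edges[OF g] F(1) finite_subset by blast
  have "card {{x, z}, {z', y}, e} = 3" using 1 z by (simp add: card_insert_if)
  moreover have "card {{x, z}, {z', y}, e} \<le> card F" using z F finF by (intro card_mono) auto
  ultimately show ?thesis by simp
qed

text \<open>With three edges only, the other two are \<open>{x, z}\<close> and
  \<open>{z', y}\<close>. Bipartiteness puts \<open>z\<close> on the side of \<open>y\<close> and
  \<open>z'\<close> on the side of \<open>x\<close>, so these two edges are disjoint and a walk from
  \<open>x\<close> is stuck in \<open>{x, z}\<close>.\<close>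

lemma cycle_card_4:
  assumes g: "simple_graph V E" and bip: "\<And>f a b. f \<in> E \<Longrightarrow> f = {a, b} \<Longrightarrow> a \<in> A \<longleftrightarrow> b \<notin> A"
    and F: "F \<subseteq> E" "e \<in> F" "on_cycle F e"
  shows "4 \<le> card F"
proof (rule ccontr)
  assume "\<not> 4 \<le> card F"
  obtain x y where xy: "e = {x, y}" "(x, y) \<in> (edge_rel (F - {e}))\<^sup>*"
    using F(3) unfolding on_cycle_def by blast
  have ne: "x \<noteq> y" using g F xy(1) unfolding simple_graph_def by fastforce
  obtain z z' where z: "{x, z} \<in> F - {e}" "{z', y} \<in> F - {e}" using edge_rel_ends[OF xy(2) ne] by blast
  have 1: "{x, z} \<noteq> {z', y}" using z xy(1) ne by (auto simp: doubleton_eq_iff insert_commute)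
  have finF: "finite F" using finite_edges[OF g] F(1) finite_subset by blast
  have c3: "card {{x, z}, {z', y}, e} = 3" using 1 z by (simp add: card_insert_if)
  have sub: "{{x, z}, {z', y}, e} \<subseteq> F" using z F by auto
  have Feq: "F = {{x, z}, {z', y}, e}"
    using card_seteq[OF finF sub] c3 \<open>\<not> 4 \<le> card F\<close> by auto
  have A: "x \<in> A \<longleftrightarrow> y \<notin> A" "x \<in> A \<longleftrightarrow> z \<notin> A" "z' \<in> A \<longleftrightarrow> y \<notin> A"
    using bip[of e x y] bip[of "{x, z}" x z] bip[of "{z', y}" z' y] F z xy(1) by auto
  have nz: "z \<noteq> y" "z' \<noteq> x" using z xy(1) by (auto simp: insert_commute)
  have "w = x \<or> w = z" if "(x, w) \<in> (edge_rel (F - {e}))\<^sup>*" for w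
    using that
  proof (induction rule: rtrancl_induct)
    case (step v w)
    have "{v, w} \<in> {{x, z}, {z', y}}" using step.hyps(2) Feq by auto
    then show ?case using step.IH A nz by (auto simp: doubleton_eq_iff)
  qed simp
  then have "y = x \<or> y = z" using xy(2) by blast
  then show False using ne nz by auto
qed

lemma planar_card:
  assumes "simple_graph V E" "planar V E" "V \<noteq> {}"
  shows "card E + 3 \<le> 3 * card V"
proof -
  obtain p \<gamma> where "cdrawing V E p \<gamma>" using planar_cdrawing assms(1,2) by blast
  from cdrawing_card[OF this assms(3), of 3] cycle_card_3[OF assms(1)] show ?thesis by auto
qed

lemma planar_bipartite_card:
  assumes "simple_graph V E" "planar V E" "\<And>f a b. f \<in> E \<Longrightarrow> f = {a, b} \<Longrightarrow> a \<in> A \<longleftrightarrow> b \<notin> A"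
  shows "card E \<le> 2 * card V"
proof (cases "V = {}")
  case True
  then have "E = {}" using assms(1) unfolding simple_graph_def by fastforce
  then show ?thesis by simp
next
  case False
  obtain p \<gamma> where "cdrawing V E p \<gamma>" using planar_cdrawing assms(1,2) by blast
  from cdrawing_card[OF this False, of 4] cycle_card_4[OF assms(1,3)] show ?thesis by auto
qed

lemma planar_subgraph:
  assumes "planar V E" "V' \<subseteq> V" "E' \<subseteq> E" "\<And>e. e \<in> E' \<Longrightarrow> e \<subseteq> V'"
  shows "planar V' E'"
proof -
  obtain p \<gamma> where d: "plane_drawing V E p \<gamma>" using assms(1) unfolding planar_def by blast
  have d1: "inj_on p V"
    and d2: "\<And>e. e \<in> E \<Longrightarrow> arc (\<gamma> e) \<and> {pathstart (\<gamma> e), pathfinish (\<gamma> e)} = p ` e \<and>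
        path_image (\<gamma> e) \<inter> p ` V = p ` e"
    and d3: "\<And>e f. e \<in> E \<Longrightarrow> f \<in> E \<Longrightarrow> e \<noteq> f \<Longrightarrow> path_image (\<gamma> e) \<inter> path_image (\<gamma> f) = p ` (e \<inter> f)"
    using d by (simp_all add: plane_drawing_def)
  have "path_image (\<gamma> e) \<inter> p ` V' = p ` e" if e: "e \<in> E'" for e
  proof -
    have "path_image (\<gamma> e) \<inter> p ` V = p ` e" using d2[of e] assms(3) e by blast
    then show ?thesis using assms(2) assms(4)[OF e] by blast
  qed
  moreover have "inj_on p V'" using d1 assms(2) by (rule inj_on_subset)
  moreover have "e \<in> E" if "e \<in> E'" for e using that assms(3) by blast
  ultimately have "plane_drawing V' E' p \<gamma>" using d2 d3 by (simp add: plane_drawing_def)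
  then show ?thesis unfolding planar_def by blast
qed

section \<open>Counting the vertices of degree 2 and of degree \<open>k\<close>\<close>

lemma sum_vertex_degree:
  assumes "finite E" "finite A"
  shows "(\<Sum>v\<in>A. vertex_degree E v) = (\<Sum>e\<in>E. card (e \<inter> A))"
proof -
  have "(\<Sum>v\<in>A. card {e \<in> E. v \<in> e}) = (\<Sum>e\<in>E. card {v \<in> A. v \<in> e})"
    using assms by (intro sum_multicount_gen) auto
  moreover have "{v \<in> A. v \<in> e} = e \<inter> A" for e by auto
  ultimately show ?thesis by (simp add: vertex_degree_def)
qed

lemma sum_vertex_degree_independent:
  assumes "finite E" "finite A" "\<And>e. e \<in> E \<Longrightarrow> card (e \<inter> A) \<le> 1"
  shows "(\<Sum>v\<in>A. vertex_degree E v) = card {e \<in> E. e \<inter> A \<noteq> {}}"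
proof -
  have "card (e \<inter> A) = (if e \<inter> A \<noteq> {} then 1 else 0)" if "e \<in> E" for e
    using assms(2) assms(3)[OF that] card_gt_0_iff[of "e \<inter> A"] by auto
  then have "(\<Sum>e\<in>E. card (e \<inter> A)) = (\<Sum>e\<in>E. if e \<inter> A \<noteq> {} then 1 else 0)"
    by (intro sum.cong) auto
  also have "\<dots> = card {e \<in> E. e \<inter> A \<noteq> {}}"
    using assms(1) by (simp add: sum.If_cases Int_def)
  finally show ?thesis using sum_vertex_degree[OF assms(1,2)] by simp
qed

text \<open>Vertices of degree at most 5 are pairwise nonadjacent and see only very large vertices,
  so the edges at them form sparse bipartite graphs. The graph without 2-vertices is sparse as well.
  Hence the large degrees can only be produced by many edges to 2-vertices.\<close>

lemma many_2_vertices: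
  assumes g: "simple_graph V E" and pl: "planar V E" and ne: "E \<noteq> {}" and k: "15 \<le> k"
    and le: "\<And>v. v \<in> V \<Longrightarrow> vertex_degree E v \<le> k"
    and heavy: "\<And>x y. {x, y} \<in> E \<Longrightarrow> k + 2 \<le> vertex_degree E x + vertex_degree E y"
  shows "3 * card {v \<in> V. vertex_degree E v = k} < 2 * card {v \<in> V. vertex_degree E v = 2}"
proof -
  let ?d = "vertex_degree E"
  have finV: "finite V" using g by (simp add: simple_graph_def)
  have finE: "finite E" using finite_edges[OF g] .
  have edge: "\<exists>x y. e = {x, y} \<and> x \<noteq> y \<and> x \<in> V \<and> y \<in> V" if "e \<in> E" for e
  proof -
    have "card e = 2" "e \<subseteq> V" using g that by (auto simp: simple_graph_def)
    then show ?thesis by (auto simp: card_2_iff)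
  qed
  define N where "N j = {v \<in> V. ?d v = j}" for j
  \<comment> \<open>By \<open>heavy\<close>, every neighbor of a vertex of degree at most
    \<open>j\<close> lies in \<open>W j\<close>.\<close>
  define W where "W j = {v \<in> V. k + 2 - j \<le> ?d v}" for j
  define B where "B = {v \<in> V. 6 \<le> ?d v}"
  have finN: "finite (N j)" "finite (W j)" "finite B" for j using finV by (auto simp: N_def W_def B_def)
  have small_indep: "card (e \<inter> {v \<in> V. ?d v \<le> 5}) \<le> 1" if eE: "e \<in> E" for e
  proof -
    obtain x y where xy: "e = {x, y}" "x \<noteq> y" using edge[OF eE] by blast
    have "k + 2 \<le> ?d x + ?d y" using heavy[of x y] eE xy by simp
    then have "e \<inter> {v \<in> V. ?d v \<le> 5} \<subseteq> {x} \<or> e \<inter> {v \<in> V. ?d v \<le> 5} \<subseteq> {y}" using xy k by auto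
    then show ?thesis using card_mono[of "{x}"] card_mono[of "{y}"] by fastforce
  qed
  have indep: "card (e \<inter> A) \<le> 1" if "e \<in> E" "A \<subseteq> {v \<in> V. ?d v \<le> 5}" for e A
  proof -
    have "card (e \<inter> A) \<le> card (e \<inter> {v \<in> V. ?d v \<le> 5})"
      using that finV by (intro card_mono) auto
    then show ?thesis using small_indep[OF that(1)] by linarith
  qed
  have pos: "2 \<le> ?d v" if ve: "v \<in> V" "v \<in> e" "e \<in> E" for v e
  proof -
    obtain y where y: "e = {v, y}" "y \<in> V" using edge[OF ve(3)] ve(2) by (auto simp: insert_commute)
    then have "k + 2 \<le> ?d v + ?d y" using heavy[of v y] ve by simp
    then show ?thesis using le[OF y(2)] by linarith
  qed
  \<comment> \<open>All edges at \<open>S\<close> lead to \<open>W j\<close> and none joins two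
    vertices of \<open>S\<close>, so the degree sum is the number of edges of a planar bipartite
    graph.\<close>
  have bip: "(\<Sum>v\<in>S. ?d v) \<le> 2 * (card S + card (W j))"
    if S: "S = {v \<in> V. 3 \<le> ?d v \<and> ?d v \<le> j}" and j: "j \<le> 5" for S j
  proof -
    have sub: "S \<subseteq> {v \<in> V. ?d v \<le> 5}" using S j by auto
    have finS: "finite S" using S finV by auto
    let ?F = "{e \<in> E. e \<inter> S \<noteq> {}}"
    have SW: "S \<inter> W j = {}" using S j k unfolding W_def by auto
    have FW: "(a \<in> S \<and> b \<in> W j) \<or> (a \<in> W j \<and> b \<in> S)" if F: "{a, b} \<in> ?F" for a b
    proof -
      have h: "k + 2 \<le> ?d a + ?d b" using heavy[of a b] F by simp
      have V: "a \<in> V" "b \<in> V" using F g by (auto simp: simple_graph_def)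
      have "a \<in> S \<or> b \<in> S" using F by auto
      then show ?thesis using h V S unfolding W_def by auto
    qed
    have F2: "e \<subseteq> S \<union> W j" if eF: "e \<in> ?F" for e
    proof -
      obtain x y where "e = {x, y}" using edge eF by blast
      then show ?thesis using FW[of x y] eF by auto
    qed
    have gF: "simple_graph (S \<union> W j) ?F" using F2 g finS finN by (auto simp: simple_graph_def)
    have "planar (S \<union> W j) ?F"
      by (rule planar_subgraph[OF pl]) (use F2 S in \<open>auto simp: W_def\<close>)
    then have "card ?F \<le> 2 * card (S \<union> W j)"
      by (rule planar_bipartite_card[OF gF, where A = S]) (use FW SW in blast)
    moreover have "card (S \<union> W j) = card S + card (W j)" using finS finN SW by (simp add: card_Un_disjoint)
    moreover have "(\<Sum>v\<in>S. ?d v) = card ?F"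
      by (rule sum_vertex_degree_independent[OF finE finS]) (rule indep[OF _ sub])
    ultimately show ?thesis by simp
  qed
  have sumN: "(\<Sum>v\<in>N j. ?d v) = j * card (N j)" for j
    by (simp add: N_def)
  have dis: "N i \<inter> N j = {}" if "i \<noteq> j" for i j using that by (auto simp: N_def)
  have disB: "N j \<inter> B = {}" if "j \<le> 5" for j using that by (auto simp: N_def B_def)
  have S3: "{v \<in> V. 3 \<le> ?d v \<and> ?d v \<le> 3} = N 3" by (auto simp: N_def)
  have S4: "{v \<in> V. 3 \<le> ?d v \<and> ?d v \<le> 4} = N 3 \<union> N 4" by (auto simp: N_def)
  have S5: "{v \<in> V. 3 \<le> ?d v \<and> ?d v \<le> 5} = (N 3 \<union> N 4) \<union> N 5" by (auto simp: N_def)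
  have d34: "N 3 \<inter> N 4 = {}" "(N 3 \<union> N 4) \<inter> N 5 = {}" "(N 3 \<union> N 4 \<union> N 5) \<inter> B = {}"
    using dis[of 3 4] dis[of 3 5] dis[of 4 5] disB[of 3] disB[of 4] disB[of 5] by auto
  have c4: "card (N 3 \<union> N 4) = card (N 3) + card (N 4)"
    "(\<Sum>v\<in>N 3 \<union> N 4. ?d v) = 3 * card (N 3) + 4 * card (N 4)"
    using d34(1) finN by (simp_all add: card_Un_disjoint sum.union_disjoint sumN)
  have c5: "card (N 3 \<union> N 4 \<union> N 5) = card (N 3) + card (N 4) + card (N 5)"
    "(\<Sum>v\<in>N 3 \<union> N 4 \<union> N 5. ?d v) = 3 * card (N 3) + 4 * card (N 4) + 5 * card (N 5)"
    using d34(2) finN c4 by (simp_all add: card_Un_disjoint sum.union_disjoint sumN)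
  have b3: "3 * card (N 3) \<le> 2 * (card (N 3) + card (W 3))"
    using bip[OF refl, of 3] sumN[of 3] unfolding S3 by simp
  have b4: "3 * card (N 3) + 4 * card (N 4) \<le> 2 * (card (N 3) + card (N 4) + card (W 4))"
    using bip[OF refl, of 4] c4 unfolding S4 by simp
  have b5: "3 * card (N 3) + 4 * card (N 4) + 5 * card (N 5) \<le>
      2 * (card (N 3) + card (N 4) + card (N 5) + card (W 5))"
    using bip[OF refl, of 5] c5 unfolding S5 by simp
  \<comment> \<open>The end of an edge has degree at least 2 by \<open>pos\<close>, so only
    2-vertices and isolated vertices are left out. Each 2-vertex takes away two edges whose other
    ends remain in \<open>V1\<close>.\<close>
  define V1 where "V1 = {v \<in> V. 3 \<le> ?d v}"
  define E1 where "E1 = {e \<in> E. e \<subseteq> V1}"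
  have V1: "V1 = N 3 \<union> N 4 \<union> N 5 \<union> B" by (auto simp: V1_def N_def B_def)
  have finV1: "finite V1" using finV by (simp add: V1_def)
  have cV1: "card V1 = card (N 3) + card (N 4) + card (N 5) + card B"
    unfolding V1 using d34(3) finN c5 by (simp add: card_Un_disjoint)
  have sV1: "(\<Sum>v\<in>V1. ?d v) = 3 * card (N 3) + 4 * card (N 4) + 5 * card (N 5) + (\<Sum>v\<in>B. ?d v)"
    unfolding V1 using d34(3) finN c5 by (simp add: sum.union_disjoint)
  have E2: "E - E1 = {e \<in> E. e \<inter> N 2 \<noteq> {}}"
  proof -
    have "e \<subseteq> V1 \<longleftrightarrow> e \<inter> N 2 = {}" if e: "e \<in> E" for e
    proof -
      have "e \<subseteq> V" using g e by (simp add: simple_graph_def)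
      then have "2 \<le> ?d v" if "v \<in> e" for v using pos[OF _ that e] that by blast
      then have "3 \<le> ?d v \<longleftrightarrow> ?d v \<noteq> 2" if "v \<in> e" for v using that by fastforce
      then show ?thesis using \<open>e \<subseteq> V\<close> unfolding V1_def N_def by blast
    qed
    then show ?thesis unfolding E1_def by blast
  qed
  have finE1: "finite E1" using finE by (simp add: E1_def)
  have cE2: "card (E - E1) = 2 * card (N 2)"
  proof -
    have "(\<Sum>v\<in>N 2. ?d v) = card {e \<in> E. e \<inter> N 2 \<noteq> {}}"
      by (rule sum_vertex_degree_independent[OF finE finN(1)]) (rule indep, auto simp: N_def)
    then show ?thesis unfolding E2 sumN by simp
  qed
  have V1ne: "V1 \<noteq> {}"
  proof -
    obtain e where e: "e \<in> E" using ne by blast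
    then obtain x y where xy: "e = {x, y}" "x \<in> V" "y \<in> V" using edge by blast
    then have "k + 2 \<le> ?d x + ?d y" using heavy[of x y] e by simp
    then have "3 \<le> ?d x \<or> 3 \<le> ?d y" using k by auto
    then show ?thesis using xy unfolding V1_def by blast
  qed
  have bE1: "card E1 + 3 \<le> 3 * card V1"
  proof (rule planar_card[OF _ _ V1ne])
    show "simple_graph V1 E1" using g finV1 by (auto simp: simple_graph_def E1_def)
    show "planar V1 E1" by (rule planar_subgraph[OF pl]) (auto simp: V1_def E1_def)
  qed
  have sum1: "(\<Sum>v\<in>V1. ?d v) = 2 * card E1 + 2 * card (N 2)"
  proof -
    have 1: "card (e \<inter> V1) = 2" if "e \<in> E1" for e
    proof -
      have "card e = 2" "e \<inter> V1 = e" using that g by (auto simp: E1_def simple_graph_def)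
      then show ?thesis by simp
    qed
    have 2: "card (e \<inter> V1) = 1" if e: "e \<in> E - E1" for e
    proof -
      obtain x y where xy: "e = {x, y}" "x \<noteq> y" "x \<in> V" "y \<in> V" using edge[of e] e by blast
      have h: "k + 2 \<le> ?d x + ?d y" using heavy[of x y] e xy by auto
      have "e \<inter> N 2 \<noteq> {}" using e unfolding E2 by blast
      then have "e \<inter> V1 = {x} \<or> e \<inter> V1 = {y}" using xy h k unfolding N_def V1_def by auto
      then show ?thesis by auto
    qed
    have "(\<Sum>v\<in>V1. ?d v) = (\<Sum>e\<in>E. card (e \<inter> V1))" by (rule sum_vertex_degree[OF finE finV1])
    also have "\<dots> = (\<Sum>e\<in>E - E1. card (e \<inter> V1)) + (\<Sum>e\<in>E1. card (e \<inter> V1))"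
      using finE by (intro sum.subset_diff) (auto simp: E1_def)
    also have "\<dots> = card (E - E1) + 2 * card E1" using 1 2 by simp
    finally show ?thesis using cE2 by simp
  qed
  have WB: "W j \<subseteq> B" if "j \<le> 5" for j using that k by (auto simp: W_def B_def)
  have count: "(\<Sum>v\<in>B. if v \<in> W j then (1::nat) else 0) = card (W j)" if "j \<le> 5" for j
  proof -
    have "(\<Sum>v\<in>B. if v \<in> W j then (1::nat) else 0) = card (B \<inter> W j)"
      using finN(3) by (simp add: sum.If_cases)
    then show ?thesis using WB[OF that] by (simp add: Int_absorb1)
  qed
  \<comment> \<open>Weights for the elimination below. The nested sets \<open>W 5\<close>,
    \<open>W 4\<close>, \<open>W 3\<close>, \<open>W 2\<close> have thresholds at least 12, 13, 14,
    15, and these are the sums of 6 with the successive weights 6, 1, 1, 1.\<close>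
  have "6 * card B + 6 * card (W 5) + card (W 4) + card (W 3) + card (W 2) =
    (\<Sum>v\<in>B. 6 + 6 * (if v \<in> W 5 then 1 else 0) + (if v \<in> W 4 then 1 else 0) +
       (if v \<in> W 3 then 1 else 0) + (if v \<in> W 2 then 1 else 0))"
    using count[of 5] count[of 4] count[of 3] count[of 2]
    by (simp only: sum.distrib sum_distrib_left[symmetric] sum_constant) simp
  also have "\<dots> \<le> (\<Sum>v\<in>B. ?d v)"
    by (rule sum_mono) (use k in \<open>auto simp: B_def W_def\<close>) \<comment> \<open>needs \<open>k - 3 \<ge> 12\<close>\<close>
  finally have low: "6 * card B + 6 * card (W 5) + card (W 4) + card (W 3) + card (W 2) \<le> (\<Sum>v\<in>B. ?d v)" .
  have mono: "card (W 2) \<le> card (W 3)" "card (W 3) \<le> card (W 4)" "card (W 4) \<le> card (W 5)"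
    using finV by (auto intro!: card_mono simp: W_def)
  have W2: "W 2 = {v \<in> V. ?d v = k}" using le by (auto simp: W_def intro: le_antisym)
  \<comment> \<open>Eliminating \<open>m\<close> and \<open>q\<close> gives
    \<open>2 * a \<ge> 6 + 6 * w5 + w4 + w3 + w2 - (3 * b + 2 * c + d)\<close>. The first three
    hypotheses with weights 2, 2/3, 1/3 bound the bracket by
    \<open>4 * w3 + 4/3 * w4 + 2/3 * w5\<close>, and monotonicity of the \<open>w\<close> leaves
    \<open>2 * a \<ge> 6 + 3 * w2\<close>. The reals provide the fractions and the
    subtraction.\<close>
  have arith: "3 * w2 < 2 * a" if "3 * b \<le> 2 * (b + w3)" "3 * b + 4 * c \<le> 2 * (b + c + w4)"
      "3 * b + 4 * c + 5 * d \<le> 2 * (b + c + d + w5)" "m + 3 \<le> 3 * (b + c + d + t)"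
      "3 * b + 4 * c + 5 * d + q = 2 * m + 2 * a" "6 * t + 6 * w5 + w4 + w3 + w2 \<le> q"
      "w2 \<le> w3" "w3 \<le> w4" "w4 \<le> w5" for a b c d m q t w2 w3 w4 w5 :: nat
  proof -
    have r: "3 * w2 < 2 * a" if "3 * b \<le> 2 * (b + w3)" "3 * b + 4 * c \<le> 2 * (b + c + w4)"
      "3 * b + 4 * c + 5 * d \<le> 2 * (b + c + d + w5)" "m + 3 \<le> 3 * (b + c + d + t)"
      "3 * b + 4 * c + 5 * d + q = 2 * m + 2 * a" "6 * t + 6 * w5 + w4 + w3 + w2 \<le> q"
      "w2 \<le> w3" "w3 \<le> w4" "w4 \<le> w5" for a b c d m q t w2 w3 w4 w5 :: real
      using that by (smt (verit))
    have "3 * real w2 < 2 * real a"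
      by (rule r[of b w3 c w4 d w5 m t q])
       (rule of_nat_mono[OF that(1), where 'a = real, unfolded of_nat_add of_nat_mult of_nat_numeral],
        rule of_nat_mono[OF that(2), where 'a = real, unfolded of_nat_add of_nat_mult of_nat_numeral],
        rule of_nat_mono[OF that(3), where 'a = real, unfolded of_nat_add of_nat_mult of_nat_numeral],
        rule of_nat_mono[OF that(4), where 'a = real, unfolded of_nat_add of_nat_mult of_nat_numeral],
        rule arg_cong[OF that(5), of real, unfolded of_nat_add of_nat_mult of_nat_numeral],
        rule of_nat_mono[OF that(6), where 'a = real, unfolded of_nat_add of_nat_mult of_nat_numeral],
        rule of_nat_mono[OF that(7), where 'a = real, unfolded of_nat_add of_nat_mult of_nat_numeral],
        rule of_nat_mono[OF that(8), where 'a = real, unfolded of_nat_add of_nat_mult of_nat_numeral],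
        rule of_nat_mono[OF that(9), where 'a = real, unfolded of_nat_add of_nat_mult of_nat_numeral])
    then have "real (3 * w2) < real (2 * a)" by simp
    then show ?thesis by (simp only: of_nat_less_iff)
  qed
  have "3 * card (W 2) < 2 * card (N 2)"
    by (rule arith[OF b3 b4 b5 bE1[unfolded cV1] sum1[unfolded sV1] low mono])
  then show ?thesis unfolding W2 N_def .
qed

section \<open>Recoloring\<close>

definition coloring_on :: "('v \<Rightarrow> 'v \<Rightarrow> bool) \<Rightarrow> ('v \<Rightarrow> 'c set) \<Rightarrow> 'v set \<Rightarrow> ('v \<Rightarrow> 'c) \<Rightarrow> bool" where
  "coloring_on adj L V \<phi> \<longleftrightarrow>
     (\<forall>v\<in>V. \<phi> v \<in> L v) \<and> (\<forall>u\<in>V. \<forall>v\<in>V. adj u v \<longrightarrow> \<phi> u \<noteq> \<phi> v)"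

text \<open>The exchanged vertices form an arbitrary set, not one Kempe component: extending a move
  to further vertices can merge components but preserves this relation.
  \<open>\<alpha> = \<beta>\<close> is allowed and means agreement on \<open>V\<close>.\<close>

definition swap_related :: "'c \<Rightarrow> 'c \<Rightarrow> 'v set \<Rightarrow> ('v \<Rightarrow> 'c) \<Rightarrow> ('v \<Rightarrow> 'c) \<Rightarrow> bool" where
  "swap_related \<alpha> \<beta> V \<phi> \<psi> \<longleftrightarrow>
     (\<forall>v\<in>V. \<psi> v = \<phi> v \<or> \<phi> v = \<alpha> \<and> \<psi> v = \<beta> \<or> \<phi> v = \<beta> \<and> \<psi> v = \<alpha>)"

definition recolor_step :: "('v \<Rightarrow> 'v \<Rightarrow> bool) \<Rightarrow> ('v \<Rightarrow> 'c set) \<Rightarrow> 'v set \<Rightarrow>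
    ('v \<Rightarrow> 'c) \<Rightarrow> ('v \<Rightarrow> 'c) \<Rightarrow> bool" where
  "recolor_step adj L V \<phi> \<psi> \<longleftrightarrow>
     coloring_on adj L V \<phi> \<and> coloring_on adj L V \<psi> \<and> (\<exists>\<alpha> \<beta>. swap_related \<alpha> \<beta> V \<phi> \<psi>)"

definition recolorable :: "('v \<Rightarrow> 'v \<Rightarrow> bool) \<Rightarrow> ('v \<Rightarrow> 'c set) \<Rightarrow> 'v set \<Rightarrow>
    ('v \<Rightarrow> 'c) \<Rightarrow> ('v \<Rightarrow> 'c) \<Rightarrow> bool" where
  "recolorable adj L V = (recolor_step adj L V)\<^sup>*\<^sup>*"

definition swappable :: "('v \<Rightarrow> 'v \<Rightarrow> bool) \<Rightarrow> ('v \<Rightarrow> 'c set) \<Rightarrow> 'v set \<Rightarrow> bool" where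
  "swappable adj L V \<longleftrightarrow>
     (\<forall>\<phi> \<psi>. coloring_on adj L V \<phi> \<longrightarrow> coloring_on adj L V \<psi> \<longrightarrow> recolorable adj L V \<phi> \<psi>)"

text \<open>Greedy colorability in hereditary form: some vertex of every remaining set can be
  colored last.\<close>

definition degenerate :: "('v \<Rightarrow> 'v \<Rightarrow> bool) \<Rightarrow> ('v \<Rightarrow> 'c set) \<Rightarrow> 'v set \<Rightarrow> bool" where
  "degenerate adj L S \<longleftrightarrow>
     (\<forall>U\<subseteq>S. U \<noteq> {} \<longrightarrow> (\<exists>v\<in>U. card {u \<in> U. adj v u} < card (L v)))"

text \<open>Connectedness by cuts instead of paths; the edge leaving \<open>U\<close> is precisely
  the uncolored neighbor that greedy arguments look for.\<close>

definition connected_set :: "('v \<Rightarrow> 'v \<Rightarrow> bool) \<Rightarrow> 'v set \<Rightarrow> bool" where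
  "connected_set adj S \<longleftrightarrow> (\<forall>U\<subseteq>S. U \<noteq> {} \<longrightarrow> U \<noteq> S \<longrightarrow> (\<exists>a\<in>U. \<exists>b\<in>S - U. adj a b))"

definition residual :: "('v \<Rightarrow> 'v \<Rightarrow> bool) \<Rightarrow> ('v \<Rightarrow> 'c set) \<Rightarrow> 'v set \<Rightarrow> ('v \<Rightarrow> 'c) \<Rightarrow> 'v \<Rightarrow> 'c set" where
  "residual adj L X \<kappa> v = L v - \<kappa> ` {u \<in> X. adj v u}"

lemma swap_related_sym: "swap_related \<alpha> \<beta> V \<phi> \<psi> \<Longrightarrow> swap_related \<alpha> \<beta> V \<psi> \<phi>"
  unfolding swap_related_def by metis

lemma swap_related_subset: "swap_related \<alpha> \<beta> V \<phi> \<psi> \<Longrightarrow> U \<subseteq> V \<Longrightarrow> swap_related \<alpha> \<beta> U \<phi> \<psi>"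
  unfolding swap_related_def by blast

lemma coloring_on_subset: "coloring_on adj L V \<phi> \<Longrightarrow> U \<subseteq> V \<Longrightarrow> coloring_on adj L U \<phi>"
  unfolding coloring_on_def by blast

lemma coloring_on_cong:
  "(\<And>v. v \<in> V \<Longrightarrow> \<phi> v = \<psi> v) \<Longrightarrow> coloring_on adj L V \<phi> \<longleftrightarrow> coloring_on adj L V \<psi>"
  unfolding coloring_on_def by auto

lemma recolorable_sym: "recolorable adj L V \<phi> \<psi> \<Longrightarrow> recolorable adj L V \<psi> \<phi>"
  unfolding recolorable_def
proof (induction rule: rtranclp_induct)
  case (step \<psi> \<xi>)
  then have "recolor_step adj L V \<xi> \<psi>"
    by (auto simp: recolor_step_def intro: swap_related_sym)
  then show ?case using step.IH by (rule converse_rtranclp_into_rtranclp)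
qed simp

lemma recolorable_trans:
  "recolorable adj L V \<phi> \<psi> \<Longrightarrow> recolorable adj L V \<psi> \<xi> \<Longrightarrow> recolorable adj L V \<phi> \<xi>"
  unfolding recolorable_def by (rule rtranclp_trans)

lemma recolorable_swap:
  "coloring_on adj L V \<phi> \<Longrightarrow> coloring_on adj L V \<psi> \<Longrightarrow> swap_related \<alpha> \<beta> V \<phi> \<psi> \<Longrightarrow>
    recolorable adj L V \<phi> \<psi>"
  unfolding recolorable_def recolor_step_def by blast

lemma recolorable_agree:
  assumes "coloring_on adj L V \<phi>" and "\<And>v. v \<in> V \<Longrightarrow> \<phi> v = \<psi> v"
  shows "recolorable adj L V \<phi> \<psi>"
proof -
  have "coloring_on adj L V \<psi>" using assms coloring_on_cong by metis
  moreover have "swap_related undefined undefined V \<phi> \<psi>" using assms(2) by (simp add: swap_related_def)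
  ultimately show ?thesis using assms(1) recolorable_swap by metis
qed

text \<open>A free color of \<open>L\<close> outside \<open>{\<alpha>, \<beta>}\<close> serves both
  colorings. If there is none, counting leaves fewer vertices of \<open>N\<close> colored from
  \<open>{\<alpha>, \<beta>}\<close> than such colors in \<open>L\<close>. So there is no such
  vertex, or a single one while both colors are listed; then the one that this vertex lacks is
  taken, separately for each coloring.\<close>

lemma two_lists_choice:
  fixes \<phi> \<phi>' :: "'v \<Rightarrow> 'c"
  assumes "finite N" and card: "card N < card L" and rel: "swap_related \<alpha> \<beta> N \<phi> \<phi>'"
  obtains x x' where "x \<in> L" "x' \<in> L" "x \<notin> \<phi> ` N" "x' \<notin> \<phi>' ` N"
    "x' = x \<or> x = \<alpha> \<and> x' = \<beta> \<or> x = \<beta> \<and> x' = \<alpha>"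
proof (cases "L - {\<alpha>, \<beta>} \<subseteq> \<phi> ` N")
  case False
  then obtain x where x: "x \<in> L" "x \<noteq> \<alpha>" "x \<noteq> \<beta>" "x \<notin> \<phi> ` N" by auto
  have "x \<notin> \<phi>' ` N"
    using x rel unfolding swap_related_def by auto
  with x show ?thesis using that by blast
next
  case True
  have finL: "finite L" using card by (metis card.infinite not_less0)
  define M where "M = {u \<in> N. \<phi> u \<in> {\<alpha>, \<beta>}}"
  have finM: "finite M" and MN: "M \<subseteq> N" using \<open>finite N\<close> by (auto simp: M_def)
  have "L - {\<alpha>, \<beta>} \<subseteq> \<phi> ` (N - M)" using True by (auto simp: M_def)
  then have "card (L - {\<alpha>, \<beta>}) \<le> card (N - M)"
    using \<open>finite N\<close> by (meson card_image_le card_mono finite_Diff finite_imageI le_trans)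
  also have "\<dots> = card N - card M" using finM MN by (simp add: card_Diff_subset)
  finally have 1: "card (L - {\<alpha>, \<beta>}) \<le> card N - card M" .
  have 2: "card L = card (L - {\<alpha>, \<beta>}) + card (L \<inter> {\<alpha>, \<beta>})"
    using finL by (metis card_Diff_subset_Int card_mono finite_Int inf_le1 le_add_diff_inverse2)
  have 3: "card M \<le> card N" using MN \<open>finite N\<close> card_mono by blast
  have lt: "card M < card (L \<inter> {\<alpha>, \<beta>})" using 1 2 3 card by linarith
  have "card (L \<inter> {\<alpha>, \<beta>}) \<le> card {\<alpha>, \<beta>}" by (intro card_mono) auto
  then have le2: "card (L \<inter> {\<alpha>, \<beta>}) \<le> 2" by (rule order.trans) (simp add: card_insert_if)
  show ?thesis
  proof (cases "M = {}")
    case True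
    have "L \<inter> {\<alpha>, \<beta>} \<noteq> {}" using lt by (metis card.empty not_less0)
    then obtain x where x: "x \<in> L" "x = \<alpha> \<or> x = \<beta>" by auto
    have 4: "\<phi> u \<noteq> \<alpha> \<and> \<phi> u \<noteq> \<beta>" if "u \<in> N" for u using True that by (auto simp: M_def)
    then have 5: "\<phi>' u = \<phi> u" if "u \<in> N" for u
      using rel that unfolding swap_related_def by metis
    show ?thesis by (rule that[of x x]) (use x 4 5 in auto)
  next
    case False
    then have "card M \<ge> 1" using finM by (simp add: Suc_leI card_gt_0_iff)
    then have c1: "card M = 1" and c2: "card (L \<inter> {\<alpha>, \<beta>}) = 2" using lt le2 by auto
    have "\<alpha> \<noteq> \<beta>"
    proof
      assume "\<alpha> = \<beta>"
      then have "card (L \<inter> {\<alpha>, \<beta>}) \<le> card {\<alpha>}" by (intro card_mono) auto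
      then show False using c2 by simp
    qed
    have "L \<inter> {\<alpha>, \<beta>} = {\<alpha>, \<beta>}"
      by (rule card_subset_eq) (use c2 \<open>\<alpha> \<noteq> \<beta>\<close> in auto)
    then have abL: "\<alpha> \<in> L" "\<beta> \<in> L" by auto
    obtain u where u: "M = {u}" using c1 card_1_singletonE by blast
    have uN: "u \<in> N" "\<phi> u \<in> {\<alpha>, \<beta>}" using u by (auto simp: M_def)
    have u': "\<phi>' u \<in> {\<alpha>, \<beta>}" using uN rel unfolding swap_related_def by blast
    have oth: "\<phi> v \<notin> {\<alpha>, \<beta>} \<and> \<phi>' v = \<phi> v" if "v \<in> N" "v \<noteq> u" for v
      using that u rel unfolding swap_related_def M_def by blast
    define f where "f c = (if c = \<alpha> then \<beta> else \<alpha>)" for c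
    have "f (\<phi> u) \<notin> \<phi> ` N" "f (\<phi>' u) \<notin> \<phi>' ` N"
      using uN u' oth \<open>\<alpha> \<noteq> \<beta>\<close> unfolding f_def image_iff by (metis insertCI insertE singletonD)+
    moreover have "f (\<phi> u) \<in> L" "f (\<phi>' u) \<in> L" using abL by (auto simp: f_def)
    moreover have "f (\<phi>' u) = f (\<phi> u) \<or> f (\<phi> u) = \<alpha> \<and> f (\<phi>' u) = \<beta> \<or> f (\<phi> u) = \<beta> \<and> f (\<phi>' u) = \<alpha>"
      by (auto simp: f_def)
    ultimately show ?thesis using that by blast
  qed
qed

section \<open>Extending colorings and moves to more vertices\<close>

locale symmetric_graph =
  fixes adj :: "'v \<Rightarrow> 'v \<Rightarrow> bool"
  assumes adj_sym: "adj u v \<Longrightarrow> adj v u" and adj_irrefl: "\<not> adj v v"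
begin

abbreviation "nbrs V v \<equiv> {u \<in> V. adj v u}"

text \<open>\<open>N\<close> holds the neighbors that have to be counted. A neighbor not affected by
  the move may be dropped if its color is outside the list or repeated by an unaffected vertex of
  \<open>N\<close>; in this way a vertex with as many neighbors as colors can still be
  served.\<close>

lemma related_pair_extend:
  assumes c: "coloring_on adj L V \<phi>" "coloring_on adj L V \<phi>'"
    and rel: "swap_related \<alpha> \<beta> V \<phi> \<phi>'" and v: "v \<notin> V"
    and N: "N \<subseteq> nbrs V v" "finite N" "card N < card (L v)"
    and drop: "\<And>u. u \<in> nbrs V v \<Longrightarrow> u \<notin> N \<Longrightarrow>
       \<phi>' u = \<phi> u \<and> (\<phi> u \<notin> L v \<or> (\<exists>u'\<in>N. \<phi> u' = \<phi> u \<and> \<phi>' u' = \<phi> u))"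
  shows "\<exists>x x'. coloring_on adj L (insert v V) (\<phi>(v := x)) \<and>
    coloring_on adj L (insert v V) (\<phi>'(v := x')) \<and>
    swap_related \<alpha> \<beta> (insert v V) (\<phi>(v := x)) (\<phi>'(v := x'))"
proof -
  have relN: "swap_related \<alpha> \<beta> N \<phi> \<phi>'" using rel N(1) by (auto intro: swap_related_subset)
  obtain x x' where x: "x \<in> L v" "x' \<in> L v" "x \<notin> \<phi> ` N" "x' \<notin> \<phi>' ` N"
    "x' = x \<or> x = \<alpha> \<and> x' = \<beta> \<or> x = \<beta> \<and> x' = \<alpha>"
    using two_lists_choice[OF N(2,3) relN] by blast
  have n1: "x \<noteq> \<phi> u \<and> x' \<noteq> \<phi>' u" if "u \<in> V" "adj v u" for u
  proof (cases "u \<in> N")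
    case False
    then have "\<phi>' u = \<phi> u \<and> (\<phi> u \<notin> L v \<or> (\<exists>u'\<in>N. \<phi> u' = \<phi> u \<and> \<phi>' u' = \<phi> u))"
      using drop that by blast
    then show ?thesis using x by (metis image_eqI)
  qed (use x in auto)
  have ins: "coloring_on adj L (insert v V) (f(v := y))"
    if "coloring_on adj L V f" "y \<in> L v" "\<And>u. u \<in> V \<Longrightarrow> adj v u \<Longrightarrow> y \<noteq> f u" for f y
    using that v adj_irrefl unfolding coloring_on_def fun_upd_apply
    by (smt (verit, ccfv_threshold) adj_sym insert_iff)
  have "coloring_on adj L (insert v V) (\<phi>(v := x))" using ins c(1) x(1) n1 by blast
  moreover have "coloring_on adj L (insert v V) (\<phi>'(v := x'))" using ins c(2) x(2) n1 by blast
  moreover have "swap_related \<alpha> \<beta> (insert v V) (\<phi>(v := x)) (\<phi>'(v := x'))"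
    using rel x(5) v unfolding swap_related_def by auto
  ultimately show ?thesis by blast
qed

text \<open>\<open>B\<close> lifts a single move outside \<open>S\<close> to a move on
  \<open>V\<close>; \<open>A\<close> bridges the gap inside \<open>S\<close> between the lifts of
  consecutive moves. The induction therefore speaks of all colorings with the given restriction to
  \<open>V - S\<close>.\<close>

lemma swappable_extend:
  assumes SV: "S \<subseteq> V" and O: "swappable adj L (V - S)"
    and A: "\<And>\<phi> \<psi>. coloring_on adj L V \<phi> \<Longrightarrow> coloring_on adj L V \<psi> \<Longrightarrow>
        (\<And>v. v \<in> V - S \<Longrightarrow> \<phi> v = \<psi> v) \<Longrightarrow> recolorable adj L V \<phi> \<psi>"
    and B: "\<And>\<eta> \<eta>' \<alpha> \<beta>. coloring_on adj L (V - S) \<eta> \<Longrightarrow> coloring_on adj L (V - S) \<eta>' \<Longrightarrow>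
        swap_related \<alpha> \<beta> (V - S) \<eta> \<eta>' \<Longrightarrow> \<exists>\<Phi> \<Phi>'. coloring_on adj L V \<Phi> \<and> coloring_on adj L V \<Phi>' \<and>
          swap_related \<alpha> \<beta> V \<Phi> \<Phi>' \<and> (\<forall>v\<in>V - S. \<Phi> v = \<eta> v \<and> \<Phi>' v = \<eta>' v)"
  shows "swappable adj L V"
  unfolding swappable_def
proof (intro allI impI)
  fix \<phi> \<psi> assume \<phi>: "coloring_on adj L V \<phi>" and \<psi>: "coloring_on adj L V \<psi>"
  have "recolorable adj L (V - S) \<phi> \<psi>"
    using O \<phi> \<psi> unfolding swappable_def by (meson Diff_subset coloring_on_subset)
  then have "(recolor_step adj L (V - S))\<^sup>*\<^sup>* \<phi> \<psi>" by (simp add: recolorable_def)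
  then have "\<forall>\<xi>. coloring_on adj L V \<xi> \<longrightarrow> (\<forall>v\<in>V - S. \<xi> v = \<psi> v) \<longrightarrow> recolorable adj L V \<phi> \<xi>"
  proof (induction rule: rtranclp_induct)
    case base
    then show ?case using A[OF \<phi>] by simp
  next
    case (step \<eta> \<eta>')
    from step.hyps(2) obtain \<alpha> \<beta> where st: "coloring_on adj L (V - S) \<eta>"
      "coloring_on adj L (V - S) \<eta>'" "swap_related \<alpha> \<beta> (V - S) \<eta> \<eta>'"
      by (auto simp: recolor_step_def)
    then obtain \<Phi> \<Phi>' where P: "coloring_on adj L V \<Phi>" "coloring_on adj L V \<Phi>'"
        "swap_related \<alpha> \<beta> V \<Phi> \<Phi>'" "\<forall>v\<in>V - S. \<Phi> v = \<eta> v \<and> \<Phi>' v = \<eta>' v"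
      using B by blast
    have 1: "recolorable adj L V \<phi> \<Phi>" using step.IH P by blast
    have 2: "recolorable adj L V \<Phi> \<Phi>'" using P recolorable_swap by metis
    show ?case
    proof (intro allI impI)
      fix \<xi> assume "coloring_on adj L V \<xi>" "\<forall>v\<in>V - S. \<xi> v = \<eta>' v"
      then have "recolorable adj L V \<Phi>' \<xi>" using A[OF P(2)] P(4) by metis
      then show "recolorable adj L V \<phi> \<xi>" using 1 2 recolorable_trans by metis
    qed
  qed
  then show "recolorable adj L V \<phi> \<psi>" using \<psi> by blast
qed

text \<open>Changing the color of \<open>v\<close> alone is a move for its old and new color, and
  moves elsewhere extend to \<open>v\<close> by \<open>related_pair_extend\<close>.\<close>

lemma swappable_insert:
  assumes "v \<in> V" "finite (nbrs V v)" "card (nbrs V v) < card (L v)" "swappable adj L (V - {v})"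
  shows "swappable adj L V"
proof (rule swappable_extend[where S = "{v}"])
  fix \<phi> \<psi> assume a: "coloring_on adj L V \<phi>" "coloring_on adj L V \<psi>" "\<And>u. u \<in> V - {v} \<Longrightarrow> \<phi> u = \<psi> u"
  have "swap_related (\<phi> v) (\<psi> v) V \<phi> \<psi>" unfolding swap_related_def using a(3) by fastforce
  then show "recolorable adj L V \<phi> \<psi>" using a recolorable_swap by metis
next
  fix \<eta> \<eta>' \<alpha> \<beta>
  assume a: "coloring_on adj L (V - {v}) \<eta>" "coloring_on adj L (V - {v}) \<eta>'"
    "swap_related \<alpha> \<beta> (V - {v}) \<eta> \<eta>'"
  have e: "nbrs (V - {v}) v = nbrs V v" using adj_irrefl by auto
  have i: "insert v (V - {v}) = V" using assms(1) by auto
  have "\<exists>x x'. coloring_on adj L (insert v (V - {v})) (\<eta>(v := x)) \<and>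
    coloring_on adj L (insert v (V - {v})) (\<eta>'(v := x')) \<and>
    swap_related \<alpha> \<beta> (insert v (V - {v})) (\<eta>(v := x)) (\<eta>'(v := x'))"
    by (rule related_pair_extend[OF a, of v "nbrs V v"]) (use assms e in simp_all)
  then obtain x x' where "coloring_on adj L V (\<eta>(v := x))" "coloring_on adj L V (\<eta>'(v := x'))"
    "swap_related \<alpha> \<beta> V (\<eta>(v := x)) (\<eta>'(v := x'))"
    unfolding i by blast
  then show "\<exists>\<Phi> \<Phi>'. coloring_on adj L V \<Phi> \<and> coloring_on adj L V \<Phi>' \<and> swap_related \<alpha> \<beta> V \<Phi> \<Phi>' \<and>
     (\<forall>u\<in>V - {v}. \<Phi> u = \<eta> u \<and> \<Phi>' u = \<eta>' u)"
    by (intro exI[of _ "\<eta>(v := x)"] exI[of _ "\<eta>'(v := x')"]) auto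
qed (use assms in auto)

lemma degenerate_subset: "degenerate adj L S \<Longrightarrow> U \<subseteq> S \<Longrightarrow> degenerate adj L U"
  unfolding degenerate_def by (meson subset_trans)

lemma degenerate_swappable:
  assumes "finite S" "degenerate adj L S"
  shows "swappable adj L S"
  using assms
proof (induction "card S" arbitrary: S)
  case 0
  then show ?case unfolding swappable_def by (auto intro: recolorable_agree)
next
  case (Suc n)
  then have "S \<noteq> {}" by auto
  then obtain v where v: "v \<in> S" "card (nbrs S v) < card (L v)"
    using Suc.prems unfolding degenerate_def by blast
  have "swappable adj L (S - {v})"
    by (rule Suc.hyps(1)) (use Suc v degenerate_subset[of L S "S - {v}"] in auto)
  then show ?case using swappable_insert[of v S L] v Suc.prems by simp
qed

lemma degenerate_colorable:
  assumes "finite S" "degenerate adj L S"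
  shows "\<exists>\<phi>. coloring_on adj L S \<phi>"
  using assms
proof (induction "card S" arbitrary: S)
  case 0
  then show ?case by (simp add: coloring_on_def)
next
  case (Suc n)
  then have "S \<noteq> {}" by auto
  then obtain v where v: "v \<in> S" "card (nbrs S v) < card (L v)"
    using Suc.prems unfolding degenerate_def by blast
  have "\<exists>\<phi>. coloring_on adj L (S - {v}) \<phi>"
    by (rule Suc.hyps(1)) (use Suc v degenerate_subset[of L S "S - {v}"] in auto)
  then obtain \<phi> where \<phi>: "coloring_on adj L (S - {v}) \<phi>" by blast
  \<comment> \<open>A coloring is related to itself for any two colors, so the extension of pairs
    also serves a single coloring.\<close>
  have rel: "swap_related undefined undefined (S - {v}) \<phi> \<phi>" by (simp add: swap_related_def)
  have e: "nbrs (S - {v}) v = nbrs S v" using adj_irrefl by auto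
  have i: "insert v (S - {v}) = S" using v(1) by auto
  have "\<exists>x x'. coloring_on adj L (insert v (S - {v})) (\<phi>(v := x)) \<and>
    coloring_on adj L (insert v (S - {v})) (\<phi>(v := x')) \<and>
    swap_related undefined undefined (insert v (S - {v})) (\<phi>(v := x)) (\<phi>(v := x'))"
    by (rule related_pair_extend[OF \<phi> \<phi> rel, of v "nbrs S v"]) (use v e Suc.prems(1) in simp_all)
  then show ?case unfolding i by blast
qed

text \<open>A set containing \<open>s\<close> has the slack of \<open>s\<close>; any other set has a
  vertex with a neighbor outside, which brings its degree below its list size.\<close>

lemma degenerate_connected:
  assumes fin: "finite S" and conn: "connected_set adj S"
    and deg: "\<And>v. v \<in> S \<Longrightarrow> card (nbrs S v) \<le> card (L v)"
    and s: "s \<in> S" "card (nbrs S s) < card (L s)"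
  shows "degenerate adj L S"
  unfolding degenerate_def
proof (intro allI impI)
  fix U assume U: "U \<subseteq> S" "U \<noteq> {}"
  have mono: "card (nbrs U v) \<le> card (nbrs S v)" for v
    using U(1) fin by (intro card_mono) auto
  show "\<exists>v\<in>U. card (nbrs U v) < card (L v)"
  proof (cases "s \<in> U")
    case True
    then show ?thesis using s mono[of s] by (intro bexI[of _ s]) auto
  next
    case False
    then have "U \<noteq> S" using s by auto
    then obtain a b where ab: "a \<in> U" "b \<in> S - U" "adj a b"
      using conn U unfolding connected_set_def by blast
    have "nbrs U a \<subset> nbrs S a" using ab U(1) by auto
    then have "card (nbrs U a) < card (nbrs S a)" using fin by (intro psubset_card_mono) auto
    then show ?thesis using deg[of a] ab U(1) by (intro bexI[of _ a]) auto
  qed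
qed

text \<open>In every nonempty \<open>U'\<close> some vertex can be colored last: one with a neighbor
  in \<open>U - U'\<close>, still uncolored, or \<open>s\<close>, which may ignore \<open>x\<close>
  because that unaffected color is outside its list or repeated.\<close>

lemma related_pair_extend_connected:
  assumes fin: "finite U" and disj: "U \<inter> V = {}" and conn: "connected_set adj U"
    and c: "coloring_on adj L V \<phi>" "coloring_on adj L V \<phi>'" and rel: "swap_related \<alpha> \<beta> V \<phi> \<phi>'"
    and deg: "\<And>v. v \<in> U \<Longrightarrow> finite (nbrs (V \<union> U) v) \<and> card (nbrs (V \<union> U) v) \<le> card (L v)"
    and s: "s \<in> U" "x \<in> V" "adj s x" "\<phi>' x = \<phi> x"
      "\<phi> x \<notin> L s \<or> (\<exists>y\<in>V. y \<noteq> x \<and> adj s y \<and> \<phi> y = \<phi> x \<and> \<phi>' y = \<phi> x)"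
  shows "\<exists>\<Phi> \<Phi>'. coloring_on adj L (V \<union> U) \<Phi> \<and> coloring_on adj L (V \<union> U) \<Phi>' \<and>
     swap_related \<alpha> \<beta> (V \<union> U) \<Phi> \<Phi>' \<and> (\<forall>v\<in>V. \<Phi> v = \<phi> v \<and> \<Phi>' v = \<phi>' v)"
proof -
  have "\<forall>U'\<subseteq>U. card U' = n \<longrightarrow> (\<exists>\<Phi> \<Phi>'. coloring_on adj L (V \<union> U') \<Phi> \<and>
     coloring_on adj L (V \<union> U') \<Phi>' \<and>
     swap_related \<alpha> \<beta> (V \<union> U') \<Phi> \<Phi>' \<and> (\<forall>v\<in>V. \<Phi> v = \<phi> v \<and> \<Phi>' v = \<phi>' v))" for n
  proof (induction n)
    case 0
    show ?case
    proof (intro allI impI)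
      fix U' assume "U' \<subseteq> U" "card U' = 0"
      then have "U' = {}" using fin by (metis card_0_eq finite_subset)
      then show "\<exists>\<Phi> \<Phi>'. coloring_on adj L (V \<union> U') \<Phi> \<and> coloring_on adj L (V \<union> U') \<Phi>' \<and>
        swap_related \<alpha> \<beta> (V \<union> U') \<Phi> \<Phi>' \<and> (\<forall>v\<in>V. \<Phi> v = \<phi> v \<and> \<Phi>' v = \<phi>' v)"
        using c rel by auto
    qed
  next
    case (Suc n)
    show ?case
    proof (intro allI impI)
      fix U' assume U': "U' \<subseteq> U" "card U' = Suc n"
      then have ne: "U' \<noteq> {}" by auto
      have ex: "\<exists>v\<in>U'. v = s \<or> (\<exists>b\<in>U - U'. adj v b)"
      proof (cases "s \<in> U'")
        case False
        then have "U' \<noteq> U" using s by auto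
        then show ?thesis using conn U'(1) ne unfolding connected_set_def by blast
      qed auto
      then obtain v where v: "v \<in> U'" "v = s \<or> (\<exists>b\<in>U - U'. adj v b)" by blast
      let ?W = "V \<union> (U' - {v})"
      have "card (U' - {v}) = n" using U' v by simp
      then obtain \<Phi> \<Phi>' where P: "coloring_on adj L ?W \<Phi>" "coloring_on adj L ?W \<Phi>'"
        "swap_related \<alpha> \<beta> ?W \<Phi> \<Phi>'" "\<forall>v\<in>V. \<Phi> v = \<phi> v \<and> \<Phi>' v = \<phi>' v"
        using Suc.IH[rule_format, of "U' - {v}"] U'(1) by blast
      have vW: "v \<notin> ?W" using v U' disj by auto
      have vU: "v \<in> U" using v U' by auto
      have finN: "finite (nbrs (V \<union> U) v)" using deg vU by blast
      have W: "?W \<subseteq> V \<union> U" "insert v ?W = V \<union> U'" using U' v by auto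
      have subW: "nbrs ?W v \<subseteq> nbrs (V \<union> U) v" using W by auto
      have finW: "finite (nbrs ?W v)" using subW finN finite_subset by blast
      have "\<exists>N. N \<subseteq> nbrs ?W v \<and> card N < card (L v) \<and> (\<forall>u. u \<in> nbrs ?W v \<longrightarrow> u \<notin> N \<longrightarrow>
         \<Phi>' u = \<Phi> u \<and> (\<Phi> u \<notin> L v \<or> (\<exists>u'\<in>N. \<Phi> u' = \<Phi> u \<and> \<Phi>' u' = \<Phi> u)))"
      proof (cases "v = s")
        case True
        have xn: "x \<in> nbrs ?W v" using s True by auto
        have "card (nbrs ?W v - {x}) < card (nbrs ?W v)"
          using finW xn by (meson card_Diff1_less)
        also have "\<dots> \<le> card (nbrs (V \<union> U) v)" using subW finN card_mono by blast
        also have "\<dots> \<le> card (L v)" using deg vU by blast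
        finally have lt: "card (nbrs ?W v - {x}) < card (L v)" .
        show ?thesis
        proof (intro exI[of _ "nbrs ?W v - {x}"] conjI allI impI)
          fix u assume "u \<in> nbrs ?W v" "u \<notin> nbrs ?W v - {x}"
          then have "u = x" by auto
          then show "\<Phi>' u = \<Phi> u"
            "\<Phi> u \<notin> L v \<or> (\<exists>u'\<in>nbrs ?W v - {x}. \<Phi> u' = \<Phi> u \<and> \<Phi>' u' = \<Phi> u)"
            using s P(4) True by (metis, (cases "\<phi> x \<in> L s"; force))
        qed (use lt in auto)
      next
        case False
        then obtain b where b: "b \<in> U - U'" "adj v b" using v by blast
        then have "b \<notin> ?W" using disj by auto
        then have "nbrs ?W v \<subset> nbrs (V \<union> U) v" using b subW by auto
        then have "card (nbrs ?W v) < card (nbrs (V \<union> U) v)" using finN psubset_card_mono by blast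
        then show ?thesis using deg[OF vU] by (intro exI[of _ "nbrs ?W v"]) auto
      qed
      then obtain N where N: "N \<subseteq> nbrs ?W v" "card N < card (L v)" "\<And>u. u \<in> nbrs ?W v \<Longrightarrow> u \<notin> N \<Longrightarrow>
         \<Phi>' u = \<Phi> u \<and> (\<Phi> u \<notin> L v \<or> (\<exists>u'\<in>N. \<Phi> u' = \<Phi> u \<and> \<Phi>' u' = \<Phi> u))" by blast
      have "finite N" using N(1) finW finite_subset by blast
      then have "\<exists>y y'. coloring_on adj L (insert v ?W) (\<Phi>(v := y)) \<and>
        coloring_on adj L (insert v ?W) (\<Phi>'(v := y')) \<and>
        swap_related \<alpha> \<beta> (insert v ?W) (\<Phi>(v := y)) (\<Phi>'(v := y'))"
        by (intro related_pair_extend[OF P(1-3) vW N(1)] N(2,3))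
      then obtain y y' where "coloring_on adj L (V \<union> U') (\<Phi>(v := y))"
        "coloring_on adj L (V \<union> U') (\<Phi>'(v := y'))"
        "swap_related \<alpha> \<beta> (V \<union> U') (\<Phi>(v := y)) (\<Phi>'(v := y'))"
        unfolding W(2) by blast
      moreover have "v \<notin> V" using vU disj by auto
      ultimately show "\<exists>\<Phi> \<Phi>'. coloring_on adj L (V \<union> U') \<Phi> \<and> coloring_on adj L (V \<union> U') \<Phi>' \<and>
        swap_related \<alpha> \<beta> (V \<union> U') \<Phi> \<Phi>' \<and> (\<forall>v\<in>V. \<Phi> v = \<phi> v \<and> \<Phi>' v = \<phi>' v)"
        using P(4) by (intro exI[of _ "\<Phi>(v := y)"] exI[of _ "\<Phi>'(v := y')"]) auto
    qed
  qed
  then show ?thesis by blast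
qed

end

section \<open>Fixing the colors of a subset\<close>

context symmetric_graph
begin

lemma coloring_on_override:
  assumes "coloring_on adj L X \<kappa>" "coloring_on adj (residual adj L X \<kappa>) U f" "X \<inter> U = {}"
  shows "coloring_on adj L (X \<union> U) (\<lambda>v. if v \<in> U then f v else \<kappa> v)"
proof -
  have 1: "f u \<noteq> \<kappa> x" if "u \<in> U" "x \<in> X" "adj u x" for u x
    using assms(2) that unfolding coloring_on_def residual_def by auto
  have 2: "f u \<in> L u" if "u \<in> U" for u
    using assms(2) that unfolding coloring_on_def residual_def by auto
  have 3: "f u \<noteq> f v" if "u \<in> U" "v \<in> U" "adj u v" for u v
    using assms(2) that unfolding coloring_on_def by auto
  have 4: "\<kappa> u \<noteq> \<kappa> v" if "u \<in> X" "v \<in> X" "adj u v" for u v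
    using assms(1) that unfolding coloring_on_def by auto
  have 5: "\<kappa> u \<in> L u" if "u \<in> X" for u
    using assms(1) that unfolding coloring_on_def by auto
  show ?thesis
    unfolding coloring_on_def
  proof (intro conjI ballI impI)
    fix v assume "v \<in> X \<union> U"
    then show "(if v \<in> U then f v else \<kappa> v) \<in> L v" using 2 5 by auto
  next
    fix u v assume uv: "u \<in> X \<union> U" "v \<in> X \<union> U" "adj u v"
    then show "(if u \<in> U then f u else \<kappa> u) \<noteq> (if v \<in> U then f v else \<kappa> v)"
      using 1[of u v] 1[of v u] 3[of u v] 4[of u v] adj_sym[of u v] by auto
  qed
qed

lemma coloring_on_residual:
  assumes "coloring_on adj L (X \<union> U) \<phi>" "\<And>x. x \<in> X \<Longrightarrow> \<phi> x = \<kappa> x"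
  shows "coloring_on adj (residual adj L X \<kappa>) U \<phi>"
proof -
  have "\<phi> v \<in> residual adj L X \<kappa> v" if "v \<in> U" for v
  proof -
    have "\<phi> v \<noteq> \<kappa> u" if "u \<in> X" "adj v u" for u
      using assms that \<open>v \<in> U\<close> unfolding coloring_on_def by (metis UnI1 UnI2)
    then show ?thesis using assms(1) that unfolding residual_def coloring_on_def by auto
  qed
  then show ?thesis using assms(1) unfolding coloring_on_def by blast
qed

lemma swappable_residual:
  assumes sw: "swappable adj (residual adj L X \<kappa>) U" and dis: "X \<inter> U = {}"
    and \<phi>: "coloring_on adj L (X \<union> U) \<phi>" "\<And>x. x \<in> X \<Longrightarrow> \<phi> x = \<kappa> x"
    and \<psi>: "coloring_on adj L (X \<union> U) \<psi>" "\<And>x. x \<in> X \<Longrightarrow> \<psi> x = \<kappa> x"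
  shows "recolorable adj L (X \<union> U) \<phi> \<psi>"
proof -
  let ?o = "\<lambda>f v. if v \<in> U then f v else \<kappa> v"
  have \<kappa>: "coloring_on adj L X \<kappa>"
    using coloring_on_subset[OF \<phi>(1), of X] coloring_on_cong[OF \<phi>(2), of X] by auto
  have "recolorable adj (residual adj L X \<kappa>) U \<phi> \<psi>"
    using sw coloring_on_residual[OF \<phi>] coloring_on_residual[OF \<psi>] unfolding swappable_def by blast
  then have a: "recolorable adj L (X \<union> U) (?o \<phi>) (?o \<psi>)"
    unfolding recolorable_def
  proof (induction rule: rtranclp_induct)
    case (step f g)
    then obtain \<alpha> \<beta> where st: "coloring_on adj (residual adj L X \<kappa>) U f"
      "coloring_on adj (residual adj L X \<kappa>) U g" "swap_related \<alpha> \<beta> U f g"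
      by (auto simp: recolor_step_def)
    have "swap_related \<alpha> \<beta> (X \<union> U) (?o f) (?o g)"
      using st(3) unfolding swap_related_def by auto
    then have "recolor_step adj L (X \<union> U) (?o f) (?o g)"
      using coloring_on_override[OF \<kappa> st(1) dis] coloring_on_override[OF \<kappa> st(2) dis]
      unfolding recolor_step_def by blast
    then show ?case by (rule rtranclp.rtrancl_into_rtrancl[OF step.IH])
  qed simp
  have b: "recolorable adj L (X \<union> U) \<phi> (?o \<phi>)"
    by (rule recolorable_agree[OF \<phi>(1)]) (use \<phi>(2) in auto)
  have c: "recolorable adj L (X \<union> U) (?o \<psi>) \<psi>"
    by (rule recolorable_sym, rule recolorable_agree[OF \<psi>(1)]) (use \<psi>(2) in auto)
  show ?thesis by (rule recolorable_trans[OF b recolorable_trans[OF a c]])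
qed

lemma card_residual:
  assumes "finite (nbrs X v)"
  shows "card (L v) \<le> card (residual adj L X \<kappa> v) + card (nbrs X v)"
proof -
  have "card (L v) - card (\<kappa> ` nbrs X v) \<le> card (residual adj L X \<kappa> v)"
    unfolding residual_def using assms by (intro diff_card_le_card_Diff) auto
  moreover have "card (\<kappa> ` nbrs X v) \<le> card (nbrs X v)" using assms by (rule card_image_le)
  ultimately show ?thesis by linarith
qed

text \<open>The neighbor \<open>x\<close> has a color outside the list and so deletes nothing from
  it.\<close>

lemma card_residual_slack:
  assumes "finite (nbrs X v)" "x \<in> nbrs X v" "\<kappa> x \<notin> L v"
  shows "card (L v) < card (residual adj L X \<kappa> v) + card (nbrs X v)"
proof -
  have "residual adj L X \<kappa> v = L v - \<kappa> ` (nbrs X v - {x})"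
    unfolding residual_def using assms(3) by auto
  then have "card (residual adj L X \<kappa> v) = card (L v - \<kappa> ` (nbrs X v - {x}))" by simp
  moreover have "card (L v) - card (\<kappa> ` (nbrs X v - {x})) \<le> card (L v - \<kappa> ` (nbrs X v - {x}))"
    using assms by (intro diff_card_le_card_Diff) auto
  moreover have "card (\<kappa> ` (nbrs X v - {x})) \<le> card (nbrs X v - {x})"
    using assms by (intro card_image_le) auto
  moreover have "card (nbrs X v - {x}) < card (nbrs X v)" using assms(1,2) by (rule card_Diff1_less)
  ultimately show ?thesis by linarith
qed

lemma card_nbrs_split:
  assumes "finite S" "X \<subseteq> S"
  shows "card (nbrs S v) = card (nbrs (S - X) v) + card (nbrs X v)"
proof -
  have "nbrs S v = nbrs (S - X) v \<union> nbrs X v" using assms by auto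
  moreover have "finite (nbrs (S - X) v)" "finite (nbrs X v)"
    using assms finite_subset[OF assms(2,1)] by simp_all
  moreover have "nbrs (S - X) v \<inter> nbrs X v = {}" by auto
  ultimately show ?thesis by (simp add: card_Un_disjoint)
qed

lemma degenerate_residual:
  assumes fin: "finite S" and X: "X \<subseteq> S"
    and deg: "\<And>v. v \<in> S \<Longrightarrow> card (nbrs S v) \<le> card (L v)"
    and conn: "connected_set adj (S - X)"
    and s: "s \<in> S - X" "x \<in> X" "adj s x" "\<kappa> x \<notin> L s"
  shows "degenerate adj (residual adj L X \<kappa>) (S - X)"
proof (rule degenerate_connected[OF _ conn])
  show "finite (S - X)" using fin by simp
  have finX: "finite (nbrs X v)" for v using finite_subset[OF X fin] by simp
  show "card (nbrs (S - X) v) \<le> card (residual adj L X \<kappa> v)" if "v \<in> S - X" for v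
    using card_nbrs_split[OF fin X, of v] card_residual[OF finX, of L v \<kappa>] deg[of v] that by auto
  show "s \<in> S - X" by fact
  show "card (nbrs (S - X) s) < card (residual adj L X \<kappa> s)"
    using card_nbrs_split[OF fin X, of s] card_residual_slack[OF finX, of x s \<kappa> L] deg[of s] s by auto
qed

text \<open>The color of \<open>x\<close> costs its neighbor \<open>s\<close> nothing, and this
  single unit of slack makes the connected rest degenerate for the residual lists.\<close>

lemma fixed_part:
  assumes fin: "finite S" and X: "X \<subseteq> S"
    and deg: "\<And>v. v \<in> S \<Longrightarrow> card (nbrs S v) \<le> card (L v)"
    and conn: "connected_set adj (S - X)"
    and s: "s \<in> S - X" "x \<in> X" "adj s x" "\<kappa> x \<notin> L s"
  shows fixed_part_colorable:
      "coloring_on adj L X \<kappa> \<Longrightarrow> \<exists>\<phi>. coloring_on adj L S \<phi> \<and> (\<forall>v\<in>X. \<phi> v = \<kappa> v)"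
    and fixed_part_recolorable:
      "coloring_on adj L S \<phi> \<Longrightarrow> coloring_on adj L S \<psi> \<Longrightarrow> (\<And>v. v \<in> X \<Longrightarrow> \<phi> v = \<kappa> v) \<Longrightarrow>
         (\<And>v. v \<in> X \<Longrightarrow> \<psi> v = \<kappa> v) \<Longrightarrow> recolorable adj L S \<phi> \<psi>"
proof -
  have D: "degenerate adj (residual adj L X \<kappa>) (S - X)" 
    by (rule degenerate_residual[where s = s and x = x and \<kappa> = \<kappa>]) (fact assms)+
  have SX: "X \<union> (S - X) = S" "X \<inter> (S - X) = {}" "finite (S - X)" using X fin by auto
  show "\<exists>\<phi>. coloring_on adj L S \<phi> \<and> (\<forall>v\<in>X. \<phi> v = \<kappa> v)" if \<kappa>: "coloring_on adj L X \<kappa>"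
  proof -
    obtain f where "coloring_on adj (residual adj L X \<kappa>) (S - X) f"
      using degenerate_colorable[OF SX(3) D] by blast
    from coloring_on_override[OF \<kappa> this SX(2)] show ?thesis
      unfolding SX(1) by (intro exI conjI) (assumption, auto)
  qed
  show "recolorable adj L S \<phi> \<psi>" if "coloring_on adj L S \<phi>" "coloring_on adj L S \<psi>"
    "\<And>v. v \<in> X \<Longrightarrow> \<phi> v = \<kappa> v" "\<And>v. v \<in> X \<Longrightarrow> \<psi> v = \<kappa> v"
    using swappable_residual[OF degenerate_swappable[OF SX(3) D] SX(2), of \<phi> \<psi>] that
    unfolding SX(1) by blast
qed

end

text \<open>\<open>K\<close> is the clique and \<open>T\<close> what hangs on it. \<open>Q v\<close>
  stands for the part of \<open>T\<close> that removing \<open>v\<close> would cut off, so that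
  fixing \<open>v\<close> together with \<open>Q v\<close> leaves a connected set. Lists in
  \<open>K\<close> are exactly as large as the degrees; that of \<open>s\<close> is one short of the
  clique size, which forces a color outside it.\<close>

locale hub = symmetric_graph adj for adj :: "'v \<Rightarrow> 'v \<Rightarrow> bool" +
  fixes L :: "'v \<Rightarrow> 'c set" and K T :: "'v set" and s :: 'v and Q :: "'v \<Rightarrow> 'v set"
  assumes finite_K: "finite K" and finite_T: "finite T" and disjoint_KT: "K \<inter> T = {}"
    and clique: "\<And>u v. u \<in> K \<Longrightarrow> v \<in> K \<Longrightarrow> u \<noteq> v \<Longrightarrow> adj u v"
    and card_K: "4 \<le> card K" and s_K: "s \<in> K" and s_T: "\<And>t. t \<in> T \<Longrightarrow> \<not> adj s t"
    and list_s: "card (L s) = card K - 1"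
    and list_K: "\<And>v. v \<in> K \<Longrightarrow> v \<noteq> s \<Longrightarrow>
       card (L v) = card K - 1 + card {t \<in> T. adj v t} \<and> card {t \<in> T. adj v t} \<le> 1"
    and list_T: "\<And>t. t \<in> T \<Longrightarrow> card {u \<in> K \<union> T. adj t u} \<le> card (L t)"
    and Q_T: "\<And>v. v \<in> K \<Longrightarrow> v \<noteq> s \<Longrightarrow> Q v \<subseteq> T"
    and conn: "\<And>v. v \<in> K \<Longrightarrow> v \<noteq> s \<Longrightarrow> connected_set adj (K \<union> T - insert v (Q v))"
    and color_Q: "\<And>v x. v \<in> K \<Longrightarrow> v \<noteq> s \<Longrightarrow>
       \<exists>\<sigma>. coloring_on adj L (Q v) \<sigma> \<and> (\<forall>t\<in>Q v. adj v t \<longrightarrow> \<sigma> t \<noteq> x)"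
begin

section \<open>Classes of colorings that agree at a clique vertex\<close>

abbreviation "colS \<equiv> coloring_on adj L (K \<union> T)"
abbreviation "recS \<equiv> recolorable adj L (K \<union> T)"
abbreviation avoids :: "'v \<Rightarrow> 'v set \<Rightarrow> 'c \<Rightarrow> ('v \<Rightarrow> 'c) \<Rightarrow> bool" where
  "avoids v A x \<sigma> \<equiv> \<forall>t\<in>A. adj v t \<longrightarrow> \<sigma> t \<noteq> x"

text \<open>Prescriptions at \<open>p\<close> and at \<open>r\<close> do not interfere inside
  \<open>T\<close>. A part of \<open>T\<close> attached to just these two vertices is what can
  destroy this.\<close>

definition linked :: "'v \<Rightarrow> 'v \<Rightarrow> bool" where
  "linked p r \<longleftrightarrow> p \<in> K - {s} \<and> r \<in> K - {s} \<and> p \<noteq> r \<and>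
     (\<forall>x x' \<sigma> \<rho>. coloring_on adj L (Q p) \<sigma> \<longrightarrow> avoids p (Q p) x \<sigma> \<longrightarrow>
        coloring_on adj L (Q r) \<rho> \<longrightarrow> avoids r (Q r) x' \<rho> \<longrightarrow>
        (\<exists>\<tau>. coloring_on adj L T \<tau> \<and> (\<forall>t\<in>Q p. \<tau> t = \<sigma> t) \<and> (\<forall>t\<in>Q r. \<tau> t = \<rho> t) \<and>
           avoids p T x \<tau> \<and> avoids r T x' \<tau>))"

lemma nbrs_K: assumes "v \<in> K" shows "card (nbrs (K \<union> T) v) = card K - 1 + card (nbrs T v)"
proof -
  have "nbrs (K \<union> T) v = (K - {v}) \<union> nbrs T v"
    using assms clique adj_irrefl by auto
  moreover have "(K - {v}) \<inter> nbrs T v = {}" using disjoint_KT by auto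
  moreover have "finite (nbrs T v)" using finite_T by auto
  ultimately show ?thesis using finite_K assms by (simp add: card_Un_disjoint)
qed

lemma deg: assumes "v \<in> K \<union> T" shows "card (nbrs (K \<union> T) v) \<le> card (L v)"
proof (cases "v \<in> K")
  case True
  have "nbrs T s = {}" using s_T by auto
  then have "card (nbrs T s) = 0" by (metis card.empty)
  then show ?thesis using nbrs_K[OF True] list_K[of v] list_s True by (cases "v = s") simp_all
qed (use assms list_T in auto)

text \<open>A class consists of the colorings with given colors on \<open>v\<close> and
  \<open>Q v\<close>. If the color of \<open>v\<close> is missing in the list of another clique
  vertex \<open>u\<close>, then \<open>u\<close> has slack and the connected remainder can be
  recolored freely.\<close>

lemma class_recolorable:
  assumes "v \<in> K" "v \<noteq> s" "u \<in> K" "u \<noteq> v" "\<phi> v \<notin> L u" "colS \<phi>" "colS \<psi>" "\<psi> v = \<phi> v"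
    "\<And>t. t \<in> Q v \<Longrightarrow> \<psi> t = \<phi> t"
  shows "recS \<phi> \<psi>"
proof (rule fixed_part_recolorable[where X = "insert v (Q v)" and s = u and x = v and \<kappa> = \<phi>])
  show "u \<in> K \<union> T - insert v (Q v)" using assms disjoint_KT Q_T by auto
  show "connected_set adj (K \<union> T - insert v (Q v))" using conn assms by blast
  show "\<psi> t = \<phi> t" if "t \<in> insert v (Q v)" for t using that assms by auto
  show "finite (K \<union> T)" using finite_K finite_T by simp
  show "insert v (Q v) \<subseteq> K \<union> T" using assms(1,2) Q_T by auto
  show "adj u v" using clique assms by auto
qed (use assms deg in auto)

lemma class_nonempty:
  assumes "v \<in> K" "v \<noteq> s" "x \<in> L v" "x \<notin> L s"
  shows "\<exists>\<phi>. colS \<phi> \<and> \<phi> v = x"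
proof -
  obtain \<sigma> where \<sigma>: "coloring_on adj L (Q v) \<sigma>" "\<forall>t\<in>Q v. adj v t \<longrightarrow> \<sigma> t \<noteq> x"
    using color_Q[OF assms(1,2)] by blast
  have vQ: "v \<notin> Q v" using assms(1,2) Q_T disjoint_KT by auto
  have 1: "coloring_on adj L (insert v (Q v)) (\<sigma>(v := x))"
    unfolding coloring_on_def
  proof (intro conjI ballI impI)
    fix a b assume "a \<in> insert v (Q v)" "b \<in> insert v (Q v)" "adj a b"
    then show "(\<sigma>(v := x)) a \<noteq> (\<sigma>(v := x)) b"
      using \<sigma> vQ adj_irrefl[of v] adj_sym[of a b] unfolding coloring_on_def
      by (cases "a = v"; cases "b = v") fastforce+
  qed (use \<sigma> assms in \<open>auto simp: coloring_on_def\<close>)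
  have "\<exists>\<phi>. colS \<phi> \<and> (\<forall>t\<in>insert v (Q v). \<phi> t = (\<sigma>(v := x)) t)"
  proof (rule fixed_part_colorable[where s = s and x = v])
    show "s \<in> K \<union> T - insert v (Q v)" using assms s_K disjoint_KT Q_T by auto
    show "connected_set adj (K \<union> T - insert v (Q v))" using conn assms by blast
    show "finite (K \<union> T)" using finite_K finite_T by simp
    show "insert v (Q v) \<subseteq> K \<union> T" using assms(1,2) Q_T by auto
    show "adj s v" using clique assms s_K by auto
    show "coloring_on adj L (insert v (Q v)) (\<sigma>(v := x))" by (rule 1)
  qed (use assms deg in auto)
  then show ?thesis by auto
qed

text \<open>With \<open>T\<close>, \<open>p\<close> and \<open>r\<close> colored, the rest of the
  clique is filled greedily with \<open>s\<close> last: the others profit from \<open>s\<close>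
  being uncolored, and \<open>s\<close> from the one of \<open>x\<close>, \<open>x'\<close> that is
  outside its list.\<close>

lemma coexist:
  assumes p: "p \<in> K - {s}" and r: "r \<in> K - {s}" and pr: "p \<noteq> r"
    and x: "x \<in> L p" "x' \<in> L r" "x \<noteq> x'" "x \<notin> L s \<or> x' \<notin> L s"
    and \<tau>: "coloring_on adj L T \<tau>" "avoids p T x \<tau>" "avoids r T x' \<tau>"
  shows "\<exists>\<phi>. colS \<phi> \<and> \<phi> p = x \<and> \<phi> r = x' \<and> (\<forall>t\<in>T. \<phi> t = \<tau> t) \<and>
    (\<forall>v\<in>K - {p, r}. \<phi> v \<noteq> x \<and> \<phi> v \<noteq> x')"
proof -
  let ?X = "T \<union> {p, r}" and ?U = "K - {p, r}" and ?\<kappa> = "\<tau>(p := x, r := x')"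
  have pT: "p \<notin> T" "r \<notin> T" using p r disjoint_KT by auto
  have \<kappa>: "coloring_on adj L ?X ?\<kappa>"
    unfolding coloring_on_def
  proof (intro conjI ballI impI)
    fix a b assume ab: "a \<in> ?X" "b \<in> ?X" "adj a b"
    have 1: "a \<noteq> b" using ab adj_irrefl by auto
    show "?\<kappa> a \<noteq> ?\<kappa> b"
    proof (cases "a \<in> {p, r}")
      case True
      then show ?thesis
        using ab 1 x(3) \<tau>(2,3) pr pT by (cases "b \<in> {p, r}") fastforce+
    next
      case False
      then have aT: "a \<in> T" using ab by auto
      show ?thesis
      proof (cases "b \<in> {p, r}")
        case True
        then show ?thesis using aT False \<tau>(2,3) pr ab(3) adj_sym[of a b] by auto
      next
        case False
        then have "\<tau> a \<noteq> \<tau> b" using \<tau>(1) ab aT unfolding coloring_on_def by auto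
        then show ?thesis using aT False \<open>a \<notin> {p, r}\<close> by auto
      qed
    qed
  next
    fix v assume "v \<in> ?X"
    then show "?\<kappa> v \<in> L v" using x \<tau>(1) pr unfolding coloring_on_def by auto
  qed
  have finX: "finite (nbrs ?X v)" for v using finite_T by auto
  have cU: "card ?U = card K - 2" using p r pr finite_K by (simp add: card_Diff_subset)
  have D: "degenerate adj (residual adj L ?X ?\<kappa>) ?U"
    unfolding degenerate_def
  proof (intro allI impI)
    fix U' assume U': "U' \<subseteq> ?U" "U' \<noteq> {}"
    have finU': "finite U'" using U' finite_K finite_subset by blast
    have small: "card (nbrs U' v) + 1 \<le> card U'" if "v \<in> U'" for v
    proof -
      have "nbrs U' v \<subseteq> U' - {v}" using adj_irrefl by auto
      then have "card (nbrs U' v) \<le> card (U' - {v})" using finU' by (intro card_mono) auto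
      then show ?thesis using that finU' card_gt_0_iff[of U'] by (auto simp: card_Diff_singleton)
    qed
    have nX: "card (nbrs ?X v) = card (nbrs T v) + 2" if "v \<in> ?U" for v
    proof -
      have "nbrs ?X v = nbrs T v \<union> {p, r}" using that p r clique by auto
      moreover have "nbrs T v \<inter> {p, r} = {}" using pT by auto
      ultimately show ?thesis using pr finite_T by (simp add: card_Un_disjoint)
    qed
    show "\<exists>v\<in>U'. card (nbrs U' v) < card (residual adj L ?X ?\<kappa> v)"
    proof (cases "s \<in> U'")
      case True
      then have sU: "s \<in> ?U" using U' by auto
      have "nbrs T s = {}" using s_T by auto
      then have n2: "card (nbrs ?X s) = 2" using nX[OF sU] by (metis card.empty add_0)
      have "\<exists>y \<in> nbrs ?X s. ?\<kappa> y \<notin> L s"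
      proof (cases "x \<notin> L s")
        case True
        then show ?thesis using p s_K clique pr by (intro bexI[of _ p]) auto
      next
        case False
        then show ?thesis using r s_K clique x(4) by (intro bexI[of _ r]) auto
      qed
      then obtain y where y: "y \<in> nbrs ?X s" "?\<kappa> y \<notin> L s" by blast
      have "card (L s) < card (residual adj L ?X ?\<kappa> s) + 2"
        using card_residual_slack[where L = L and \<kappa> = ?\<kappa>, OF finX y] unfolding n2 .
      moreover have "card U' \<le> card K - 2" using U' cU finite_K by (metis card_mono finite_Diff)
      ultimately have "card (nbrs U' s) < card (residual adj L ?X ?\<kappa> s)"
        using small[OF True] list_s card_K by linarith
      then show ?thesis using True by blast
    next
      case False
      obtain v where v: "v \<in> U'" using U' by auto
      then have vU: "v \<in> ?U" "v \<noteq> s" using U' False by auto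
      have "U' \<subset> ?U" using U' False p r s_K by auto
      then have "card U' < card K - 2" using cU finite_K by (metis finite_Diff psubset_card_mono)
      moreover have "card (L v) \<le> card (residual adj L ?X ?\<kappa> v) + (card (nbrs T v) + 2)"
        using card_residual[OF finX, of L v ?\<kappa>] nX[OF vU(1)] by simp
      ultimately have "card (nbrs U' v) < card (residual adj L ?X ?\<kappa> v)"
        using small[OF v] list_K[of v] vU card_K by auto
      then show ?thesis using v by blast
    qed
  qed
  obtain f where f: "coloring_on adj (residual adj L ?X ?\<kappa>) ?U f"
    using degenerate_colorable[OF _ D] finite_K by blast
  have dis: "?X \<inter> ?U = {}" and un: "?X \<union> ?U = K \<union> T" using p r disjoint_KT by auto
  let ?\<phi> = "\<lambda>v. if v \<in> ?U then f v else ?\<kappa> v"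
  have c: "colS ?\<phi>" using coloring_on_override[OF \<kappa> f dis] unfolding un .
  have "?\<phi> v \<noteq> x \<and> ?\<phi> v \<noteq> x'" if "v \<in> ?U" for v
  proof -
    have "f v \<in> residual adj L ?X ?\<kappa> v" using f that unfolding coloring_on_def by blast
    moreover have "p \<in> nbrs ?X v" "r \<in> nbrs ?X v" using that p r clique by auto
    ultimately have "f v \<noteq> ?\<kappa> p" "f v \<noteq> ?\<kappa> r" unfolding residual_def by blast+
    then show ?thesis using that pr by auto
  qed
  moreover have "?\<phi> t = \<tau> t" if "t \<in> T" for t using that pT disjoint_KT by auto
  ultimately show ?thesis using c pr by (intro exI[of _ ?\<phi>]) auto
qed


text \<open>The coloring \<open>\<xi>\<close> given by \<open>coexist\<close> lies in the class of
  \<open>\<phi>\<close> at \<open>p\<close> and in the class of \<open>\<psi>\<close> at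
  \<open>r\<close>; \<open>ne\<close> allows both colors in the clique at once.\<close>

lemma link_recolorable:
  assumes lk: "linked p r" and c: "colS \<phi>" "colS \<psi>" and ne: "\<phi> p \<noteq> \<psi> r"
    and sl: "\<phi> p \<notin> L s \<or> \<psi> r \<notin> L s"
    and fp: "u \<in> K" "u \<noteq> p" "\<phi> p \<notin> L u" and fr: "u' \<in> K" "u' \<noteq> r" "\<psi> r \<notin> L u'"
  shows "recS \<phi> \<psi>"
proof -
  have pr: "p \<in> K - {s}" "r \<in> K - {s}" "p \<noteq> r" using lk by (auto simp: linked_def)
  have QT: "Q p \<subseteq> T" "Q r \<subseteq> T" using Q_T[of p] Q_T[of r] pr by auto
  have Qp: "Q p \<subseteq> K \<union> T" "Q r \<subseteq> K \<union> T" using Q_T pr by blast+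
  have av: "avoids v (Q v) (\<xi> v) \<xi>" if "colS \<xi>" "v \<in> K - {s}" for v \<xi>
  proof (intro ballI impI)
    fix t assume "t \<in> Q v" "adj v t"
    then have "v \<in> K \<union> T" "t \<in> K \<union> T" "adj v t" using that Q_T by blast+
    then show "\<xi> t \<noteq> \<xi> v" using that(1) unfolding coloring_on_def by metis
  qed
  have cQ: "coloring_on adj L (Q p) \<phi>" "coloring_on adj L (Q r) \<psi>"
    using c Qp coloring_on_subset by blast+
  have "\<exists>\<tau>. coloring_on adj L T \<tau> \<and> (\<forall>t\<in>Q p. \<tau> t = \<phi> t) \<and> (\<forall>t\<in>Q r. \<tau> t = \<psi> t) \<and>
      avoids p T (\<phi> p) \<tau> \<and> avoids r T (\<psi> r) \<tau>"
    using lk cQ av[OF c(1) pr(1)] av[OF c(2) pr(2)] unfolding linked_def by blast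
  then obtain \<tau> where \<tau>: "coloring_on adj L T \<tau>" "\<forall>t\<in>Q p. \<tau> t = \<phi> t" "\<forall>t\<in>Q r. \<tau> t = \<psi> t"
      "avoids p T (\<phi> p) \<tau>" "avoids r T (\<psi> r) \<tau>" by blast
  have L: "\<phi> p \<in> L p" "\<psi> r \<in> L r" using c pr unfolding coloring_on_def by auto
  obtain \<xi> where \<xi>: "colS \<xi>" "\<xi> p = \<phi> p" "\<xi> r = \<psi> r" "\<forall>t\<in>T. \<xi> t = \<tau> t"
    using coexist[OF pr L ne sl \<tau>(1,4,5)] by blast
  have "recS \<phi> \<xi>"
    by (rule class_recolorable[of p u]) (use pr fp c \<xi> \<tau>(2) QT in auto)
  moreover have "recS \<psi> \<xi>"
    by (rule class_recolorable[of r u']) (use pr fr c \<xi> \<tau>(3) QT in auto)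
  ultimately show ?thesis using recolorable_sym recolorable_trans by blast
qed

text \<open>One half of the argument of \<open>link_recolorable\<close>, with \<open>Q r\<close>
  colored by \<open>color_Q\<close>: it changes the color of \<open>r\<close> without leaving the
  class at \<open>p\<close>.\<close>

lemma link_move:
  assumes lk: "linked p r" and c: "colS \<phi>" and y: "y \<in> L r" "y \<noteq> \<phi> p"
    and sl: "\<phi> p \<notin> L s \<or> y \<notin> L s" and fp: "u \<in> K" "u \<noteq> p" "\<phi> p \<notin> L u"
  shows "\<exists>\<xi>. colS \<xi> \<and> recS \<phi> \<xi> \<and> \<xi> p = \<phi> p \<and> \<xi> r = y"
proof -
  have pr: "p \<in> K - {s}" "r \<in> K - {s}" "p \<noteq> r" using lk by (auto simp: linked_def)
  have QT: "Q p \<subseteq> T" "Q r \<subseteq> T" using Q_T[of p] Q_T[of r] pr by auto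
  have Qp: "Q p \<subseteq> K \<union> T" using Q_T pr by blast
  have av: "avoids p (Q p) (\<phi> p) \<phi>"
  proof (intro ballI impI)
    fix t assume "t \<in> Q p" "adj p t"
    then have "p \<in> K \<union> T" "t \<in> K \<union> T" "adj p t" using pr Qp by blast+
    then show "\<phi> t \<noteq> \<phi> p" using c unfolding coloring_on_def by metis
  qed
  have cQ: "coloring_on adj L (Q p) \<phi>" using c Qp coloring_on_subset by blast
  obtain \<rho> where \<rho>: "coloring_on adj L (Q r) \<rho>" "avoids r (Q r) y \<rho>" using color_Q pr by blast
  have "\<exists>\<tau>. coloring_on adj L T \<tau> \<and> (\<forall>t\<in>Q p. \<tau> t = \<phi> t) \<and> (\<forall>t\<in>Q r. \<tau> t = \<rho> t) \<and>
      avoids p T (\<phi> p) \<tau> \<and> avoids r T y \<tau>"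
    using lk cQ av \<rho> unfolding linked_def by blast
  then obtain \<tau> where \<tau>: "coloring_on adj L T \<tau>" "\<forall>t\<in>Q p. \<tau> t = \<phi> t"
      "avoids p T (\<phi> p) \<tau>" "avoids r T y \<tau>" by blast
  have L: "\<phi> p \<in> L p" using c pr unfolding coloring_on_def by auto
  obtain \<xi> where \<xi>: "colS \<xi>" "\<xi> p = \<phi> p" "\<xi> r = y" "\<forall>t\<in>T. \<xi> t = \<tau> t"
    using coexist[OF pr L y(1) y(2)[symmetric] sl \<tau>(1,3,4)] by blast
  have "recS \<phi> \<xi>"
    by (rule class_recolorable[of p u]) (use pr fp c \<xi> \<tau>(2) QT in auto)
  then show ?thesis using \<xi> by blast
qed

lemma linked_sym: "linked p r \<Longrightarrow> linked r p"
  unfolding linked_def by (intro conjI; (blast | metis))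

text \<open>Adjacent \<open>p\<close> and \<open>r\<close> cannot both have the color
  \<open>x\<close>, so the two classes have no common coloring. If \<open>L r\<close> is contained
  in \<open>L p\<close>, one move exchanges \<open>x\<close> with a second color \<open>a\<close>
  between \<open>p\<close> and \<open>r\<close>. Otherwise a color \<open>j\<close> of
  \<open>r\<close> outside \<open>L p\<close> is a stepping stone: while \<open>r\<close> has it,
  \<open>p\<close> has slack and can be moved away from \<open>x\<close>.\<close>

lemma link_recolorable_same:
  assumes lk: "linked p r" and full: "card (L p) = card K" and c: "colS \<phi>" "colS \<psi>"
    and eq: "\<phi> p = \<psi> r" and sl: "\<phi> p \<notin> L s"
  shows "recS \<phi> \<psi>"
proof -
  have pr: "p \<in> K - {s}" "r \<in> K - {s}" "p \<noteq> r" using lk by (auto simp: linked_def)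
  have QT: "Q p \<subseteq> T" "Q r \<subseteq> T" using Q_T[of p] Q_T[of r] pr by auto
  define x where "x = \<phi> p"
  have x: "\<phi> p = x" "\<psi> r = x" "x \<notin> L s" using eq sl by (auto simp: x_def)
  have "\<phi> p \<in> L p" "\<psi> r \<in> L r" using c pr unfolding coloring_on_def by blast+
  then have xL: "x \<in> L p" "x \<in> L r" using x by simp_all
  have finL: "finite (L v)" if "v \<in> K" for v
    using that list_s list_K[of v] card_K by (cases "v = s") (auto intro: card_ge_0_finite)
  have sKK: "s \<in> K" "s \<noteq> p" "s \<noteq> r" using pr s_K by auto
  show ?thesis
  proof (cases "L r \<subseteq> L p")
    case True
    have av: "avoids v (Q v) (\<xi> v) \<xi>" if "colS \<xi>" "v \<in> K - {s}" for v \<xi>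
    proof (intro ballI impI)
      fix t assume "t \<in> Q v" "adj v t"
      then have "v \<in> K \<union> T" "t \<in> K \<union> T" "adj v t" using that Q_T by blast+
      then show "\<xi> t \<noteq> \<xi> v" using that(1) unfolding coloring_on_def by metis
    qed
    have "Q p \<subseteq> K \<union> T" "Q r \<subseteq> K \<union> T" using Q_T pr by blast+
    then have cQ: "coloring_on adj L (Q p) \<phi>" "coloring_on adj L (Q r) \<psi>"
      using c coloring_on_subset by blast+
    have "\<exists>\<tau>. coloring_on adj L T \<tau> \<and> (\<forall>t\<in>Q p. \<tau> t = \<phi> t) \<and> (\<forall>t\<in>Q r. \<tau> t = \<psi> t) \<and>
        avoids p T x \<tau> \<and> avoids r T x \<tau>"
      using lk cQ av[OF c(1) pr(1)] av[OF c(2) pr(2)] unfolding linked_def x by blast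
    then obtain \<tau> where \<tau>: "coloring_on adj L T \<tau>" "\<forall>t\<in>Q p. \<tau> t = \<phi> t" "\<forall>t\<in>Q r. \<tau> t = \<psi> t"
        "avoids p T x \<tau>" "avoids r T x \<tau>" by blast
    have finT: "finite (nbrs T p)" "finite (nbrs T r)" using finite_T by auto
    \<comment> \<open>Colors unsuitable for \<open>a\<close>: at most
      \<open>2 + card (nbrs T r)\<close> of them, whereas \<open>L r\<close> has
      \<open>card K - 1 + card (nbrs T r)\<close> colors. This is where
      \<open>card K \<ge> 4\<close> matters.\<close>
    define B where "B = insert x (\<tau> ` nbrs T p \<union> \<tau> ` nbrs T r)"
    have "card B \<le> Suc (card (\<tau> ` nbrs T p \<union> \<tau> ` nbrs T r))"
      unfolding B_def by (rule card_insert_le_m1) auto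
    also have "card (\<tau> ` nbrs T p \<union> \<tau> ` nbrs T r) \<le> card (nbrs T p) + card (nbrs T r)"
      by (rule order.trans[OF card_Un_le]) (intro add_mono card_image_le finT)
    finally have "card B \<le> Suc (card (nbrs T p) + card (nbrs T r))" by simp
    also have "\<dots> < card (L r)"
      using list_K[of p] list_K[of r] pr card_K by auto
    finally have ltB: "card B < card (L r)" .
    have "finite B" using finT by (simp add: B_def)
    then have "\<not> L r \<subseteq> B" using ltB card_mono[of B "L r"] by auto
    then obtain a where a: "a \<in> L r" "a \<notin> B" by blast
    have a': "a \<noteq> x" "a \<in> L p" "avoids p T a \<tau>" "avoids r T a \<tau>"
      using a True unfolding B_def by blast+
    obtain \<phi>1 where f1: "colS \<phi>1" "\<phi>1 p = x" "\<phi>1 r = a" "\<forall>t\<in>T. \<phi>1 t = \<tau> t"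
       "\<forall>v\<in>K - {p, r}. \<phi>1 v \<noteq> x \<and> \<phi>1 v \<noteq> a"
      using coexist[OF pr xL(1) a(1) a'(1)[symmetric] _ \<tau>(1,4) a'(4)] x(3) by blast
    \<comment> \<open>Exchanging \<open>x\<close> and \<open>a\<close> between \<open>p\<close> and
      \<open>r\<close> alone stays proper: no other clique vertex has either color, and neither do
      the neighbors of \<open>p\<close> and \<open>r\<close> in \<open>T\<close>.\<close>
    define \<phi>2 where "\<phi>2 = \<phi>1(p := a, r := x)"
    have pT: "p \<notin> T" "r \<notin> T" using pr disjoint_KT by auto
    have \<phi>2: "\<phi>2 p = a" "\<phi>2 r = x" "\<And>v. v \<noteq> p \<Longrightarrow> v \<noteq> r \<Longrightarrow> \<phi>2 v = \<phi>1 v"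
      using pr by (auto simp: \<phi>2_def)
    have ok: "\<phi>1 v \<noteq> x \<and> \<phi>1 v \<noteq> a" if "v \<in> K \<union> T" "v \<noteq> p" "v \<noteq> r" "adj p v \<or> adj r v" for v
    proof (cases "v \<in> K")
      case False
      then have "v \<in> T" using that by auto
      then show ?thesis using that(4) f1(4) \<tau>(4,5) a'(3,4) by auto
    qed (use that f1(5) in auto)
    have "colS \<phi>2"
      unfolding coloring_on_def
    proof (intro conjI ballI impI)
      fix v assume "v \<in> K \<union> T"
      then show "\<phi>2 v \<in> L v"
        using f1(1) \<phi>2 a'(2) xL unfolding coloring_on_def by (cases "v = p"; cases "v = r") auto
    next
      fix v w assume vw: "v \<in> K \<union> T" "w \<in> K \<union> T" "adj v w"
      then have "\<phi>1 v \<noteq> \<phi>1 w" "v \<noteq> w" using f1(1) adj_irrefl unfolding coloring_on_def by auto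
      then show "\<phi>2 v \<noteq> \<phi>2 w"
        using ok[of v] ok[of w] vw adj_sym[of v w] \<phi>2 a'(1)
        by (cases "v = p"; cases "v = r"; cases "w = p"; cases "w = r") auto
    qed
    have "swap_related x a (K \<union> T) \<phi>1 \<phi>2"
      unfolding swap_related_def
    proof
      fix v show "\<phi>2 v = \<phi>1 v \<or> \<phi>1 v = x \<and> \<phi>2 v = a \<or> \<phi>1 v = a \<and> \<phi>2 v = x"
        using \<phi>2 f1 by (cases "v = p"; cases "v = r") auto
    qed
    then have r12: "recS \<phi>1 \<phi>2" using f1(1) \<open>colS \<phi>2\<close> recolorable_swap by metis
    have "recS \<phi> \<phi>1"
      by (rule class_recolorable[of p s]) (use pr x c f1 \<tau>(2) QT s_K in auto)
    moreover have "recS \<psi> \<phi>2"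
    proof (rule class_recolorable[of r s])
      show "\<phi>2 t = \<psi> t" if "t \<in> Q r" for t
      proof -
        have "t \<in> T" using that Q_T pr by blast
        moreover from this have "t \<noteq> p" "t \<noteq> r" using pT by auto
        ultimately show ?thesis using \<phi>2(3) f1(4) \<tau>(3) that by simp
      qed
    qed (use pr x c \<phi>2 \<open>colS \<phi>2\<close> s_K in auto)
    ultimately show ?thesis using r12 recolorable_sym recolorable_trans by blast
  next
    case False
    then obtain j where j: "j \<in> L r" "j \<notin> L p" by blast
    have jx: "j \<noteq> x" using j xL by auto
    obtain \<xi>1 where k1: "colS \<xi>1" "recS \<phi> \<xi>1" "\<xi>1 p = x" "\<xi>1 r = j"
      using link_move[OF lk c(1) j(1), of s] jx x sKK by auto
    show ?thesis
    proof (cases "L p - L s \<subseteq> {x}")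
      case False
      then obtain x' where x': "x' \<in> L p" "x' \<notin> L s" "x' \<noteq> x" by blast
      have "x' \<noteq> j" using x' j by auto
      then obtain \<xi>2 where k2: "colS \<xi>2" "recS \<xi>1 \<xi>2" "\<xi>2 r = j" "\<xi>2 p = x'"
        using link_move[OF linked_sym[OF lk] k1(1) x'(1), of p] k1 x' j pr by auto
      have "recS \<xi>2 \<psi>"
        by (rule link_recolorable[OF lk k2(1) c(2), of s s]) (use k2 x x' sKK in auto)
      then show ?thesis using k1 k2 recolorable_trans by blast
    next
      case True
      \<comment> \<open>Now \<open>x\<close> is the only color of \<open>p\<close> outside
        \<open>L s\<close>, so by cardinality \<open>L p = insert x (L s)\<close> and
        \<open>j\<close> is missing at \<open>s\<close> too. Since \<open>L r\<close> is not larger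
        than \<open>L p\<close>, some color \<open>i\<close> of \<open>p\<close> is outside
        \<open>L r\<close>; once \<open>p\<close> has it, the slack sits at \<open>r\<close> instead
        of \<open>s\<close>.\<close>
      have "L p \<subseteq> insert x (L s)" using True by blast
      moreover have "card (insert x (L s)) = card K"
        using finL[OF s_K] x(3) list_s card_K by simp
      ultimately have Lp: "L p = insert x (L s)"
        using full finL[OF s_K] by (intro card_subset_eq) auto
      then have js: "j \<notin> L s" using j by auto
      have "card (L r) \<le> card (L p)" using full list_K[of r] pr card_K by auto
      then have "\<not> L p \<subseteq> L r"
        using False j finL[of r] pr by (metis card_seteq DiffD1 subset_refl)
      then obtain i where i: "i \<in> L p" "i \<notin> L r" by blast
      have "i \<noteq> j" "i \<noteq> x" using i j xL by auto
      then obtain \<xi>2 where k2: "colS \<xi>2" "recS \<xi>1 \<xi>2" "\<xi>2 r = j" "\<xi>2 p = i"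
        using link_move[OF linked_sym[OF lk] k1(1) i(1), of p] k1 js j pr by auto
      have "recS \<xi>2 \<psi>"
        by (rule link_recolorable[OF lk k2(1) c(2), of r s])
          (use k2 x i sKK pr \<open>i \<noteq> x\<close> in auto)
      then show ?thesis using k1 k2 recolorable_trans by blast
    qed
  qed
qed

lemma link_recolorable_any:
  assumes lk: "linked p r" and full: "card (L p) = card K" and c: "colS \<phi>" "colS \<psi>"
    and sl: "\<phi> p \<notin> L s" "\<psi> r \<notin> L s"
  shows "recS \<phi> \<psi>"
proof (cases "\<phi> p = \<psi> r")
  case True
  then show ?thesis using link_recolorable_same[OF lk full c] sl by blast
next
  case False
  have "s \<noteq> p" "s \<noteq> r" using lk by (auto simp: linked_def)
  then show ?thesis using link_recolorable[OF lk c False, of s s] sl s_K by blast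
qed

text \<open>The clique shows \<open>card K\<close> colors and \<open>L s\<close> has one fewer, so
  each coloring is in a class whose color is missing at \<open>s\<close>. By \<open>H\<close> two
  such classes are joined directly or through a third, which is nonempty because a list of size
  \<open>card K\<close> has a color outside \<open>L s\<close>.\<close>

theorem hub_swappable:
  assumes H: "\<And>v v'. v \<in> K - {s} \<Longrightarrow> v' \<in> K - {s} \<Longrightarrow>
     linked v v' \<and> card (L v) = card K \<or> linked v' v \<and> card (L v') = card K \<or>
     (\<exists>u. card (L u) = card K \<and> linked u v \<and> linked u v')"
  shows "swappable adj L (K \<union> T)"
  unfolding swappable_def
proof (intro allI impI)
  fix \<phi> \<psi> assume c: "colS \<phi>" "colS \<psi>"
  have finLs: "finite (L s)" using list_s card_K by (intro card_ge_0_finite) auto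
  have ex: "\<exists>v\<in>K - {s}. \<xi> v \<notin> L s" if "colS \<xi>" for \<xi>
  proof (rule ccontr)
    assume "\<not> ?thesis"
    then have "\<xi> ` K \<subseteq> L s" using that s_K unfolding coloring_on_def by (auto; metis Un_iff)
    moreover have "inj_on \<xi> K"
      using that clique unfolding inj_on_def coloring_on_def by (metis UnI1)
    ultimately have "card K \<le> card (L s)" using finLs by (metis card_image card_mono)
    then show False using list_s card_K by auto
  qed
  obtain v where v: "v \<in> K - {s}" "\<phi> v \<notin> L s" using ex c by blast
  obtain v' where v': "v' \<in> K - {s}" "\<psi> v' \<notin> L s" using ex c by blast
  show "recS \<phi> \<psi>"
    using H[OF v(1) v'(1)]
  proof (elim disjE conjE exE)
    assume "linked v v'" "card (L v) = card K"
    then show ?thesis using link_recolorable_any c v v' by blast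
  next
    assume "linked v' v" "card (L v') = card K"
    then show ?thesis using link_recolorable_any c v v' recolorable_sym by blast
  next
    fix u assume u: "card (L u) = card K" "linked u v" "linked u v'"
    then have uK: "u \<in> K" "u \<noteq> s" by (auto simp: linked_def)
    have "\<not> L u \<subseteq> L s" using u(1) list_s card_K finLs card_mono[of "L s" "L u"] by auto
    then obtain x where "x \<in> L u" "x \<notin> L s" by blast
    then obtain \<xi> where "colS \<xi>" "\<xi> u \<notin> L s" using class_nonempty[OF uK] by blast
    then show ?thesis
      using link_recolorable_any[OF u(2,1), of \<xi> \<phi>] link_recolorable_any[OF u(3,1), of \<xi> \<psi>] c v v'
        recolorable_sym recolorable_trans by blast
  qed
qed

end

section \<open>Connectedness, gluing and the star configuration\<close>

context symmetric_graph
begin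

lemma connected_setD:
  "connected_set adj S \<Longrightarrow> U \<subseteq> S \<Longrightarrow> U \<noteq> {} \<Longrightarrow> U \<noteq> S \<Longrightarrow> \<exists>a\<in>U. \<exists>b\<in>S - U. adj a b"
  by (simp add: connected_set_def)

lemma connected_set_clique:
  assumes "\<And>u v. u \<in> A \<Longrightarrow> v \<in> A \<Longrightarrow> u \<noteq> v \<Longrightarrow> adj u v"
  shows "connected_set adj A"
  unfolding connected_set_def
proof (intro allI impI)
  fix U assume "U \<subseteq> A" "U \<noteq> {}" "U \<noteq> A"
  then obtain a b where "a \<in> U" "b \<in> A - U" by blast
  then show "\<exists>a\<in>U. \<exists>b\<in>A - U. adj a b" using assms \<open>U \<subseteq> A\<close> by blast
qed

lemma connected_set_Union:
  assumes A: "connected_set adj A"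
    and B: "\<And>B. B \<in> \<B> \<Longrightarrow> connected_set adj B \<and> (\<exists>a\<in>A. \<exists>b\<in>B. adj a b)"
  shows "connected_set adj (A \<union> \<Union>\<B>)"
  unfolding connected_set_def
proof (intro allI impI)
  fix U assume U: "U \<subseteq> A \<union> \<Union>\<B>" "U \<noteq> {}" "U \<noteq> A \<union> \<Union>\<B>"
  let ?S = "A \<union> \<Union>\<B>"
  have split: "\<exists>a\<in>U. \<exists>b\<in>?S - U. adj a b"
    if C: "connected_set adj C" "C \<subseteq> ?S" "C \<inter> U \<noteq> {}" "\<not> C \<subseteq> U" for C
  proof -
    have "C \<inter> U \<subseteq> C" "C \<inter> U \<noteq> C" using C by auto
    then obtain a b where "a \<in> C \<inter> U" "b \<in> C - C \<inter> U" "adj a b"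
      using connected_setD[OF C(1) _ C(3)] by blast
    then show ?thesis using C(2) by blast
  qed
  consider "A \<inter> U \<noteq> {}" "\<not> A \<subseteq> U" | "A \<subseteq> U" | "A \<inter> U = {}" by blast
  then show "\<exists>a\<in>U. \<exists>b\<in>?S - U. adj a b"
  proof cases
    case 1
    then show ?thesis using split[OF A] by blast
  next
    case 2
    then obtain z B where z: "z \<in> B" "B \<in> \<B>" "z \<notin> U" using U by blast
    show ?thesis
    proof (cases "B \<inter> U = {}")
      case True
      obtain a b where "a \<in> A" "b \<in> B" "adj a b" using B z by blast
      then show ?thesis using 2 True z(2) by blast
    next
      case False
      then show ?thesis using split[of B] B z by blast
    qed
  next
    case 3
    then obtain z B where z: "z \<in> B" "B \<in> \<B>" "z \<in> U" using U by blast
    show ?thesis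
    proof (cases "B \<subseteq> U")
      case True
      obtain a b where "a \<in> A" "b \<in> B" "adj a b" using B z by blast
      then show ?thesis using 3 True adj_sym by blast
    next
      case False
      then show ?thesis using split[of B] B z by blast
    qed
  qed
qed

text \<open>\<open>t\<close> is simplicial, so passing through it can be replaced by the edge
  between its two neighbors.\<close>

lemma connected_set_remove:
  assumes S: "connected_set adj S" and "t \<in> S"
    and cl: "\<And>u v. u \<in> S \<Longrightarrow> v \<in> S \<Longrightarrow> adj t u \<Longrightarrow> adj t v \<Longrightarrow> u \<noteq> v \<Longrightarrow> adj u v"
  shows "connected_set adj (S - {t})"
  unfolding connected_set_def
proof (intro allI impI)
  fix U assume U: "U \<subseteq> S - {t}" "U \<noteq> {}" "U \<noteq> S - {t}"
  then have "U \<subseteq> S" "U \<noteq> S" "insert t U \<subseteq> S" "insert t U \<noteq> S" "insert t U \<noteq> {}"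
    using assms(2) by auto
  note sub = this
  obtain a b where ab: "a \<in> U" "b \<in> S - U" "adj a b"
    using connected_setD[OF S sub(1) U(2) sub(2)] by blast
  obtain c d where cd: "c \<in> insert t U" "d \<in> S - insert t U" "adj c d"
    using connected_setD[OF S sub(3,5,4)] by blast
  show "\<exists>a\<in>U. \<exists>b\<in>S - {t} - U. adj a b"
  proof (cases "b = t \<and> c = t")
    case True
    then have "adj a d" using cl[of a d] ab cd adj_sym U(1) by blast
    then show ?thesis using ab cd by blast
  next
    case False
    then show ?thesis using ab cd by blast
  qed
qed

lemma coloring_on_Union:
  assumes ex: "\<And>B. B \<in> \<B> \<Longrightarrow> \<exists>\<sigma>. coloring_on adj L B \<sigma> \<and> P B \<sigma>"
    and dis: "\<And>B B'. B \<in> \<B> \<Longrightarrow> B' \<in> \<B> \<Longrightarrow> B \<noteq> B' \<Longrightarrow> B \<inter> B' = {} \<and> (\<forall>a\<in>B. \<forall>b\<in>B'. \<not> adj a b)"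
  obtains \<tau> where "coloring_on adj L (\<Union>\<B>) \<tau>"
    "\<And>B. B \<in> \<B> \<Longrightarrow> \<exists>\<sigma>. coloring_on adj L B \<sigma> \<and> P B \<sigma> \<and> (\<forall>t\<in>B. \<tau> t = \<sigma> t)"
proof -
  from ex have "\<forall>B\<in>\<B>. \<exists>\<sigma>. coloring_on adj L B \<sigma> \<and> P B \<sigma>" by blast
  then obtain f where f: "\<And>B. B \<in> \<B> \<Longrightarrow> coloring_on adj L B (f B) \<and> P B (f B)" by metis
  define g where "g t = (SOME B. B \<in> \<B> \<and> t \<in> B)" for t
  define \<tau> where "\<tau> t = f (g t) t" for t
  have g: "g t = B" if "B \<in> \<B>" "t \<in> B" for t B
  proof -
    have "g t \<in> \<B> \<and> t \<in> g t" unfolding g_def by (rule someI[of _ B]) (use that in blast)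
    then show ?thesis using dis[of "g t" B] that by blast
  qed
  have \<tau>: "\<tau> t = f B t" if "B \<in> \<B>" "t \<in> B" for t B using g that by (simp add: \<tau>_def)
  have "coloring_on adj L (\<Union>\<B>) \<tau>"
    unfolding coloring_on_def
  proof (intro conjI ballI impI)
    fix v assume "v \<in> \<Union>\<B>"
    then obtain B where "B \<in> \<B>" "v \<in> B" by blast
    then show "\<tau> v \<in> L v" using f[of B] \<tau> unfolding coloring_on_def by simp
  next
    fix u v assume "u \<in> \<Union>\<B>" "v \<in> \<Union>\<B>" "adj u v"
    then obtain B where B: "B \<in> \<B>" "u \<in> B" "v \<in> B" using dis by blast
    then show "\<tau> u \<noteq> \<tau> v" using f[of B] \<tau> \<open>adj u v\<close> unfolding coloring_on_def by simp
  qed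
  moreover have "\<exists>\<sigma>. coloring_on adj L B \<sigma> \<and> P B \<sigma> \<and> (\<forall>t\<in>B. \<tau> t = \<sigma> t)" if "B \<in> \<B>" for B
    using f[OF that] \<tau>[OF that] by blast
  ultimately show ?thesis using that by blast
qed

text \<open>The argument of Lovasz for Brooks's theorem, for two related colorings at once. A color
  \<open>i\<close> outside \<open>{\<alpha>, \<beta>}\<close> is left for \<open>p\<close> and is
  unaffected by the move. If \<open>i\<close> is useless at \<open>b\<close> or at \<open>t\<close>,
  giving it to \<open>p\<close> creates slack there; otherwise \<open>b\<close> and \<open>t\<close>
  both take \<open>i\<close>, and the repetition creates slack at \<open>p\<close>.\<close>

lemma related_pair_extend_star:
  assumes fin: "finite S" and dis: "S \<inter> V = {}"
    and c: "coloring_on adj L V \<phi>" "coloring_on adj L V \<phi>'" and rel: "swap_related \<alpha> \<beta> V \<phi> \<phi>'"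
    and deg: "\<And>v. v \<in> S \<Longrightarrow> finite (nbrs (V \<union> S) v) \<and> card (nbrs (V \<union> S) v) \<le> card (L v)"
    and S: "p \<in> S" "b \<in> S" "t \<in> S" "adj p b" "adj p t" "\<not> adj b t" "b \<noteq> t"
    and conn: "connected_set adj (S - {p})" "connected_set adj (S - {b, t})"
    and three: "3 \<le> card (nbrs S p)"
  shows "\<exists>\<Phi> \<Phi>'. coloring_on adj L (V \<union> S) \<Phi> \<and> coloring_on adj L (V \<union> S) \<Phi>' \<and>
     swap_related \<alpha> \<beta> (V \<union> S) \<Phi> \<Phi>' \<and> (\<forall>v\<in>V. \<Phi> v = \<phi> v \<and> \<Phi>' v = \<phi>' v)"
proof -
  have nV: "card (nbrs (V \<union> S) p) = card (nbrs S p) + card (nbrs V p)" and finV: "finite (nbrs V p)"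
  proof -
    have 1: "nbrs (V \<union> S) p = nbrs S p \<union> nbrs V p" by auto
    have 2: "finite (nbrs (V \<union> S) p)" using deg S by blast
    then show "finite (nbrs V p)" unfolding 1 by simp
    show "card (nbrs (V \<union> S) p) = card (nbrs S p) + card (nbrs V p)"
      using 2 dis unfolding 1 by (intro card_Un_disjoint) auto
  qed
  \<comment> \<open>Three neighbors of \<open>p\<close> are still uncolored, so three colors remain,
    one more than \<open>\<alpha>\<close> and \<open>\<beta>\<close> can account for.\<close>
  have "3 \<le> card (residual adj L V \<phi> p)"
    using card_residual[OF finV, of L \<phi>] nV deg[OF S(1)] three by linarith
  moreover have "card {\<alpha>, \<beta>} \<le> 2" by (simp add: card_insert_if)
  ultimately have "\<not> residual adj L V \<phi> p \<subseteq> {\<alpha>, \<beta>}"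
    by (metis card_mono finite.emptyI finite.insertI le_trans not_numeral_le_zero numeral_le_iff semiring_norm(72) Suc_leI not_less_eq_eq numeral_3_eq_3 numeral_2_eq_2)
  then obtain i where i: "i \<in> residual adj L V \<phi> p" "i \<noteq> \<alpha>" "i \<noteq> \<beta>" by blast
  have iL: "i \<in> L p" "\<And>u. u \<in> V \<Longrightarrow> adj p u \<Longrightarrow> \<phi> u \<noteq> i"
    using i(1) unfolding residual_def by auto
  have static: "\<phi>' u = i \<longleftrightarrow> \<phi> u = i" if "u \<in> V" for u
    using rel i that unfolding swap_related_def by metis
  have ext: "coloring_on adj L (V \<union> X) (\<lambda>u. if u \<in> X then i else f u)"
    if f: "coloring_on adj L V f" "\<And>x. x \<in> X \<Longrightarrow> i \<in> L x" "\<And>x u. x \<in> X \<Longrightarrow> u \<in> V \<Longrightarrow> adj x u \<Longrightarrow> f u \<noteq> i"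
      and X: "\<And>x y. x \<in> X \<Longrightarrow> y \<in> X \<Longrightarrow> \<not> adj x y" for X f
    unfolding coloring_on_def
  proof (intro conjI ballI impI)
    fix u v assume uv: "u \<in> V \<union> X" "v \<in> V \<union> X" "adj u v"
    show "(if u \<in> X then i else f u) \<noteq> (if v \<in> X then i else f v)"
    proof (cases "u \<in> X")
      case True
      then show ?thesis using X[of u v] f(3)[of u v] uv by auto
    next
      case False
      show ?thesis
      proof (cases "v \<in> X")
        case True
        then show ?thesis using False f(3)[of v u] uv adj_sym by auto
      next
        case f2: False
        then show ?thesis using False f(1) uv unfolding coloring_on_def by auto
      qed
    qed
  qed (use f in \<open>auto simp: coloring_on_def\<close>)
  have main: "\<exists>\<Phi> \<Phi>'. coloring_on adj L (V \<union> S) \<Phi> \<and> coloring_on adj L (V \<union> S) \<Phi>' \<and>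
     swap_related \<alpha> \<beta> (V \<union> S) \<Phi> \<Phi>' \<and> (\<forall>v\<in>V. \<Phi> v = \<phi> v \<and> \<Phi>' v = \<phi>' v)"
    if X: "X \<subseteq> S" "\<And>x. x \<in> X \<Longrightarrow> i \<in> L x" "\<And>x u. x \<in> X \<Longrightarrow> u \<in> V \<Longrightarrow> adj x u \<Longrightarrow> \<phi> u \<noteq> i"
       "\<And>x y. x \<in> X \<Longrightarrow> y \<in> X \<Longrightarrow> \<not> adj x y" "connected_set adj (S - X)"
      and s: "s \<in> S - X" "x \<in> X" "adj s x"
        "i \<notin> L s \<or> (\<exists>y\<in>V. adj s y \<and> \<phi> y = i) \<or> (\<exists>y\<in>X. y \<noteq> x \<and> adj s y)" for X s x
  proof -
    let ?f = "\<lambda>u. if u \<in> X then i else \<phi> u" and ?f' = "\<lambda>u. if u \<in> X then i else \<phi>' u"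
    have VX: "V \<union> X \<union> (S - X) = V \<union> S" using X(1) by auto
    have XV: "x \<notin> V" "X \<inter> V = {}" using X(1) s(2) dis by auto
    have "\<exists>\<Phi> \<Phi>'. coloring_on adj L (V \<union> X \<union> (S - X)) \<Phi> \<and> coloring_on adj L (V \<union> X \<union> (S - X)) \<Phi>' \<and>
      swap_related \<alpha> \<beta> (V \<union> X \<union> (S - X)) \<Phi> \<Phi>' \<and> (\<forall>v\<in>V \<union> X. \<Phi> v = ?f v \<and> \<Phi>' v = ?f' v)"
    proof (rule related_pair_extend_connected[where s = s and x = x])
      show "finite (S - X)" "(S - X) \<inter> (V \<union> X) = {}" using fin dis by auto
      show "connected_set adj (S - X)" by fact
      show "coloring_on adj L (V \<union> X) ?f" using ext[OF c(1)] X by blast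
      show "coloring_on adj L (V \<union> X) ?f'" by (rule ext[OF c(2)]) (use X static in blast)+
      show "swap_related \<alpha> \<beta> (V \<union> X) ?f ?f'" using rel unfolding swap_related_def by auto
      show "finite (nbrs (V \<union> X \<union> (S - X)) v) \<and> card (nbrs (V \<union> X \<union> (S - X)) v) \<le> card (L v)"
        if "v \<in> S - X" for v unfolding VX using deg that by blast
      show "?f x \<notin> L s \<or> (\<exists>y\<in>V \<union> X. y \<noteq> x \<and> adj s y \<and> ?f y = ?f x \<and> ?f' y = ?f x)"
        using s(4)
      proof (elim disjE bexE conjE)
        fix y assume "y \<in> V" "adj s y" "\<phi> y = i"
        moreover from this have "y \<noteq> x" "y \<notin> X" using XV by auto
        ultimately show ?thesis using static[of y] s(2) by (intro disjI2 bexI[of _ y]) auto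
      qed (use s(2) in auto)
    qed (use s in auto)
    then show ?thesis unfolding VX using XV(2)
      by (elim exE conjE, intro exI conjI) (assumption | auto)+
  qed
  consider (b) "i \<notin> L b \<or> (\<exists>y\<in>V. adj b y \<and> \<phi> y = i)" | (t) "i \<notin> L t \<or> (\<exists>y\<in>V. adj t y \<and> \<phi> y = i)"
    | (bt) "i \<in> L b" "\<forall>y\<in>V. adj b y \<longrightarrow> \<phi> y \<noteq> i" "i \<in> L t" "\<forall>y\<in>V. adj t y \<longrightarrow> \<phi> y \<noteq> i" by blast
  then show ?thesis
  proof cases
    case b
    have "b \<noteq> p" using S adj_irrefl by auto
    then show ?thesis
      by (intro main[of "{p}" b p]) (use b S iL conn adj_sym adj_irrefl in auto)
  next
    case t
    have "t \<noteq> p" using S adj_irrefl by auto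
    then show ?thesis
      by (intro main[of "{p}" t p]) (use t S iL conn adj_sym adj_irrefl in auto)
  next
    case bt
    have "b \<noteq> p" "t \<noteq> p" using S adj_irrefl by auto
    then show ?thesis
      by (intro main[of "{b, t}" p b]) (use bt S conn adj_sym adj_irrefl in auto)
  qed
qed

end

section \<open>A clique with branches\<close>

definition degree_colorable :: "('v \<Rightarrow> 'v \<Rightarrow> bool) \<Rightarrow> 'c itself \<Rightarrow> 'v set \<Rightarrow> bool" where
  "degree_colorable adj _ B \<longleftrightarrow> (\<forall>M :: 'v \<Rightarrow> 'c set.
     (\<forall>t\<in>B. card {u \<in> B. adj t u} \<le> card (M t)) \<longrightarrow> (\<exists>\<sigma>. coloring_on adj M B \<sigma>))"

text \<open>The concrete source of hubs: a clique vertex sees at most one vertex of all branches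
  together, and \<open>s\<close> sees none. Lists are only assumed at least as large as the degrees;
  strict inequality anywhere makes the whole connected set degenerate.\<close>

locale branched_clique = symmetric_graph adj for adj :: "'v \<Rightarrow> 'v \<Rightarrow> bool" +
  fixes L :: "'v \<Rightarrow> 'c set" and K :: "'v set" and \<B> :: "'v set set" and s :: 'v
  assumes finite_K: "finite K"
    and clique: "\<And>u v. u \<in> K \<Longrightarrow> v \<in> K \<Longrightarrow> u \<noteq> v \<Longrightarrow> adj u v"
    and card_K: "4 \<le> card K" and s_K: "s \<in> K"
    and finite_B: "finite (\<Union>\<B>)" and disjoint_K: "K \<inter> \<Union>\<B> = {}"
    and conn_B: "\<And>B. B \<in> \<B> \<Longrightarrow> connected_set adj B"
    and disjoint_B: "\<And>B B'. B \<in> \<B> \<Longrightarrow> B' \<in> \<B> \<Longrightarrow> B \<noteq> B' \<Longrightarrow>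
       B \<inter> B' = {} \<and> (\<forall>a\<in>B. \<forall>b\<in>B'. \<not> adj a b)"
    and s_B: "\<And>t. t \<in> \<Union>\<B> \<Longrightarrow> \<not> adj s t"
    and one_nbr: "\<And>v. v \<in> K \<Longrightarrow> card {t \<in> \<Union>\<B>. adj v t} \<le> 1"
    and att_ne: "\<And>B. B \<in> \<B> \<Longrightarrow> \<exists>v\<in>K. \<exists>t\<in>B. adj v t"
    and deg: "\<And>v. v \<in> K \<union> \<Union>\<B> \<Longrightarrow> card {u \<in> K \<union> \<Union>\<B>. adj v u} \<le> card (L v)"
begin

definition att :: "'v set \<Rightarrow> 'v set" where "att B = {v \<in> K. \<exists>t\<in>B. adj v t}"

text \<open>Degree-choosability: such a branch can be colored after all clique vertices attached to
  it, whatever their colors.\<close>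

definition free :: "'v set \<Rightarrow> bool" where "free B \<longleftrightarrow> degree_colorable adj TYPE('c) B"

lemma finite_nbrs_B: "finite {t \<in> \<Union>\<B>. adj v t}"
  by (rule finite_subset[OF _ finite_B]) blast

lemma att_unique:
  assumes "v \<in> att B" "v \<in> att B'" "B \<in> \<B>" "B' \<in> \<B>"
  shows "B = B'"
proof (rule ccontr)
  assume ne: "B \<noteq> B'"
  obtain t t' where t: "t \<in> B" "adj v t" "t' \<in> B'" "adj v t'" "v \<in> K"
    using assms by (auto simp: att_def)
  have "t \<noteq> t'" using t ne disjoint_B[OF assms(3,4)] by auto
  have "card {t, t'} \<le> card {t \<in> \<Union>\<B>. adj v t}"
    using t assms by (intro card_mono finite_nbrs_B) blast
  then show False using one_nbr[OF t(5)] \<open>t \<noteq> t'\<close> by simp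
qed

text \<open>\<open>Q v\<close> collects the branches attached to \<open>v\<close> alone, and an
  attached vertex fails to be linked to another vertex only if a branch that is not free is attached
  to exactly these two. Such bad pairs form a matching, so three attached vertices always leave a
  suitable intermediary; without bad pairs two are enough.\<close>

lemma branched_clique_swappable:
  assumes single: "\<And>B. B \<in> \<B> \<Longrightarrow> card (att B) = 1 \<Longrightarrow> free B"
    and big: "3 \<le> card (\<Union>(att ` \<B>)) \<or> 2 \<le> card (\<Union>(att ` \<B>)) \<and> (\<forall>B\<in>\<B>. free B)"
  shows "swappable adj L (K \<union> \<Union>\<B>)"
proof -
  let ?T = "\<Union>\<B>"
  have finS: "finite (K \<union> ?T)" using finite_K finite_B by simp
  have att': "att B \<noteq> {}" "att B \<subseteq> K - {s}" if "B \<in> \<B>" for B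
    using att_ne[OF that] s_B that by (auto simp: att_def)
  have nbrsK: "card (nbrs (K \<union> ?T) v) = card K - 1 + card (nbrs ?T v)" if "v \<in> K" for v
  proof -
    have "nbrs (K \<union> ?T) v = (K - {v}) \<union> nbrs ?T v" using that clique adj_irrefl by auto
    moreover have "(K - {v}) \<inter> nbrs ?T v = {}" using disjoint_K by auto
    ultimately show ?thesis using finite_K that finite_nbrs_B by (simp add: card_Un_disjoint)
  qed
  have connK: "connected_set adj A" if "A \<subseteq> K" for A
    using clique that by (intro connected_set_clique) blast
  show ?thesis
  proof (cases "\<exists>v\<in>K \<union> ?T. card (nbrs (K \<union> ?T) v) < card (L v)")
    case True
    have "connected_set adj (K \<union> ?T)"
      using conn_B att_ne by (intro connected_set_Union connK) auto
    then show ?thesis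
      using True degenerate_connected[OF finS _ deg] degenerate_swappable[OF finS] by blast
  next
    case False
    then have exact: "card (L v) = card (nbrs (K \<union> ?T) v)" if "v \<in> K \<union> ?T" for v
      using deg[OF that] that by (meson le_antisym not_le)
    define Q where "Q v = \<Union>{B \<in> \<B>. att B = {v}}" for v
    have QT: "Q v \<subseteq> ?T" for v unfolding Q_def by auto
    \<comment> \<open>If \<open>B\<close> is not free, an attached vertex outside \<open>X\<close>
      is still uncolored and gives slack to its neighbor in the connected set
      \<open>B\<close>.\<close>
    have res_free: "\<exists>\<sigma>. coloring_on adj (residual adj L X \<kappa>) B \<sigma>"
      if B: "B \<in> \<B>" and X: "X \<subseteq> K" "finite X" and ok: "free B \<or> (\<exists>v. v \<in> att B - X)" for B X \<kappa>
    proof -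
      have finB: "finite B" using finite_B B by (meson Union_upper finite_subset)
      have nb: "card (nbrs B t) + card (nbrs K t) = card (L t)" if "t \<in> B" for t
      proof -
        have "nbrs (K \<union> ?T) t = nbrs B t \<union> nbrs K t"
          using B that disjoint_B by blast
        moreover have "nbrs B t \<inter> nbrs K t = {}" using disjoint_K B by auto
        moreover have "finite (nbrs B t)" "finite (nbrs K t)" using finB finite_K by auto
        ultimately have "card (nbrs (K \<union> ?T) t) = card (nbrs B t) + card (nbrs K t)"
          by (simp add: card_Un_disjoint)
        moreover have "t \<in> K \<union> ?T" using B that by blast
        ultimately show ?thesis using exact[of t] by linarith
      qed
      have finX: "finite (nbrs X t)" for t using X by simp
      have XK: "card (nbrs X t) \<le> card (nbrs K t)" for t
        using X finite_K by (intro card_mono) auto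
      have le: "card (nbrs B t) \<le> card (residual adj L X \<kappa> t)" if "t \<in> B" for t
        using card_residual[OF finX, of L t \<kappa>] nb[OF that] XK[of t] by linarith
      from ok show ?thesis
      proof
        assume "free B"
        then show ?thesis using le unfolding free_def degree_colorable_def by blast
      next
        assume "\<exists>v. v \<in> att B - X"
        then obtain v t where v: "v \<in> K" "v \<notin> X" "t \<in> B" "adj v t" by (auto simp: att_def)
        have "nbrs X t \<subset> nbrs K t" using v X adj_sym by auto
        then have "card (nbrs X t) < card (nbrs K t)" using finite_K by (intro psubset_card_mono) auto
        then have "card (nbrs B t) < card (residual adj L X \<kappa> t)"
          using card_residual[OF finX, of L t \<kappa>] nb[OF v(3)] by linarith
        then have "degenerate adj (residual adj L X \<kappa>) B"
          using degenerate_connected[OF finB conn_B[OF B] le v(3)] by blast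
        then show ?thesis using degenerate_colorable[OF finB] by blast
      qed
    qed
    have res: "coloring_on adj L B \<sigma> \<and> (\<forall>x\<in>X. \<forall>t\<in>B. adj x t \<longrightarrow> \<sigma> t \<noteq> \<kappa> x)"
      if "coloring_on adj (residual adj L X \<kappa>) B \<sigma>" for B X \<kappa> \<sigma>
    proof -
      have "\<sigma> t \<noteq> \<kappa> x" if "t \<in> B" "x \<in> X" "adj x t" for t x
        using \<open>coloring_on adj (residual adj L X \<kappa>) B \<sigma>\<close> that adj_sym
        unfolding coloring_on_def residual_def by blast
      then show ?thesis using that unfolding coloring_on_def residual_def by blast
    qed
    interpret hub adj L K ?T s Q
    proof
      show "card (L s) = card K - 1"
      proof -
        have "nbrs ?T s = {}" using s_B by auto
        then have "card (nbrs ?T s) = 0" by (metis card.empty)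
        then show ?thesis using exact[of s] nbrsK[OF s_K] s_K by simp
      qed
      show "card (L v) = card K - 1 + card (nbrs ?T v) \<and> card (nbrs ?T v) \<le> 1" if "v \<in> K" for v
        using exact[of v] nbrsK[OF that] one_nbr[OF that] that by simp
      show "connected_set adj (K \<union> ?T - insert v (Q v))" if v: "v \<in> K" "v \<noteq> s" for v
      proof -
        have "K \<union> ?T - insert v (Q v) = (K - {v}) \<union> \<Union>{B \<in> \<B>. att B \<noteq> {v}}"
        proof -
          have "B \<inter> Q v = {}" if "B \<in> \<B>" "att B \<noteq> {v}" for B
            using that disjoint_B unfolding Q_def by blast
          then show ?thesis using v disjoint_K unfolding Q_def by blast
        qed
        moreover have "connected_set adj ((K - {v}) \<union> \<Union>{B \<in> \<B>. att B \<noteq> {v}})"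
        proof (rule connected_set_Union)
          fix B assume "B \<in> {B \<in> \<B>. att B \<noteq> {v}}"
          then have B: "B \<in> \<B>" "att B \<noteq> {v}" by auto
          then obtain u where "u \<in> att B" "u \<noteq> v" using att'(1)[of B] by blast
          then show "connected_set adj B \<and> (\<exists>a\<in>K - {v}. \<exists>b\<in>B. adj a b)"
            using conn_B B by (auto simp: att_def)
        qed (rule connK, blast)
        ultimately show ?thesis by simp
      qed
      show "\<exists>\<sigma>. coloring_on adj L (Q v) \<sigma> \<and> (\<forall>t\<in>Q v. adj v t \<longrightarrow> \<sigma> t \<noteq> x)"
        if v: "v \<in> K" "v \<noteq> s" for v x
      proof -
        have ex: "\<exists>\<sigma>. coloring_on adj L B \<sigma> \<and> (\<forall>t\<in>B. adj v t \<longrightarrow> \<sigma> t \<noteq> x)"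
          if "B \<in> {B \<in> \<B>. att B = {v}}" for B
          using res_free[of B "{v}" "\<lambda>_. x"] res[of "{v}" "\<lambda>_. x" B] single[of B] that v by auto
        let ?C = "{B \<in> \<B>. att B = {v}}"
        have dC: "B \<inter> B' = {} \<and> (\<forall>a\<in>B. \<forall>b\<in>B'. \<not> adj a b)"
          if "B \<in> ?C" "B' \<in> ?C" "B \<noteq> B'" for B B' using disjoint_B[of B B'] that by simp
        obtain \<tau> where \<tau>: "coloring_on adj L (\<Union>?C) \<tau>" "\<And>B. B \<in> ?C \<Longrightarrow>
            \<exists>\<sigma>. coloring_on adj L B \<sigma> \<and> (\<forall>t\<in>B. adj v t \<longrightarrow> \<sigma> t \<noteq> x) \<and> (\<forall>t\<in>B. \<tau> t = \<sigma> t)"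
          using coloring_on_Union[of ?C L "\<lambda>B \<sigma>. \<forall>t\<in>B. adj v t \<longrightarrow> \<sigma> t \<noteq> x", OF ex dC] by blast
        have "\<tau> t \<noteq> x" if "t \<in> \<Union>?C" "adj v t" for t
        proof -
          from that(1) obtain B where B: "B \<in> ?C" "t \<in> B" by blast
          then show ?thesis using \<tau>(2)[OF B(1)] that(2) by metis
        qed
        then show ?thesis using \<tau>(1) unfolding Q_def by blast
      qed
    qed (use finite_K finite_B disjoint_K clique card_K s_K s_B deg QT in auto)
    have link: "linked p r"
      if pr: "p \<in> K - {s}" "r \<in> K - {s}" "p \<noteq> r"
        and ok: "\<And>B. B \<in> \<B> \<Longrightarrow> att B = {p, r} \<Longrightarrow> free B" for p r
      unfolding linked_def
    proof (intro conjI allI impI)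
      fix x x' \<sigma> \<rho>
      assume s1: "coloring_on adj L (Q p) \<sigma>" "avoids p (Q p) x \<sigma>"
        and r1: "coloring_on adj L (Q r) \<rho>" "avoids r (Q r) x' \<rho>"
      define \<kappa> where "\<kappa> = (\<lambda>v. if v = p then x else x')"
      let ?P = "\<lambda>B \<tau>. (att B = {p} \<longrightarrow> (\<forall>t\<in>B. \<tau> t = \<sigma> t)) \<and> (att B = {r} \<longrightarrow> (\<forall>t\<in>B. \<tau> t = \<rho> t)) \<and>
        avoids p B x \<tau> \<and> avoids r B x' \<tau>"
      have ex: "\<exists>\<tau>. coloring_on adj L B \<tau> \<and> ?P B \<tau>" if B: "B \<in> \<B>" for B
      proof -
        consider (p) "att B = {p}" | (r) "att B = {r}" | (o) "att B \<noteq> {p}" "att B \<noteq> {r}" by blast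
        then show ?thesis
        proof cases
          case p
          have "B \<subseteq> Q p" using p B by (auto simp: Q_def)
          moreover have "r \<notin> att B" using p pr by auto
          ultimately show ?thesis using s1 p pr coloring_on_subset[OF s1(1), of B]
            by (intro exI[of _ \<sigma>]) (auto simp: att_def)
        next
          case r
          have "B \<subseteq> Q r" using r B by (auto simp: Q_def)
          moreover have "p \<notin> att B" using r pr by auto
          ultimately show ?thesis using r1 r pr coloring_on_subset[OF r1(1), of B]
            by (intro exI[of _ \<rho>]) (auto simp: att_def)
        next
          case o
          have "free B \<or> (\<exists>v. v \<in> att B - {p, r})"
            using ok[OF B] o att'(1)[OF B] by blast
          then obtain \<tau> where "coloring_on adj (residual adj L {p, r} \<kappa>) B \<tau>"
            using res_free[OF B, of "{p, r}" \<kappa>] pr by blast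
          from res[OF this] show ?thesis using o pr by (intro exI[of _ \<tau>]) (auto simp: \<kappa>_def)
        qed
      qed
      obtain \<tau> where \<tau>: "coloring_on adj L ?T \<tau>" "\<And>B. B \<in> \<B> \<Longrightarrow>
          \<exists>\<sigma>. coloring_on adj L B \<sigma> \<and> ?P B \<sigma> \<and> (\<forall>t\<in>B. \<tau> t = \<sigma> t)"
        using coloring_on_Union[of \<B> L ?P, OF ex disjoint_B] by blast
      have \<tau>P: "?P B \<tau>" if "B \<in> \<B>" for B using \<tau>(2)[OF that] by fastforce
      show "\<exists>\<tau>. coloring_on adj L ?T \<tau> \<and> (\<forall>t\<in>Q p. \<tau> t = \<sigma> t) \<and> (\<forall>t\<in>Q r. \<tau> t = \<rho> t) \<and>
          avoids p ?T x \<tau> \<and> avoids r ?T x' \<tau>"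
        using \<tau>(1) \<tau>P unfolding Q_def by (intro exI[of _ \<tau>]) blast
    qed (use pr in auto)
    let ?A = "\<Union>(att ` \<B>)"
    have A: "?A \<subseteq> K - {s}" using att' by blast
    have full: "card (L v) = card K" if "v \<in> ?A" for v
    proof -
      obtain B t where "B \<in> \<B>" "t \<in> B" "adj v t" "v \<in> K" using \<open>v \<in> ?A\<close> by (auto simp: att_def)
      then have "nbrs ?T v \<noteq> {}" "v \<noteq> s" using s_B by auto
      then have "card (nbrs ?T v) = 1"
        using one_nbr[OF \<open>v \<in> K\<close>] card_0_eq[OF finite_nbrs_B, of v] by linarith
      then show ?thesis using list_K[OF \<open>v \<in> K\<close> \<open>v \<noteq> s\<close>] card_K by simp
    qed
    define bad where "bad u v \<longleftrightarrow> (\<exists>B\<in>\<B>. att B = {u, v} \<and> \<not> free B)" for u v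
    have bad_sym: "bad u v \<Longrightarrow> bad v u" for u v unfolding bad_def by (simp add: insert_commute)
    have bad_A: "bad u v \<Longrightarrow> v \<in> ?A" for u v unfolding bad_def by blast
    have bad_unique: "v = w" if b: "bad u v" "bad u w" "v \<noteq> u" for u v w
    proof -
      obtain B B' where B: "B \<in> \<B>" "att B = {u, v}" "B' \<in> \<B>" "att B' = {u, w}"
        using b unfolding bad_def by blast
      then have "B = B'" using att_unique[of u B B'] by blast
      then have "{u, v} = {u, w}" using B by simp
      then show ?thesis using b(3) by (auto simp: doubleton_eq_iff)
    qed
    have lk: "linked u v" if "u \<in> ?A" "v \<in> K - {s}" "u \<noteq> v" "\<not> bad u v" for u v
      using link[of u v] that A unfolding bad_def by blast
    show ?thesis
    proof (rule hub_swappable)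
      fix v v' assume v: "v \<in> K - {s}" "v' \<in> K - {s}"
      show "linked v v' \<and> card (L v) = card K \<or> linked v' v \<and> card (L v') = card K \<or>
        (\<exists>u. card (L u) = card K \<and> linked u v \<and> linked u v')"
      proof (cases "v \<noteq> v' \<and> (v \<in> ?A \<or> v' \<in> ?A) \<and> \<not> bad v v'")
        case True
        then show ?thesis
        proof (cases "v \<in> ?A")
          case True
          then show ?thesis using lk[of v v'] full[of v] v \<open>v \<noteq> v' \<and> _\<close> by blast
        next
          case False
          then have "v' \<in> ?A" "\<not> bad v' v" using \<open>v \<noteq> v' \<and> _\<close> bad_sym by blast+
          then show ?thesis using lk[of v' v] full[of v'] v \<open>v \<noteq> v' \<and> _\<close> by blast
        qed
      next
        case no: False
        have big3: "3 \<le> card ?A" if "bad a b" for a b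
          using that big unfolding bad_def by blast
        have pick: "\<exists>u\<in>?A. u \<noteq> a \<and> u \<noteq> b" if "3 \<le> card ?A" for a b
        proof (rule ccontr)
          assume "\<not> ?thesis"
          then have "?A \<subseteq> {a, b}" by blast
          then have "card ?A \<le> card {a, b}" by (intro card_mono) auto
          moreover have "card {a, b} \<le> 2" by (simp add: card_insert_if)
          ultimately show False using that by linarith
        qed
        have "\<exists>u\<in>?A. u \<noteq> v \<and> u \<noteq> v' \<and> \<not> bad u v \<and> \<not> bad u v'"
        proof -
          consider (out) "v \<noteq> v'" "v \<notin> ?A" "v' \<notin> ?A" | (bad) "v \<noteq> v'" "bad v v'"
            | (eq) w where "v = v'" "bad w v" "w \<noteq> v" | (eq') "v = v'" "\<And>w. w \<noteq> v \<Longrightarrow> \<not> bad w v"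
            using no by blast
          then show ?thesis
          proof cases
            case out
            have "2 \<le> card ?A" using big by linarith
            then have "?A \<noteq> {}" using card.empty by (metis not_numeral_le_zero)
            then obtain u where u: "u \<in> ?A" by blast
            have "\<not> bad u v" "\<not> bad u v'" using bad_A[of u v] bad_A[of u v'] out by auto
            moreover have "u \<noteq> v" "u \<noteq> v'" using u out by auto
            ultimately show ?thesis using u by (intro bexI[of _ u]) simp_all
          next
            case bad
            then obtain u where u: "u \<in> ?A" "u \<noteq> v" "u \<noteq> v'" using pick[OF big3] by metis
            have "\<not> bad u v" using bad_unique[of v v' u] bad bad_sym[of u v] u by auto
            moreover have "\<not> bad u v'"
              using bad_unique[of v' v u] bad bad_sym[of u v'] bad_sym[of v v'] u by auto
            ultimately show ?thesis using u by blast
          next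
            case eq
            then obtain u where u: "u \<in> ?A" "u \<noteq> v" "u \<noteq> w" using pick[OF big3] by metis
            have "\<not> bad u v" using bad_unique[of v w u] eq bad_sym[of u v] bad_sym[of w v] u by auto
            then show ?thesis using u eq by blast
          next
            case eq'
            have "2 \<le> card ?A" using big by linarith
            then have "\<not> ?A \<subseteq> {v}" using card_mono[of "{v}" ?A] by auto
            then obtain u where "u \<in> ?A" "u \<noteq> v" by blast
            then show ?thesis using eq' by blast
          qed
        qed
        then obtain u where u: "u \<in> ?A" "u \<noteq> v" "u \<noteq> v'" "\<not> bad u v" "\<not> bad u v'" by blast
        then have "linked u v" "linked u v'" using lk[of u v] lk[of u v'] v by blast+
        then show ?thesis using full u(1) by blast
      qed
    qed
  qed
qed

end

section \<open>Reducible sets\<close>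

definition degree_swappable :: "('v \<Rightarrow> 'v \<Rightarrow> bool) \<Rightarrow> 'c itself \<Rightarrow> 'v set \<Rightarrow> bool" where
  "degree_swappable adj _ S \<longleftrightarrow> (\<forall>M :: 'v \<Rightarrow> 'c set.
     (\<forall>v\<in>S. card {u \<in> S. adj v u} \<le> card (M v)) \<longrightarrow> swappable adj M S)"

text \<open>Quantifying over all \<open>V\<close> and \<open>L\<close> makes this a property of
  \<open>S\<close> alone, so that sets can be colored one after the other, each added to
  \<open>V\<close> for the next.\<close>

definition degree_extendable :: "('v \<Rightarrow> 'v \<Rightarrow> bool) \<Rightarrow> 'c itself \<Rightarrow> 'v set \<Rightarrow> bool" where
  "degree_extendable adj _ S \<longleftrightarrow> (\<forall>(L :: 'v \<Rightarrow> 'c set) V \<phi> \<phi>' \<alpha> \<beta>.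
     S \<inter> V = {} \<longrightarrow> coloring_on adj L V \<phi> \<longrightarrow> coloring_on adj L V \<phi>' \<longrightarrow> swap_related \<alpha> \<beta> V \<phi> \<phi>' \<longrightarrow>
     (\<forall>v\<in>S. finite {u \<in> V \<union> S. adj v u} \<and> card {u \<in> V \<union> S. adj v u} \<le> card (L v)) \<longrightarrow>
     (\<exists>\<Phi> \<Phi>'. coloring_on adj L (V \<union> S) \<Phi> \<and> coloring_on adj L (V \<union> S) \<Phi>' \<and>
        swap_related \<alpha> \<beta> (V \<union> S) \<Phi> \<Phi>' \<and> (\<forall>v\<in>V. \<Phi> v = \<phi> v \<and> \<Phi>' v = \<phi>' v)))"

context symmetric_graph
begin

text \<open>Fixing the colors on \<open>V - S\<close> leaves residual lists at least as large as the
  degrees in \<open>S\<close>, so \<open>degree_swappable\<close> yields the first condition of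
  \<open>swappable_extend\<close>; \<open>degree_extendable\<close> is the second.\<close>

lemma swappable_reduce:
  fixes L :: "'v \<Rightarrow> 'c set"
  assumes fin: "finite V" and SV: "S \<subseteq> V"
    and deg: "\<And>v. v \<in> S \<Longrightarrow> card (nbrs V v) \<le> card (L v)"
    and O: "swappable adj L (V - S)"
    and sw: "degree_swappable adj TYPE('c) S" and ex: "degree_extendable adj TYPE('c) S"
  shows "swappable adj L V"
proof (rule swappable_extend[OF SV O])
  have V: "V - S \<union> S = V" using SV by auto
  fix \<phi> \<psi> assume \<phi>: "coloring_on adj L V \<phi>" and \<psi>: "coloring_on adj L V \<psi>"
    and eq: "\<And>v. v \<in> V - S \<Longrightarrow> \<phi> v = \<psi> v"
  let ?M = "residual adj L (V - S) \<phi>"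
  have "card (nbrs S v) \<le> card (?M v)" if "v \<in> S" for v
  proof -
    have 1: "card (nbrs V v) = card (nbrs (V - S) v) + card (nbrs S v)"
      by (rule card_nbrs_split[OF fin SV])
    have "finite (nbrs (V - S) v)" using fin by simp
    then show ?thesis using card_residual[of "V - S" v L \<phi>] 1 deg[OF that] by linarith
  qed
  then have M: "swappable adj ?M S" using sw unfolding degree_swappable_def by blast
  have "recolorable adj L (V - S \<union> S) \<phi> \<psi>"
    by (rule swappable_residual[OF M]) (use \<phi> \<psi> eq V in auto)
  then show "recolorable adj L V \<phi> \<psi>" unfolding V .
next
  have V: "V - S \<union> S = V" using SV by auto
  fix \<eta> \<eta>' \<alpha> \<beta>
  assume a: "coloring_on adj L (V - S) \<eta>" "coloring_on adj L (V - S) \<eta>'" "swap_related \<alpha> \<beta> (V - S) \<eta> \<eta>'"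
  have "\<forall>v\<in>S. finite (nbrs (V - S \<union> S) v) \<and> card (nbrs (V - S \<union> S) v) \<le> card (L v)"
    unfolding V using fin deg by simp
  then show "\<exists>\<Phi> \<Phi>'. coloring_on adj L V \<Phi> \<and> coloring_on adj L V \<Phi>' \<and>
          swap_related \<alpha> \<beta> V \<Phi> \<Phi>' \<and> (\<forall>v\<in>V - S. \<Phi> v = \<eta> v \<and> \<Phi>' v = \<eta>' v)"
    using ex[unfolded degree_extendable_def, rule_format, OF _ a] unfolding V by blast
qed

lemma degree_extendable_star:
  assumes "finite S" "p \<in> S" "b \<in> S" "t \<in> S" "adj p b" "adj p t" "\<not> adj b t" "b \<noteq> t"
    "connected_set adj (S - {p})" "connected_set adj (S - {b, t})" "3 \<le> card (nbrs S p)"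
  shows "degree_extendable adj TYPE('c) S"
  unfolding degree_extendable_def
proof (intro allI impI)
  fix L :: "'v \<Rightarrow> 'c set" and V \<phi> \<phi>' \<alpha> \<beta>
  assume a: "S \<inter> V = {}" "coloring_on adj L V \<phi>" "coloring_on adj L V \<phi>'" "swap_related \<alpha> \<beta> V \<phi> \<phi>'"
    "\<forall>v\<in>S. finite (nbrs (V \<union> S) v) \<and> card (nbrs (V \<union> S) v) \<le> card (L v)"
  show "\<exists>\<Phi> \<Phi>'. coloring_on adj L (V \<union> S) \<Phi> \<and> coloring_on adj L (V \<union> S) \<Phi>' \<and>
     swap_related \<alpha> \<beta> (V \<union> S) \<Phi> \<Phi>' \<and> (\<forall>v\<in>V. \<Phi> v = \<phi> v \<and> \<Phi>' v = \<phi>' v)"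
    by (rule related_pair_extend_star[OF assms(1) a(1-4) a(5)[rule_format] assms(2-)])
qed

text \<open>The order of coloring is that of \<open>related_pair_extend_connected\<close>, but the
  slack at \<open>s\<close> is numerical and no neighbor has to be dropped.\<close>

lemma related_pair_extend_slack:
  assumes fin: "finite U" and disj: "U \<inter> V = {}" and conn: "connected_set adj U"
    and c: "coloring_on adj L V \<phi>" "coloring_on adj L V \<phi>'" and rel: "swap_related \<alpha> \<beta> V \<phi> \<phi>'"
    and deg: "\<And>v. v \<in> U \<Longrightarrow> finite (nbrs (V \<union> U) v) \<and> card (nbrs (V \<union> U) v) \<le> card (L v)"
    and s: "s \<in> U" "card (nbrs (V \<union> U) s) < card (L s)"
  shows "\<exists>\<Phi> \<Phi>'. coloring_on adj L (V \<union> U) \<Phi> \<and> coloring_on adj L (V \<union> U) \<Phi>' \<and>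
     swap_related \<alpha> \<beta> (V \<union> U) \<Phi> \<Phi>' \<and> (\<forall>v\<in>V. \<Phi> v = \<phi> v \<and> \<Phi>' v = \<phi>' v)"
proof -
  let ?P = "\<lambda>U'. \<exists>\<Phi> \<Phi>'. coloring_on adj L (V \<union> U') \<Phi> \<and> coloring_on adj L (V \<union> U') \<Phi>' \<and>
     swap_related \<alpha> \<beta> (V \<union> U') \<Phi> \<Phi>' \<and> (\<forall>v\<in>V. \<Phi> v = \<phi> v \<and> \<Phi>' v = \<phi>' v)"
  have "U' \<subseteq> U \<Longrightarrow> ?P U'" for U'
  proof (induction "card U'" arbitrary: U')
    case 0
    then have "U' = {}" using finite_subset[OF 0(2) fin] by simp
    then show ?case using c rel by auto
  next
    case (Suc n)
    have finU': "finite U'" by (rule finite_subset[OF Suc.prems fin])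
    have "\<exists>v\<in>U'. card (nbrs (V \<union> (U' - {v})) v) < card (L v)"
    proof (cases "s \<in> U'")
      case True
      have "card (nbrs (V \<union> (U' - {s})) s) \<le> card (nbrs (V \<union> U) s)"
        using deg[OF s(1)] Suc.prems by (intro card_mono) auto
      then show ?thesis using s True by (intro bexI[of _ s]) auto
    next
      case False
      have "U' \<noteq> U" "U' \<noteq> {}" using False s Suc.hyps(2) by auto
      then obtain a b where ab: "a \<in> U'" "b \<in> U - U'" "adj a b"
        using connected_setD[OF conn Suc.prems] by blast
      have aU: "a \<in> U" using ab Suc.prems by blast
      have "nbrs (V \<union> (U' - {a})) a \<subset> nbrs (V \<union> U) a" using ab Suc.prems disj by blast
      then have "card (nbrs (V \<union> (U' - {a})) a) < card (nbrs (V \<union> U) a)"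
        using deg[OF aU] by (intro psubset_card_mono) auto
      then show ?thesis using deg[OF aU] ab by (intro bexI[of _ a]) auto
    qed
    then obtain v where v: "v \<in> U'" "card (nbrs (V \<union> (U' - {v})) v) < card (L v)" by blast
    let ?W = "V \<union> (U' - {v})"
    have vU: "v \<in> U" using v Suc.prems by blast
    have "?P (U' - {v})" by (rule Suc.hyps(1)) (use v Suc.hyps(2) Suc.prems finU' in auto)
    then obtain \<Phi> \<Phi>' where P: "coloring_on adj L ?W \<Phi>" "coloring_on adj L ?W \<Phi>'"
        "swap_related \<alpha> \<beta> ?W \<Phi> \<Phi>'" "\<forall>v\<in>V. \<Phi> v = \<phi> v \<and> \<Phi>' v = \<phi>' v" by blast
    have vV: "v \<notin> V" using vU disj by blast
    have i: "insert v ?W = V \<union> U'" using v by auto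
    have finN: "finite (nbrs ?W v)"
      by (rule finite_subset[of _ "nbrs (V \<union> U) v"]) (use deg[OF vU] Suc.prems in auto)
    have "\<exists>x x'. coloring_on adj L (insert v ?W) (\<Phi>(v := x)) \<and>
      coloring_on adj L (insert v ?W) (\<Phi>'(v := x')) \<and>
      swap_related \<alpha> \<beta> (insert v ?W) (\<Phi>(v := x)) (\<Phi>'(v := x'))"
      by (rule related_pair_extend[OF P(1-3) _ subset_refl finN v(2)]) (use vV in auto)
    then obtain x x' where "coloring_on adj L (V \<union> U') (\<Phi>(v := x))"
      "coloring_on adj L (V \<union> U') (\<Phi>'(v := x'))"
      "swap_related \<alpha> \<beta> (V \<union> U') (\<Phi>(v := x)) (\<Phi>'(v := x'))" unfolding i by blast
    then show ?case using P(4) vV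
      by (intro exI[of _ "\<Phi>(v := x)"] exI[of _ "\<Phi>'(v := x')"]) auto
  qed
  then show ?thesis by blast
qed

lemma degree_extendable_Union:
  assumes fin: "finite \<B>"
    and ex: "\<And>B. B \<in> \<B> \<Longrightarrow> degree_extendable adj TYPE('c) B"
    and dis: "\<And>B B'. B \<in> \<B> \<Longrightarrow> B' \<in> \<B> \<Longrightarrow> B \<noteq> B' \<Longrightarrow> B \<inter> B' = {}"
  shows "degree_extendable adj TYPE('c) (\<Union>\<B>)"
  using assms
proof (induction \<B> rule: finite_induct)
  case empty
  then show ?case unfolding degree_extendable_def by auto
next
  case (insert B \<B>)
  have dB: "B \<inter> \<Union>\<B> = {}" using insert.prems(2)[of B] insert.hyps(2) by blast
  have IH: "degree_extendable adj TYPE('c) (\<Union>\<B>)" by (rule insert.IH) (use insert.prems in auto)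
  have exB: "degree_extendable adj TYPE('c) B" using insert.prems by simp
  show ?case
    unfolding degree_extendable_def
  proof (intro allI impI)
    fix L :: "'v \<Rightarrow> 'c set" and V \<phi> \<phi>' \<alpha> \<beta>
    let ?S = "\<Union>(insert B \<B>)"
    assume a: "?S \<inter> V = {}" "coloring_on adj L V \<phi>" "coloring_on adj L V \<phi>'" "swap_related \<alpha> \<beta> V \<phi> \<phi>'"
      "\<forall>v\<in>?S. finite (nbrs (V \<union> ?S) v) \<and> card (nbrs (V \<union> ?S) v) \<le> card (L v)"
    have sub: "finite (nbrs A v) \<and> card (nbrs A v) \<le> card (L v)" if "v \<in> ?S" "A \<subseteq> V \<union> ?S" for v A
    proof -
      have 1: "nbrs A v \<subseteq> nbrs (V \<union> ?S) v" using that(2) by blast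
      have 2: "finite (nbrs (V \<union> ?S) v)" "card (nbrs (V \<union> ?S) v) \<le> card (L v)" using a(5) that(1) by simp_all
      show ?thesis using finite_subset[OF 1 2(1)] card_mono[OF 2(1) 1] 2(2) by simp
    qed
    have d1: "B \<inter> V = {}" using a(1) by auto
    have "\<forall>v\<in>B. finite (nbrs (V \<union> B) v) \<and> card (nbrs (V \<union> B) v) \<le> card (L v)"
      by (intro ballI sub) auto
    then obtain \<xi> \<xi>' where x: "coloring_on adj L (V \<union> B) \<xi>" "coloring_on adj L (V \<union> B) \<xi>'"
        "swap_related \<alpha> \<beta> (V \<union> B) \<xi> \<xi>'" "\<forall>v\<in>V. \<xi> v = \<phi> v \<and> \<xi>' v = \<phi>' v"
      using exB[unfolded degree_extendable_def, rule_format, OF d1 a(2-4)] by blast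
    have d2: "\<Union>\<B> \<inter> (V \<union> B) = {}" using a(1) dB by auto
    have e: "V \<union> B \<union> \<Union>\<B> = V \<union> ?S" by auto
    have "\<forall>v\<in>\<Union>\<B>. finite (nbrs (V \<union> B \<union> \<Union>\<B>) v) \<and> card (nbrs (V \<union> B \<union> \<Union>\<B>) v) \<le> card (L v)"
      by (intro ballI sub) auto
    then have "\<exists>\<Phi> \<Phi>'. coloring_on adj L (V \<union> B \<union> \<Union>\<B>) \<Phi> \<and> coloring_on adj L (V \<union> B \<union> \<Union>\<B>) \<Phi>' \<and>
        swap_related \<alpha> \<beta> (V \<union> B \<union> \<Union>\<B>) \<Phi> \<Phi>' \<and> (\<forall>v\<in>V \<union> B. \<Phi> v = \<xi> v \<and> \<Phi>' v = \<xi>' v)"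
      using IH[unfolded degree_extendable_def, rule_format, OF d2 x(1-3)] by blast
    then obtain \<Phi> \<Phi>' where "coloring_on adj L (V \<union> ?S) \<Phi>" "coloring_on adj L (V \<union> ?S) \<Phi>'"
        "swap_related \<alpha> \<beta> (V \<union> ?S) \<Phi> \<Phi>'" "\<forall>v\<in>V \<union> B. \<Phi> v = \<xi> v \<and> \<Phi>' v = \<xi>' v"
      unfolding e by blast
    then show "\<exists>\<Phi> \<Phi>'. coloring_on adj L (V \<union> ?S) \<Phi> \<and> coloring_on adj L (V \<union> ?S) \<Phi>' \<and>
        swap_related \<alpha> \<beta> (V \<union> ?S) \<Phi> \<Phi>' \<and> (\<forall>v\<in>V. \<Phi> v = \<phi> v \<and> \<Phi>' v = \<phi>' v)"
      using x(4) by (intro exI[of _ \<Phi>] exI[of _ \<Phi>']) simp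
  qed
qed

text \<open>\<open>K\<close> is colored first: \<open>r\<close> still has the uncolored neighbor
  \<open>t\<close>, hence slack within \<open>V \<union> K\<close>. Then \<open>T\<close> is
  extended over the larger colored set.\<close>

lemma degree_extendable_Un:
  assumes K: "finite K" "connected_set adj K" "K \<inter> T = {}" and r: "r \<in> K" "t \<in> T" "adj r t"
    and T: "degree_extendable adj TYPE('c) T"
  shows "degree_extendable adj TYPE('c) (K \<union> T)"
  unfolding degree_extendable_def
proof (intro allI impI)
  fix L :: "'v \<Rightarrow> 'c set" and V \<phi> \<phi>' \<alpha> \<beta>
  let ?S = "K \<union> T"
  assume a: "?S \<inter> V = {}" "coloring_on adj L V \<phi>" "coloring_on adj L V \<phi>'" "swap_related \<alpha> \<beta> V \<phi> \<phi>'"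
    "\<forall>v\<in>?S. finite (nbrs (V \<union> ?S) v) \<and> card (nbrs (V \<union> ?S) v) \<le> card (L v)"
  have full: "finite (nbrs (V \<union> ?S) v)" "card (nbrs (V \<union> ?S) v) \<le> card (L v)" if "v \<in> ?S" for v
    using a(5) that by simp_all
  have subK: "finite (nbrs (V \<union> K) v) \<and> card (nbrs (V \<union> K) v) \<le> card (L v)" if "v \<in> K" for v
  proof -
    have 1: "nbrs (V \<union> K) v \<subseteq> nbrs (V \<union> ?S) v" by blast
    have 2: "finite (nbrs (V \<union> ?S) v)" "card (nbrs (V \<union> ?S) v) \<le> card (L v)" using full[of v] that by simp_all
    show ?thesis using finite_subset[OF 1 2(1)] card_mono[OF 2(1) 1] 2(2) by simp
  qed
  have lt: "card (nbrs (V \<union> K) r) < card (L r)"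
  proof -
    have "t \<notin> V \<union> K" using r K(3) a(1) by blast
    then have "nbrs (V \<union> K) r \<subset> nbrs (V \<union> ?S) r" using r by blast
    then have "card (nbrs (V \<union> K) r) < card (nbrs (V \<union> ?S) r)"
      using full(1)[of r] r by (intro psubset_card_mono) auto
    then show ?thesis using full(2)[of r] r by simp
  qed
  have d1: "K \<inter> V = {}" using a(1) by auto
  obtain \<xi> \<xi>' where x: "coloring_on adj L (V \<union> K) \<xi>" "coloring_on adj L (V \<union> K) \<xi>'"
        "swap_related \<alpha> \<beta> (V \<union> K) \<xi> \<xi>'" "\<forall>v\<in>V. \<xi> v = \<phi> v \<and> \<xi>' v = \<phi>' v"
    using related_pair_extend_slack[OF K(1) d1 K(2) a(2-4) subK r(1) lt] by blast
  have d2: "T \<inter> (V \<union> K) = {}" using a(1) K(3) by auto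
  have e: "V \<union> K \<union> T = V \<union> ?S" by auto
  have "\<forall>v\<in>T. finite (nbrs (V \<union> K \<union> T) v) \<and> card (nbrs (V \<union> K \<union> T) v) \<le> card (L v)"
    unfolding e using full by simp
  then have "\<exists>\<Phi> \<Phi>'. coloring_on adj L (V \<union> K \<union> T) \<Phi> \<and> coloring_on adj L (V \<union> K \<union> T) \<Phi>' \<and>
        swap_related \<alpha> \<beta> (V \<union> K \<union> T) \<Phi> \<Phi>' \<and> (\<forall>v\<in>V \<union> K. \<Phi> v = \<xi> v \<and> \<Phi>' v = \<xi>' v)"
    using T[unfolded degree_extendable_def, rule_format, OF d2 x(1-3)] by blast
  then obtain \<Phi> \<Phi>' where "coloring_on adj L (V \<union> ?S) \<Phi>" "coloring_on adj L (V \<union> ?S) \<Phi>'"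
        "swap_related \<alpha> \<beta> (V \<union> ?S) \<Phi> \<Phi>'" "\<forall>v\<in>V \<union> K. \<Phi> v = \<xi> v \<and> \<Phi>' v = \<xi>' v"
      unfolding e by blast
  then show "\<exists>\<Phi> \<Phi>'. coloring_on adj L (V \<union> ?S) \<Phi> \<and> coloring_on adj L (V \<union> ?S) \<Phi>' \<and>
        swap_related \<alpha> \<beta> (V \<union> ?S) \<Phi> \<Phi>' \<and> (\<forall>v\<in>V. \<Phi> v = \<phi> v \<and> \<Phi>' v = \<phi>' v)"
    using x(4) by (intro exI[of _ \<Phi>] exI[of _ \<Phi>']) simp
qed

section \<open>Components and even cycles\<close>

definition component :: "'v set \<Rightarrow> 'v \<Rightarrow> 'v set" where
  "component V y = \<Union>{C. C \<subseteq> V \<and> y \<in> C \<and> connected_set adj C}"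

lemma connected_set_singleton: "connected_set adj {y}"
  by (rule connected_set_clique) auto

lemma connected_set_insert:
  assumes "connected_set adj A" "a \<in> A" "adj a b"
  shows "connected_set adj (insert b A)"
proof -
  have "connected_set adj (A \<union> \<Union>{{b}})"
    by (rule connected_set_Union[OF assms(1)]) (use assms connected_set_singleton in auto)
  then show ?thesis by simp
qed

lemma connected_set_Union_common:
  assumes "\<And>C. C \<in> \<C> \<Longrightarrow> connected_set adj C \<and> y \<in> C"
  shows "connected_set adj (\<Union>\<C>)"
  unfolding connected_set_def
proof (intro allI impI)
  fix U assume U: "U \<subseteq> \<Union>\<C>" "U \<noteq> {}" "U \<noteq> \<Union>\<C>"
  have "\<exists>C\<in>\<C>. C \<inter> U \<noteq> {} \<and> \<not> C \<subseteq> U"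
  proof (cases "y \<in> U")
    case True
    then show ?thesis using U assms by blast
  next
    case False
    then show ?thesis using U assms by blast
  qed
  then obtain C where C: "C \<in> \<C>" "C \<inter> U \<noteq> {}" "\<not> C \<subseteq> U" by blast
  have c: "connected_set adj C" using assms C by blast
  have "C \<inter> U \<subseteq> C" "C \<inter> U \<noteq> C" using C by auto
  from connected_setD[OF c this(1) C(2) this(2)] obtain a b
    where "a \<in> C \<inter> U" "b \<in> C - C \<inter> U" "adj a b" by blast
  then show "\<exists>a\<in>U. \<exists>b\<in>\<Union>\<C> - U. adj a b" using C(1) by blast
qed

lemma component_connected: "connected_set adj (component V y)"
  unfolding component_def by (rule connected_set_Union_common) auto

lemma component_subset: "component V y \<subseteq> V"
  unfolding component_def by auto

lemma component_self: "y \<in> V \<Longrightarrow> y \<in> component V y"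
  unfolding component_def using connected_set_singleton[of y] by auto

lemma component_maximal: "connected_set adj D \<Longrightarrow> D \<subseteq> V \<Longrightarrow> y \<in> D \<Longrightarrow> D \<subseteq> component V y"
  unfolding component_def by auto

lemma component_eq:
  assumes "z \<in> component V y"
  shows "component V z = component V y"
proof
  have y: "y \<in> component V y" using assms unfolding component_def by blast
  have 1: "component V y \<subseteq> component V z"
    by (rule component_maximal[OF component_connected component_subset assms])
  then have "y \<in> component V z" using y by blast
  then show "component V z \<subseteq> component V y"
    by (rule component_maximal[OF component_connected component_subset])
  show "component V y \<subseteq> component V z" by fact
qed

lemma component_closed:
  assumes "a \<in> component V y" "b \<in> V" "adj a b"
  shows "b \<in> component V y"
proof -
  have y: "y \<in> component V y" using assms unfolding component_def by blast
  have "insert b (component V y) \<subseteq> component V y"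
    by (rule component_maximal[OF connected_set_insert[OF component_connected assms(1,3)]])
      (use assms(2) y component_subset in auto)
  then show ?thesis by blast
qed

text \<open>A largest proper connected subset containing \<open>y\<close> lacks only one vertex,
  because it can be enlarged by a vertex adjacent to it.\<close>

lemma connected_set_remove_noncut:
  assumes fin: "finite C" and conn: "connected_set adj C" and y: "y \<in> C" "C \<noteq> {y}"
  shows "\<exists>z\<in>C. z \<noteq> y \<and> connected_set adj (C - {z})"
proof -
  let ?D = "{D. D \<subset> C \<and> y \<in> D \<and> connected_set adj D}"
  have finD: "finite ?D" by (rule finite_subset[of _ "Pow C"]) (use fin in auto)
  have "{y} \<in> ?D" using y connected_set_singleton by auto
  then have ne: "card ` ?D \<noteq> {}" by blast
  obtain D where D0: "D \<in> ?D" "card D = Max (card ` ?D)" using Max_in[OF finite_imageI[OF finD] ne] by (metis (lifting) imageE)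
  have D: "card D' \<le> card D" if "D' \<in> ?D" for D'
    unfolding D0(2) by (rule Max_ge[OF finite_imageI[OF finD] imageI[OF that]])
  have D': "D \<subseteq> C" "D \<noteq> C" "D \<noteq> {}" "y \<in> D" "connected_set adj D" using D0(1) by auto
  obtain a b where ab: "a \<in> D" "b \<in> C - D" "adj a b"
    using connected_setD[OF conn D'(1,3,2)] by blast
  have "card (insert b D) > card D" using ab finite_subset[OF D'(1) fin] by simp
  then have "insert b D \<notin> ?D" using D[of "insert b D"] by linarith
  then have "insert b D = C" using connected_set_insert[OF D'(5) ab(1,3)] D' ab by blast
  then have "C - {b} = D" using ab by auto
  then show ?thesis using ab D' by (intro bexI[of _ b]) auto
qed

text \<open>\<open>\<rho>\<close> is the rotation of the cycle and \<open>cyc\<close> says that it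
  has a single orbit. Giving \<open>x\<close> to \<open>s\<close> costs \<open>\<rho> s\<close>
  nothing, so the remaining path can be colored ending at \<open>\<rho> s\<close>. Formally, a set
  \<open>U\<close> violating degeneracy is closed under predecessors, hence invariant, hence
  contains \<open>s\<close>.\<close>

lemma cycle_colorable_distinct:
  assumes fin: "finite Z" and \<rho>: "inj_on \<rho> Z" "\<rho> ` Z = Z"
    and adj: "\<And>u v. u \<in> Z \<Longrightarrow> v \<in> Z \<Longrightarrow> adj u v \<Longrightarrow> v = \<rho> u \<or> u = \<rho> v"
    and cyc: "\<And>U. U \<subseteq> Z \<Longrightarrow> U \<noteq> {} \<Longrightarrow> \<rho> ` U = U \<Longrightarrow> U = Z"
    and L: "\<And>z. z \<in> Z \<Longrightarrow> 2 \<le> card (L z)"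
    and s: "s \<in> Z" "x \<in> L s" "x \<notin> L (\<rho> s)"
  shows "\<exists>\<sigma>. coloring_on adj L Z \<sigma>"
proof -
  let ?M = "residual adj L {s} (\<lambda>_. x)"
  have "degenerate adj ?M (Z - {s})"
    unfolding degenerate_def
  proof (intro allI impI, rule ccontr)
    fix U assume U: "U \<subseteq> Z - {s}" "U \<noteq> {}" and no: "\<not> (\<exists>v\<in>U. card (nbrs U v) < card (?M v))"
    have finU: "finite U" by (rule finite_subset[OF U(1)]) (use fin in simp)
    have le: "card (?M v) \<le> card (nbrs U v)" if "v \<in> U" for v using no that by (meson not_le)
    have pred: "\<exists>u\<in>Z. \<rho> u = v \<and> nbrs U v \<subseteq> {\<rho> v, u}" if v: "v \<in> U" for v
    proof -
      have "v \<in> \<rho> ` Z" unfolding \<rho>(2) using v U(1) by blast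
      then obtain u where u: "u \<in> Z" "\<rho> u = v" by blast
      have "nbrs U v \<subseteq> {\<rho> v, u}"
      proof
        fix z assume z: "z \<in> nbrs U v"
        have vz: "v \<in> Z" "z \<in> Z" "adj v z" using z v U(1) by auto
        from adj[OF this] show "z \<in> {\<rho> v, u}"
        proof
          assume "v = \<rho> z"
          then have "z = u" using u \<rho>(1) vz by (metis inj_onD)
          then show ?thesis by simp
        qed simp
      qed
      then show ?thesis using u by blast
    qed
    have full: "u \<in> U" if v: "v \<in> U" and u: "u \<in> Z" "\<rho> u = v" and c: "2 \<le> card (nbrs U v)" for u v
    proof (rule ccontr)
      assume un: "u \<notin> U"
      obtain u' where u': "u' \<in> Z" "\<rho> u' = v" "nbrs U v \<subseteq> {\<rho> v, u'}" using pred[OF v] by blast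
      have "u' = u" using u u' \<rho>(1) by (metis inj_onD)
      then have "nbrs U v \<subseteq> {\<rho> v}" using u' un by auto
      then have "card (nbrs U v) \<le> card {\<rho> v}" by (intro card_mono) auto
      then show False using c by simp
    qed
    have M2: "2 \<le> card (?M v)" if "v \<in> Z" "\<not> adj v s \<or> x \<notin> L v" for v
    proof -
      have "?M v = L v" using that(2) unfolding residual_def by auto
      then show ?thesis using L that(1) by simp
    qed
    have M1: "1 \<le> card (?M v)" if "v \<in> Z" for v
    proof -
      have "card (nbrs {s} v) \<le> card {s}" by (rule card_mono) auto
      then show ?thesis using card_residual[of "{s}" v L "\<lambda>_. x"] L[OF that] by simp
    qed
    have pred_in: "u \<in> U" if v: "v \<in> U" and u: "u \<in> Z" "\<rho> u = v" for u v
    proof (cases "\<not> adj v s \<or> x \<notin> L v")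
      case True
      then show ?thesis using full[OF v u] M2[of v] le[OF v] v U(1) by auto
    next
      case False
      have vZ: "v \<in> Z" using v U by blast
      have "s = \<rho> v \<or> v = \<rho> s" using adj[OF vZ s(1)] False by blast
      then have sv: "s = \<rho> v" using False s(3) by auto
      obtain u' where u': "u' \<in> Z" "\<rho> u' = v" "nbrs U v \<subseteq> {\<rho> v, u'}" using pred[OF v] by blast
      have "u' = u" using u u' \<rho>(1) by (metis inj_onD)
      moreover have "nbrs U v \<noteq> {}" using M1[OF vZ] le[OF v] by fastforce
      ultimately show ?thesis using u'(3) sv U(1) by auto
    qed
    have "\<rho> ` U = U"
    proof -
      have sub: "U \<subseteq> \<rho> ` U"
      proof
        fix v assume v: "v \<in> U"
        obtain u where "u \<in> Z" "\<rho> u = v" using pred[OF v] by blast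
        then show "v \<in> \<rho> ` U" using pred_in[OF v] by blast
      qed
      have "card (\<rho> ` U) \<le> card U" using finU by (rule card_image_le)
      then show ?thesis using sub finU by (metis card_seteq finite_imageI)
    qed
    then show False using cyc[of U] U s(1) by blast
  qed
  then obtain \<sigma> where \<sigma>: "coloring_on adj ?M (Z - {s}) \<sigma>"
    using degenerate_colorable[of "Z - {s}" ?M] fin by auto
  have "coloring_on adj L {s} (\<lambda>_. x)" using s adj_irrefl by (simp add: coloring_on_def)
  from coloring_on_override[OF this \<sigma>] have "coloring_on adj L ({s} \<union> (Z - {s})) (\<lambda>v. if v \<in> Z - {s} then \<sigma> v else x)"
    by simp
  moreover have "{s} \<union> (Z - {s}) = Z" using s by auto
  ultimately show ?thesis by auto
qed

text \<open>If consecutive lists differ, one has a color missing in the other, and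
  \<open>cycle_colorable_distinct\<close> applies to \<open>\<rho>\<close> or its inverse. If all
  are equal, two of the common colors alternate; \<open>P\<close> is a parity class.\<close>

lemma even_cycle_colorable:
  fixes L :: "'v \<Rightarrow> 'c set"
  assumes fin: "finite Z" and \<rho>: "inj_on \<rho> Z" "\<rho> ` Z = Z"
    and adj: "\<And>u v. u \<in> Z \<Longrightarrow> v \<in> Z \<Longrightarrow> adj u v \<Longrightarrow> v = \<rho> u \<or> u = \<rho> v"
    and cyc: "\<And>U. U \<subseteq> Z \<Longrightarrow> U \<noteq> {} \<Longrightarrow> \<rho> ` U = U \<Longrightarrow> U = Z"
    and even: "\<And>z. z \<in> Z \<Longrightarrow> \<rho> z \<in> P \<longleftrightarrow> z \<notin> P"
    and L: "\<And>z. z \<in> Z \<Longrightarrow> 2 \<le> card (L z)"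
  shows "\<exists>\<sigma>. coloring_on adj L Z \<sigma>"
proof -
  let ?\<rho> = "inv_into Z \<rho>"
  have inv: "?\<rho> (\<rho> z) = z" "\<rho> (?\<rho> z) = z" "?\<rho> z \<in> Z" if "z \<in> Z" for z
    using that \<rho> by (auto simp: inv_into_f_f f_inv_into_f inv_into_into)
  consider s x where "s \<in> Z" "x \<in> L s" "x \<notin> L (\<rho> s)" | s x where "s \<in> Z" "x \<in> L (\<rho> s)" "x \<notin> L s"
    | "\<forall>s\<in>Z. L (\<rho> s) = L s" by blast
  then show ?thesis
  proof cases
    case 1
    then show ?thesis by (intro cycle_colorable_distinct[OF fin \<rho> adj cyc L])
  next
    case 2
    have r: "\<rho> s \<in> Z" using imageI[OF 2(1), of \<rho>] unfolding \<rho>(2) .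
    show ?thesis
    proof (rule cycle_colorable_distinct[OF fin, of ?\<rho>])
      show "inj_on ?\<rho> Z" using inj_on_inv_into[of Z \<rho> Z] \<rho>(2) by simp
      show "?\<rho> ` Z = Z"
      proof
        show "?\<rho> ` Z \<subseteq> Z" using inv(3) by (rule image_subsetI)
        show "Z \<subseteq> ?\<rho> ` Z"
        proof
          fix z assume z: "z \<in> Z"
          then have "\<rho> z \<in> Z" using \<rho>(2) by auto
          then show "z \<in> ?\<rho> ` Z" using inv(1)[OF z] by (metis imageI)
        qed
      qed
      show "v = ?\<rho> u \<or> u = ?\<rho> v" if "u \<in> Z" "v \<in> Z" "adj u v" for u v
        using adj[OF that] inv that by auto
      show "U = Z" if U: "U \<subseteq> Z" "U \<noteq> {}" "?\<rho> ` U = U" for U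
      proof (rule cyc[OF U(1,2)])
        have "\<rho> ` U = \<rho> ` ?\<rho> ` U" using U(3) by simp
        also have "\<dots> = U" using inv U(1) by (force simp: image_image)
        finally show "\<rho> ` U = U" .
      qed
      show "\<rho> s \<in> Z" "x \<in> L (\<rho> s)" "x \<notin> L (?\<rho> (\<rho> s))" using 2 r inv by auto
    qed (use L in auto)
  next
    case 3
    have "\<exists>a b. a \<in> A \<and> b \<in> A \<and> a \<noteq> b" if A: "2 \<le> card A" for A :: "'c set"
    proof -
      obtain B where B: "B \<subseteq> A" "card B = 2" by (rule obtain_subset_with_card_n[OF A])
      then obtain a b where "B = {a, b}" "a \<noteq> b" by (auto simp: card_2_iff)
      then show ?thesis using B(1) by auto
    qed
    \<comment> \<open>The two colors are chosen as functions of the list, so equal lists get the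
      same pair.\<close>
    then obtain f g where fg: "\<And>A :: 'c set. 2 \<le> card A \<Longrightarrow> f A \<in> A \<and> g A \<in> A \<and> f A \<noteq> g A" by metis
    define \<sigma> where "\<sigma> z = (if z \<in> P then f (L z) else g (L z))" for z
    have eq: "\<sigma> (\<rho> z) \<noteq> \<sigma> z" if "z \<in> Z" for z
      using even[OF that] 3 that fg[OF L[OF that]] unfolding \<sigma>_def by auto
    have "coloring_on adj L Z \<sigma>"
      unfolding coloring_on_def
    proof (intro conjI ballI impI)
      fix z assume "z \<in> Z"
      then show "\<sigma> z \<in> L z" using fg[OF L] unfolding \<sigma>_def by auto
    next
      fix u v assume "u \<in> Z" "v \<in> Z" "adj u v"
      then show "\<sigma> u \<noteq> \<sigma> v" using adj[of u v] eq[of u] eq[of v] by auto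
    qed
    then show ?thesis by blast
  qed
qed

end

section \<open>Half edges of a multigraph\<close>

text \<open>Each \<open>u\<close> in \<open>X\<close> is an edge of a multigraph with ends
  \<open>N u\<close>, parallel edges allowed, and \<open>h u y\<close> is its half at
  \<open>y\<close>. Halves are adjacent if they belong to the same edge or sit at the same vertex:
  the line graph of the multigraph with every edge subdivided once.\<close>

locale half_edges = symmetric_graph adj for adj :: "'v \<Rightarrow> 'v \<Rightarrow> bool" +
  fixes X :: "'a set" and N :: "'a \<Rightarrow> 'b set" and h :: "'a \<Rightarrow> 'b \<Rightarrow> 'v"
  assumes finite_X: "finite X" and card_N: "\<And>u. u \<in> X \<Longrightarrow> card (N u) = 2"
    and h_eq: "\<And>u u' y y'. u \<in> X \<Longrightarrow> u' \<in> X \<Longrightarrow> y \<in> N u \<Longrightarrow> y' \<in> N u' \<Longrightarrow>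
       h u y = h u' y' \<longleftrightarrow> u = u' \<and> y = y'"
    and adj_h: "\<And>u u' y y'. u \<in> X \<Longrightarrow> u' \<in> X \<Longrightarrow> y \<in> N u \<Longrightarrow> y' \<in> N u' \<Longrightarrow>
       adj (h u y) (h u' y') \<longleftrightarrow> (u = u') \<noteq> (y = y')"
begin

definition W :: "'a set \<Rightarrow> 'b set" where "W Y = \<Union>(N ` Y)"

definition link :: "'b \<Rightarrow> 'b \<Rightarrow> bool" where
  "link y y' \<longleftrightarrow> y \<noteq> y' \<and> (\<exists>u\<in>X. y \<in> N u \<and> y' \<in> N u)"

definition halves :: "'b set \<Rightarrow> 'v set" where
  "halves A = {h u y | u y. u \<in> X \<and> y \<in> N u \<and> y \<in> A}"

definition other :: "'a \<Rightarrow> 'b \<Rightarrow> 'b" where "other u y = (THE z. z \<in> N u \<and> z \<noteq> y)"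

definition inner_edges :: "'b set \<Rightarrow> 'a set" where "inner_edges C = {u \<in> X. N u \<subseteq> C}"

definition star :: "'b \<Rightarrow> 'a set" where "star w = {u \<in> X. w \<in> N u}"

sublocale mg: symmetric_graph link
  by unfold_locales (auto simp: link_def)

lemma finite_N: "u \<in> X \<Longrightarrow> finite (N u)"
  using card_N[of u] by (metis card.infinite zero_neq_numeral)

lemma finite_W: "Y \<subseteq> X \<Longrightarrow> finite (W Y)"
  unfolding W_def using finite_subset[OF _ finite_X, of Y] finite_N by auto

lemma finite_star: "finite (star w)" unfolding star_def using finite_X by simp

lemma W_mono: "Y \<subseteq> Z \<Longrightarrow> W Y \<subseteq> W Z" unfolding W_def by blast

lemma other:
  assumes "u \<in> X" "y \<in> N u"
  shows "N u = {y, other u y}" "other u y \<noteq> y" "other u y \<in> N u"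
proof -
  obtain a b where ab: "N u = {a, b}" "a \<noteq> b" using card_N[OF assms(1)] by (auto simp: card_2_iff)
  obtain z where z: "N u = {y, z}" "z \<noteq> y" using ab assms(2) by auto
  have "other u y = z" unfolding other_def by (rule the_equality) (use z in auto)
  then show "N u = {y, other u y}" "other u y \<noteq> y" "other u y \<in> N u" using z by auto
qed

lemma other_unique: "u \<in> X \<Longrightarrow> y \<in> N u \<Longrightarrow> z \<in> N u \<Longrightarrow> z \<noteq> y \<Longrightarrow> z = other u y"
  using other(1)[of u y] by blast

lemma halvesE:
  assumes "t \<in> halves A"
  obtains u y where "t = h u y" "u \<in> X" "y \<in> N u" "y \<in> A"
  using assms unfolding halves_def by blast

lemma halvesI: "u \<in> X \<Longrightarrow> y \<in> N u \<Longrightarrow> y \<in> A \<Longrightarrow> h u y \<in> halves A"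
  unfolding halves_def by blast

lemma h_halves_iff: "u \<in> X \<Longrightarrow> y \<in> N u \<Longrightarrow> h u y \<in> halves A \<longleftrightarrow> y \<in> A"
  unfolding halves_def using h_eq by blast

lemma halves_mono: "A \<subseteq> B \<Longrightarrow> halves A \<subseteq> halves B"
  unfolding halves_def by blast

lemma finite_halves: "finite (halves A)"
proof (rule finite_subset)
  show "halves A \<subseteq> (\<lambda>(u, y). h u y) ` (SIGMA u:X. N u)" unfolding halves_def by auto
  show "finite ((\<lambda>(u, y). h u y) ` (SIGMA u:X. N u))" using finite_X finite_N by auto
qed

lemma halves_disjoint: "A \<inter> B = {} \<Longrightarrow> halves A \<inter> halves B = {}"
proof -
  assume d: "A \<inter> B = {}"
  have False if "t \<in> halves A" "t \<in> halves B" for t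
    using that(1)
  proof (rule halvesE)
    fix u y assume "t = h u y" "u \<in> X" "y \<in> N u" "y \<in> A"
    then show False using that(2) h_halves_iff[of u y B] d by blast
  qed
  then show ?thesis by blast
qed

lemma halves_connected:
  assumes A: "connected_set link A" "A \<subseteq> W X"
  shows "connected_set adj (halves A)"
  unfolding connected_set_def
proof (intro allI impI)
  fix U assume U: "U \<subseteq> halves A" "U \<noteq> {}" "U \<noteq> halves A"
  let ?B = "{y \<in> A. \<exists>u\<in>X. y \<in> N u \<and> h u y \<in> U}"
  show "\<exists>a\<in>U. \<exists>b\<in>halves A - U. adj a b"
  proof (cases "\<exists>y\<in>?B. \<exists>u\<in>X. y \<in> N u \<and> h u y \<notin> U")
    case True
    then obtain y u u' where "y \<in> A" "u \<in> X" "y \<in> N u" "h u y \<in> U" "u' \<in> X" "y \<in> N u'" "h u' y \<notin> U" by blast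
    moreover from this have "adj (h u y) (h u' y)" using adj_h by blast
    ultimately show ?thesis using halvesI[of u' y A] by blast
  next
    case False
    have "?B \<noteq> {}"
    proof -
      obtain t where t: "t \<in> U" using U by blast
      then have "t \<in> halves A" using U by blast
      then show ?thesis using t by (elim halvesE) blast
    qed
    moreover have "?B \<noteq> A"
    proof
      assume eq: "?B = A"
      have "halves A \<subseteq> U"
      proof
        fix t assume "t \<in> halves A"
        then obtain u y where t: "t = h u y" "u \<in> X" "y \<in> N u" "y \<in> A" by (rule halvesE)
        then have "y \<in> ?B" unfolding eq by simp
        then show "t \<in> U" using False t by blast
      qed
      then show False using U by blast
    qed
    ultimately obtain y z where yz: "y \<in> ?B" "z \<in> A - ?B" "link y z"
      using mg.connected_setD[OF A(1), of ?B] by blast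
    then obtain u where u: "u \<in> X" "y \<in> N u" "z \<in> N u" "y \<noteq> z" unfolding link_def by blast
    have "h u y \<in> U" using False yz(1) u by blast
    moreover have "h u z \<notin> U" using yz(2) u by blast
    moreover have "h u z \<in> halves A" using yz(2) u halvesI by blast
    moreover have "adj (h u y) (h u z)" using u adj_h by blast
    ultimately show ?thesis by blast
  qed
qed

lemma adj_halves:
  assumes "u \<in> X" "y \<in> N u" "t \<in> halves A" "y \<notin> A"
  shows "adj (h u y) t \<longleftrightarrow> t = h u (other u y)"
  using assms(3)
proof (rule halvesE)
  fix u' y' assume t: "t = h u' y'" "u' \<in> X" "y' \<in> N u'" "y' \<in> A"
  have "y \<noteq> y'" using t assms by blast
  moreover have "u = u' \<longleftrightarrow> h u' y' = h u (other u y)"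
    using h_eq[of u' u y' "other u y"] t assms other[OF assms(1,2)] other_unique[OF assms(1,2), of y'] \<open>y \<noteq> y'\<close> by blast
  ultimately show ?thesis using adj_h[OF assms(1) t(2) assms(2) t(3)] t(1) by simp
qed

lemma halves_nonadjacent:
  assumes "a \<in> halves A" "b \<in> halves B" "A \<inter> B = {}" "\<And>y z. y \<in> A \<Longrightarrow> z \<in> B \<Longrightarrow> \<not> link y z"
  shows "\<not> adj a b"
proof
  assume adj: "adj a b"
  obtain u y where a: "a = h u y" "u \<in> X" "y \<in> N u" "y \<in> A" using assms(1) by (rule halvesE)
  obtain u' y' where b: "b = h u' y'" "u' \<in> X" "y' \<in> N u'" "y' \<in> B" using assms(2) by (rule halvesE)
  have "y \<noteq> y'" using a b assms(3) by blast
  then have "u = u'" using adj adj_h[OF a(2) b(2) a(3) b(3)] a b by blast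
  then have "link y y'" using a b \<open>y \<noteq> y'\<close> unfolding link_def by blast
  then show False using assms(4) a b by blast
qed

text \<open>A half edge whose mate lies outside is simplicial: all its neighbours sit at the same vertex.\<close>

lemma halves_connected_remove:
  assumes S: "connected_set adj S" "S \<subseteq> halves A" and u: "u \<in> X" "y \<in> N u" "h u (other u y) \<notin> S"
  shows "connected_set adj (S - {h u y})"
proof (cases "h u y \<in> S")
  case True
  have at: "\<exists>u'. u' \<in> X \<and> y \<in> N u' \<and> t = h u' y" if t: "t \<in> S" "adj (h u y) t" for t
  proof -
    have "t \<in> halves A" using t S by blast
    then obtain u' y' where t': "t = h u' y'" "u' \<in> X" "y' \<in> N u'" by (rule halvesE)
    have x: "(u = u') \<noteq> (y = y')" using adj_h[OF u(1) t'(2) u(2) t'(3)] t(2) t'(1) by blast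
    have "y = y'"
    proof (rule ccontr)
      assume "y \<noteq> y'"
      then have "u' = u" "y' \<noteq> y" using x by auto
      then have "y' = other u y" using other_unique[OF u(1,2)] t'(3) by blast
      then show False using u(3) t(1) t'(1) \<open>u' = u\<close> by blast
    qed
    then show ?thesis using t' by blast
  qed
  show ?thesis
  proof (rule connected_set_remove[OF S(1) True])
    fix t t' assume t: "t \<in> S" "t' \<in> S" "adj (h u y) t" "adj (h u y) t'" "t \<noteq> t'"
    obtain v where v: "v \<in> X" "y \<in> N v" "t = h v y" using at[OF t(1,3)] by blast
    obtain v' where v': "v' \<in> X" "y \<in> N v'" "t' = h v' y" using at[OF t(2,4)] by blast
    show "adj t t'" using v v' t(5) adj_h[of v v' y y] by blast
  qed
next
  case False
  then show ?thesis using S by simp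
qed

lemma sum_degrees:
  assumes "Y \<subseteq> X" "finite A"
  shows "(\<Sum>y\<in>A. card {u \<in> Y. y \<in> N u}) = (\<Sum>u\<in>Y. card (N u \<inter> A))"
proof -
  have "(\<Sum>y\<in>A. card {u \<in> Y. y \<in> N u}) = (\<Sum>u\<in>Y. card {y \<in> A. y \<in> N u})"
    using assms finite_subset[OF assms(1) finite_X] by (intro sum_multicount_gen) auto
  moreover have "{y \<in> A. y \<in> N u} = N u \<inter> A" for u by auto
  ultimately show ?thesis by simp
qed

lemma sum_degrees_W:
  assumes "Y \<subseteq> X"
  shows "(\<Sum>y\<in>W Y. card {u \<in> Y. y \<in> N u}) = 2 * card Y"
proof -
  have "N u \<inter> W Y = N u" if "u \<in> Y" for u using that unfolding W_def by blast
  then have "(\<Sum>u\<in>Y. card (N u \<inter> W Y)) = (\<Sum>u\<in>Y. 2)"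
    using card_N assms by (intro sum.cong) auto
  then show ?thesis using sum_degrees[OF assms finite_W[OF assms]] by simp
qed

text \<open>The hypothesis describes a forest, in which each edge is assigned its end away from the
  root \<open>r\<close>. The degree sum \<open>2 * card Y\<close> is too small for all vertices but
  \<open>r\<close> to have degree 2, so there is a leaf other than \<open>r\<close> to
  strip.\<close>

lemma acyclic_injection:
  assumes "Y \<subseteq> X" "\<And>Z. Z \<subseteq> Y \<Longrightarrow> Z \<noteq> {} \<Longrightarrow> card Z < card (W Z)"
  shows "\<exists>f. inj_on f Y \<and> (\<forall>u\<in>Y. f u \<in> N u \<and> f u \<noteq> r)"
  using assms
proof (induction "card Y" arbitrary: Y)
  case 0
  then have "Y = {}" using finite_subset[OF 0(2) finite_X] by simp
  then show ?case by simp
next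
  case (Suc n)
  have finY: "finite Y" by (rule finite_subset[OF Suc.prems(1) finite_X])
  have ne: "Y \<noteq> {}" using Suc.hyps(2) by auto
  let ?d = "\<lambda>y. card {u \<in> Y. y \<in> N u}"
  have finW: "finite (W Y)" using finite_W Suc.prems(1) .
  have pos: "1 \<le> ?d y" if "y \<in> W Y" for y
  proof -
    have "{u \<in> Y. y \<in> N u} \<noteq> {}" using that unfolding W_def by blast
    then show ?thesis using finY card_gt_0_iff[of "{u \<in> Y. y \<in> N u}"] by simp
  qed
  have "\<exists>y\<in>W Y. y \<noteq> r \<and> ?d y = 1"
  proof (rule ccontr)
    assume "\<not> ?thesis"
    then have two: "2 \<le> ?d y" if "y \<in> W Y - {r}" for y using pos[of y] that by fastforce
    have low: "2 * card (W Y - {r}) \<le> (\<Sum>y\<in>W Y - {r}. ?d y)"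
      using sum_mono[of "W Y - {r}" "\<lambda>_. 2" ?d] two by simp
    have total: "(\<Sum>y\<in>W Y. ?d y) = 2 * card Y" by (rule sum_degrees_W[OF Suc.prems(1)])
    have lt: "card Y < card (W Y)" using Suc.prems(2)[of Y] ne by blast
    show False
    proof (cases "r \<in> W Y")
      case True
      have "(\<Sum>y\<in>W Y. ?d y) = ?d r + (\<Sum>y\<in>W Y - {r}. ?d y)" by (rule sum.remove[OF finW True])
      moreover have "Suc (card (W Y - {r})) = card (W Y)" by (rule card_Suc_Diff1[OF finW True])
      ultimately show False using low total lt pos[OF True] by linarith
    next
      case False
      then have "W Y - {r} = W Y" by simp
      then show False using low total lt by simp
    qed
  qed
  then obtain y where y: "y \<in> W Y" "y \<noteq> r" "?d y = 1" by blast
  then obtain u where u: "{v \<in> Y. y \<in> N v} = {u}" by (auto simp: card_1_singleton_iff)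
  then have uY: "u \<in> Y" "y \<in> N u" by auto
  have "\<exists>f. inj_on f (Y - {u}) \<and> (\<forall>v\<in>Y - {u}. f v \<in> N v \<and> f v \<noteq> r)"
  proof (rule Suc.hyps(1))
    show "n = card (Y - {u})" using Suc.hyps(2) uY(1) finY by simp
    show "Y - {u} \<subseteq> X" using Suc.prems(1) by blast
    show "card Z < card (W Z)" if "Z \<subseteq> Y - {u}" "Z \<noteq> {}" for Z
      using that by (intro Suc.prems(2)) blast+
  qed
  then obtain f where f: "inj_on f (Y - {u})" "\<forall>v\<in>Y - {u}. f v \<in> N v \<and> f v \<noteq> r" by blast
  have nf: "f v \<noteq> y" if "v \<in> Y - {u}" for v using f(2) that u by blast
  have inj: "inj_on (f(u := y)) Y"
  proof (rule inj_onI)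
    fix a b assume ab: "a \<in> Y" "b \<in> Y" "(f(u := y)) a = (f(u := y)) b"
    show "a = b"
    proof (cases "a = u \<or> b = u")
      case True
      then show ?thesis using ab nf[of a] nf[of b] by (auto split: if_splits)
    next
      case False
      then show ?thesis using ab f(1) by (auto dest: inj_onD)
    qed
  qed
  have "\<forall>v\<in>Y. (f(u := y)) v \<in> N v \<and> (f(u := y)) v \<noteq> r" using f(2) uY(2) y(2) by auto
  then show ?case using inj by blast
qed

text \<open>A minimal edge set with no more vertices than edges is a cycle, possibly a pair of
  parallel edges; \<open>f\<close> and \<open>g\<close> are the two ends of each edge in a cyclic
  orientation. It arises by cutting an edge \<open>u0\<close> and rooting the remaining forest at
  the end \<open>r\<close> of \<open>u0\<close>.\<close>

lemma unicyclic_edges: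
  assumes I: "I \<subseteq> X" "I \<noteq> {}" "card (W I) \<le> card I"
  obtains Y f g where "Y \<subseteq> I" "Y \<noteq> {}" "inj_on f Y" "f ` Y = W Y" "inj_on g Y" "g ` Y = W Y"
    "\<forall>u\<in>Y. N u = {f u, g u} \<and> f u \<noteq> g u"
    "\<forall>Z. Z \<subseteq> Y \<longrightarrow> Z \<noteq> {} \<longrightarrow> card (W Z) \<le> card Z \<longrightarrow> Z = Y"
proof -
  let ?P = "\<lambda>Y. Y \<subseteq> I \<and> Y \<noteq> {} \<and> card (W Y) \<le> card Y"
  have "\<exists>Y. ?P Y \<and> (\<forall>Z. ?P Z \<longrightarrow> card Y \<le> card Z)"
    using ex_has_least_nat[of ?P I card] I by blast
  then obtain Y where Y: "Y \<subseteq> I" "Y \<noteq> {}" "card (W Y) \<le> card Y" and min: "\<And>Z. ?P Z \<Longrightarrow> card Y \<le> card Z" by blast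
  have YX: "Y \<subseteq> X" using Y I by blast
  have finY: "finite Y" by (rule finite_subset[OF YX finite_X])
  have finW: "finite (W Y)" using finite_W[OF YX] .
  have min': "Z = Y" if "Z \<subseteq> Y" "Z \<noteq> {}" "card (W Z) \<le> card Z" for Z
    using min[of Z] that Y(1) card_seteq[OF finY that(1)] by blast
  have W2: "2 \<le> card (W Z)" if Z: "Z \<subseteq> Y" "Z \<noteq> {}" for Z
  proof -
    obtain u where u: "u \<in> Z" using Z(2) by blast
    have "N u \<subseteq> W Z" using u unfolding W_def by blast
    then have "card (N u) \<le> card (W Z)" using finite_W[of Z] Z YX by (intro card_mono) auto
    then show ?thesis using card_N[of u] u Z YX by auto
  qed
  have rem: "card Y \<le> card (W (Y - {u}))" if u: "u \<in> Y" for u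
  proof (rule ccontr)
    assume c: "\<not> ?thesis"
    then have le: "card (W (Y - {u})) \<le> card (Y - {u})" using u finY by simp
    have "Y - {u} \<noteq> {}"
    proof
      assume "Y - {u} = {}"
      then have "Y = {u}" using u by blast
      then show False using W2[of Y] Y(2,3) by simp
    qed
    then show False using min'[OF _ _ le] u by blast
  qed
  have eq: "card (W Y) = card Y"
  proof -
    obtain u where u: "u \<in> Y" using Y by blast
    have "card (W (Y - {u})) \<le> card (W Y)" by (rule card_mono[OF finW W_mono]) blast
    then show ?thesis using rem[OF u] Y(3) by linarith
  qed
  obtain u0 where u0: "u0 \<in> Y" using Y by blast
  have u0X: "u0 \<in> X" using u0 YX by blast
  obtain r q where rq: "N u0 = {r, q}" "r \<noteq> q" using card_N[OF u0X] by (auto simp: card_2_iff)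
  have "\<exists>f. inj_on f (Y - {u0}) \<and> (\<forall>u\<in>Y - {u0}. f u \<in> N u \<and> f u \<noteq> r)"
  proof (rule acyclic_injection)
    show "Y - {u0} \<subseteq> X" using YX by blast
    fix Z assume Z: "Z \<subseteq> Y - {u0}" "Z \<noteq> {}"
    then have "Z \<noteq> Y" "Z \<subseteq> Y" using u0 by auto
    then show "card Z < card (W Z)" using min'[of Z] Z(2) by linarith
  qed
  then obtain f0 where f0: "inj_on f0 (Y - {u0})" "\<forall>u\<in>Y - {u0}. f0 u \<in> N u \<and> f0 u \<noteq> r" by blast
  define f where "f = f0(u0 := r)"
  define g where "g u = other u (f u)" for u
  have fN: "f u \<in> N u" if "u \<in> Y" for u using f0(2) that rq unfolding f_def by auto
  have inj: "inj_on f Y"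
  proof (rule inj_onI)
    fix a b assume ab: "a \<in> Y" "b \<in> Y" "f a = f b"
    show "a = b"
    proof (cases "a = u0 \<or> b = u0")
      case True
      then show ?thesis using ab f0(2) unfolding f_def by (auto split: if_splits)
    next
      case False
      then show ?thesis using ab f0(1) unfolding f_def by (auto dest: inj_onD)
    qed
  qed
  have fW: "f ` Y = W Y"
  proof (rule card_seteq[OF finW])
    show "f ` Y \<subseteq> W Y" using fN unfolding W_def by blast
    show "card (W Y) \<le> card (f ` Y)" using card_image[OF inj] eq by simp
  qed
  have g: "N u = {f u, g u} \<and> f u \<noteq> g u" if "u \<in> Y" for u
    using other[OF _ fN[OF that]] that YX unfolding g_def by fastforce
  have gW: "g ` Y = W Y"
  proof
    show "g ` Y \<subseteq> W Y" using g unfolding W_def by blast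
    show "W Y \<subseteq> g ` Y"
    proof
      fix y assume y: "y \<in> W Y"
      then obtain u where u: "u \<in> Y" "f u = y" using fW by (metis imageE)
      have "\<exists>v\<in>Y - {u}. y \<in> N v"
      proof (rule ccontr)
        assume n: "\<not> ?thesis"
        then have "W (Y - {u}) \<subseteq> W Y - {y}" unfolding W_def by blast
        then have "card (W (Y - {u})) \<le> card (W Y - {y})" using finW by (intro card_mono) auto
        also have "\<dots> < card (W Y)" using finW y by (rule card_Diff1_less)
        finally show False using rem[OF u(1)] eq by simp
      qed
      then obtain v where v: "v \<in> Y" "v \<noteq> u" "y \<in> N v" by blast
      then have "f v \<noteq> y" using inj u by (auto dest: inj_onD)
      then have "y = g v" using g[OF v(1)] v(3) by auto
      then show "y \<in> g ` Y" using v(1) by blast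
    qed
  qed
  have injg: "inj_on g Y" by (rule eq_card_imp_inj_on[OF finY]) (simp add: gW eq)
  show ?thesis
    by (rule that[OF Y(1,2) inj fW injg gW]) (use g min' in blast)+
qed

text \<open>As many inner edges as vertices force a cycle, and its halves form an induced cycle
  \<open>?Z\<close> of even length in the line graph. The rest is colored towards \<open>?Z\<close>,
  whose residual lists keep two colors.\<close>

lemma halves_degree_colorable:
  assumes C: "connected_set link C" "C \<subseteq> W X" "C \<noteq> {}" and c: "card C \<le> card (inner_edges C)"
  shows "degree_colorable adj TYPE('c) (halves C)"
  unfolding degree_colorable_def
proof (intro allI impI)
  fix M :: "'v \<Rightarrow> 'c set"
  assume M: "\<forall>t\<in>halves C. card (nbrs (halves C) t) \<le> card (M t)"
  let ?S = "halves C"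
  have finC: "finite C" by (rule finite_subset[OF C(2) finite_W[OF subset_refl]])
  have IX: "inner_edges C \<subseteq> X" unfolding inner_edges_def by blast
  have Ine: "inner_edges C \<noteq> {}" using c C(3) finC by (metis card.empty card_gt_0_iff le_zero_eq not_gr_zero)
  have "W (inner_edges C) \<subseteq> C" unfolding W_def inner_edges_def by blast
  then have cI: "card (W (inner_edges C)) \<le> card (inner_edges C)" using card_mono[OF finC] c by (meson le_trans)
  obtain Y f g where YI: "Y \<subseteq> inner_edges C" and Yne: "Y \<noteq> {}"
    and f: "inj_on f Y" "f ` Y = W Y" and g: "inj_on g Y" "g ` Y = W Y"
    and fg': "\<forall>u\<in>Y. N u = {f u, g u} \<and> f u \<noteq> g u"
    and min: "\<forall>Z. Z \<subseteq> Y \<longrightarrow> Z \<noteq> {} \<longrightarrow> card (W Z) \<le> card Z \<longrightarrow> Z = Y"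
    by (rule unicyclic_edges[OF IX Ine cI])
  note fg = fg'[rule_format] and min = min[rule_format]
  have YX: "Y \<subseteq> X" using YI IX by blast
  have finY: "finite Y" by (rule finite_subset[OF YX finite_X])
  define a where "a u = h u (f u)" for u
  define b where "b u = h u (g u)" for u
  \<comment> \<open>\<open>\<tau> u\<close> is the edge after \<open>u\<close> on the cycle, so its
    halves follow each other as \<open>a u\<close>, \<open>b u\<close>, \<open>a (\<tau> u)\<close>;
    the rotation \<open>\<rho>\<close> is built from this order.\<close>
  define \<tau> where "\<tau> u = inv_into Y f (g u)" for u
  have \<tau>: "\<tau> u \<in> Y" "f (\<tau> u) = g u" if "u \<in> Y" for u
  proof -
    have "g u \<in> f ` Y" using that g(2) f(2) by blast
    then show "\<tau> u \<in> Y" "f (\<tau> u) = g u" unfolding \<tau>_def by (auto simp: inv_into_into f_inv_into_f)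
  qed
  have \<tau>_surj: "\<exists>v\<in>Y. \<tau> v = u" if u: "u \<in> Y" for u
  proof -
    have "f u \<in> g ` Y" using u g(2) f(2) by blast
    then obtain v where v: "v \<in> Y" "g v = f u" by (metis imageE)
    then have "\<tau> v = u" using u f(1) unfolding \<tau>_def by (simp add: inv_into_f_f)
    then show ?thesis using v by blast
  qed
  have YN: "u \<in> X" "f u \<in> N u" "g u \<in> N u" if "u \<in> Y" for u using fg[OF that] YX that by auto
  have aa: "a u = a v \<longleftrightarrow> u = v" if "u \<in> Y" "v \<in> Y" for u v
    unfolding a_def using h_eq YN that by blast
  have bb: "b u = b v \<longleftrightarrow> u = v" if "u \<in> Y" "v \<in> Y" for u v
    unfolding b_def using h_eq YN that by blast
  have ab: "a u \<noteq> b v" if "u \<in> Y" "v \<in> Y" for u v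
  proof
    assume "a u = b v"
    then have "u = v \<and> f u = g v"
      unfolding a_def b_def using h_eq[OF YN(1)[OF that(1)] YN(1)[OF that(2)] YN(2)[OF that(1)] YN(3)[OF that(2)]] by blast
    then show False using fg[OF that(1)] by blast
  qed
  have inja: "inj_on a Y" and injb: "inj_on b Y" using aa bb by (auto intro: inj_onI)
  let ?Z = "a ` Y \<union> b ` Y"
  define \<rho> where "\<rho> z = (if z \<in> a ` Y then b (inv_into Y a z) else a (\<tau> (inv_into Y b z)))" for z
  have \<rho>a: "\<rho> (a u) = b u" if "u \<in> Y" for u using that inja unfolding \<rho>_def by (simp add: inv_into_f_f)
  have \<rho>b: "\<rho> (b u) = a (\<tau> u)" if "u \<in> Y" for u
  proof -
    have "b u \<notin> a ` Y"
    proof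
      assume "b u \<in> a ` Y"
      then obtain v where "b u = a v" "v \<in> Y" by (rule imageE)
      then show False using ab[of v u] that by simp
    qed
    then show ?thesis using that injb unfolding \<rho>_def by (simp add: inv_into_f_f)
  qed
  have ZS: "?Z \<subseteq> ?S"
  proof -
    have "N u \<subseteq> C" if "u \<in> Y" for u using YI that unfolding inner_edges_def by blast
    then show ?thesis unfolding a_def b_def using YN halvesI by blast
  qed
  have adjaa: "\<not> adj (a u) (a v)" if uv: "u \<in> Y" "v \<in> Y" for u v
    unfolding a_def adj_h[OF YN(1)[OF uv(1)] YN(1)[OF uv(2)] YN(2)[OF uv(1)] YN(2)[OF uv(2)]]
    using uv inj_on_eq_iff[OF f(1)] by blast
  have adjbb: "\<not> adj (b u) (b v)" if uv: "u \<in> Y" "v \<in> Y" for u v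
    unfolding b_def adj_h[OF YN(1)[OF uv(1)] YN(1)[OF uv(2)] YN(3)[OF uv(1)] YN(3)[OF uv(2)]]
    using uv inj_on_eq_iff[OF g(1)] by blast
  have adjab: "v = u \<or> u = \<tau> v" if uv: "u \<in> Y" "v \<in> Y" and ad: "adj (a u) (b v)" for u v
  proof (rule ccontr)
    assume n: "\<not> ?thesis"
    then have "f u = g v" using adj_h[of u v "f u" "g v"] YN uv ad unfolding a_def b_def by blast
    then have "u = \<tau> v" using \<tau>[OF uv(2)] uv f(1) by (metis inj_onD)
    then show False using n by blast
  qed
  have \<rho>Z: "\<rho> ` ?Z = ?Z"
  proof
    show "\<rho> ` ?Z \<subseteq> ?Z" using \<rho>a \<rho>b \<tau> by auto
    show "?Z \<subseteq> \<rho> ` ?Z"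
    proof
      fix z assume "z \<in> ?Z"
      then consider u where "u \<in> Y" "z = a u" | u where "u \<in> Y" "z = b u" by blast
      then show "z \<in> \<rho> ` ?Z"
      proof cases
        case 1
        then obtain v where v: "v \<in> Y" "\<tau> v = u" using \<tau>_surj by blast
        then have "z = \<rho> (b v)" using 1 \<rho>b by simp
        then show ?thesis using v by blast
      next
        case 2
        then have "z = \<rho> (a u)" using \<rho>a by simp
        then show ?thesis using 2 by blast
      qed
    qed
  qed
  have finZ: "finite ?Z" using finY by simp
  \<comment> \<open>The edges meeting an invariant set of halves cover no more vertices than they
    are edges, so by minimality of \<open>Y\<close> they are all of \<open>Y\<close>.\<close>
  have cyc: "U = ?Z" if U: "U \<subseteq> ?Z" "U \<noteq> {}" "\<rho> ` U = U" for U
  proof -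
    have cl: "\<rho> z \<in> U" if "z \<in> U" for z using imageI[OF that, of \<rho>] unfolding U(3) .
    let ?Y = "{u \<in> Y. a u \<in> U \<or> b u \<in> U}"
    have bU: "b u \<in> U" if "u \<in> ?Y" for u using cl[of "a u"] \<rho>a[of u] that by auto
    have \<tau>U: "a (\<tau> u) \<in> U" if "u \<in> ?Y" for u using cl[OF bU[OF that]] \<rho>b[of u] that by auto
    have "W ?Y \<subseteq> f ` ?Y"
    proof
      fix y assume "y \<in> W ?Y"
      then obtain u where u: "u \<in> ?Y" "y \<in> N u" unfolding W_def by blast
      then consider "y = f u" | "y = f (\<tau> u)" using fg[of u] \<tau>(2)[of u] by auto
      then show "y \<in> f ` ?Y"
      proof cases
        case 2
        have "\<tau> u \<in> ?Y" using \<tau>U[OF u(1)] \<tau>(1)[of u] u(1) by blast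
        then show ?thesis using 2 by blast
      qed (use u in blast)
    qed
    then have "card (W ?Y) \<le> card (f ` ?Y)" using finY by (intro card_mono) auto
    also have "\<dots> \<le> card ?Y" using finY by (intro card_image_le) auto
    finally have le: "card (W ?Y) \<le> card ?Y" .
    have ne: "?Y \<noteq> {}" using U(1,2) by blast
    have all: "?Y = Y" by (rule min[OF _ ne le]) blast
    have "b u \<in> U" if "u \<in> Y" for u using bU[of u] that unfolding all by blast
    moreover have "a u \<in> U" if u: "u \<in> Y" for u
    proof -
      obtain v where v: "v \<in> Y" "\<tau> v = u" using \<tau>_surj[OF u] by blast
      have "v \<in> ?Y" unfolding all by (rule v(1))
      then show ?thesis using \<tau>U[of v] v(2) by simp
    qed
    ultimately show ?thesis using U(1) by blast
  qed
  have finS: "finite ?S" by (rule finite_halves)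
  have conn: "connected_set adj ?S" by (rule halves_connected[OF C(1,2)])
  have "degenerate adj M (?S - ?Z)"
    unfolding degenerate_def
  proof (intro allI impI)
    fix U assume U: "U \<subseteq> ?S - ?Z" "U \<noteq> {}"
    have "U \<noteq> ?S" using U(1) ZS Yne by blast
    then obtain p q where pq: "p \<in> U" "q \<in> ?S - U" "adj p q" using connected_setD[OF conn _ U(2)] U(1) by blast
    have "nbrs U p \<subset> nbrs ?S p" using pq U(1) by blast
    then have "card (nbrs U p) < card (nbrs ?S p)" using finS by (intro psubset_card_mono) auto
    moreover have "card (nbrs ?S p) \<le> card (M p)" using M pq(1) U(1) by blast
    ultimately show "\<exists>v\<in>U. card (nbrs U v) < card (M v)" using pq(1) by (intro bexI[of _ p]) auto
  qed
  then obtain \<kappa> where \<kappa>: "coloring_on adj M (?S - ?Z) \<kappa>"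
    using degenerate_colorable[of "?S - ?Z" M] finS by auto
  let ?R = "residual adj M (?S - ?Z) \<kappa>"
  have two: "2 \<le> card (nbrs ?Z z)" if z: "z \<in> ?Z" for z
  proof -
    have two': "2 \<le> card (nbrs ?Z z)" if "p \<in> ?Z" "q \<in> ?Z" "p \<noteq> q" "adj z p" "adj z q" for p q
    proof -
      have "card {p, q} \<le> card (nbrs ?Z z)" using that finZ by (intro card_mono) auto
      then show ?thesis using that(3) by simp
    qed
    have ab': "adj (a u) (b u)" if "u \<in> Y" for u
      unfolding a_def b_def using adj_h[of u u "f u" "g u"] YN fg that by blast
    have ba': "adj (b u) (a (\<tau> u))" if u: "u \<in> Y" for u
    proof -
      have fgu: "f (\<tau> u) = g u" "\<tau> u \<in> Y" using \<tau> u by auto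
      have "u \<noteq> \<tau> u" using fgu fg[OF u] by metis
      then show ?thesis unfolding a_def b_def fgu(1)
        using adj_h[of u "\<tau> u" "g u" "g u"] YN[OF u] YN[OF fgu(2)] fgu(1) by metis
    qed
    consider u where "u \<in> Y" "z = a u" | u where "u \<in> Y" "z = b u" using z by blast
    then show ?thesis
    proof cases
      case 1
      obtain v where v: "v \<in> Y" "\<tau> v = u" using \<tau>_surj[OF 1(1)] by blast
      have "u \<noteq> v" using \<tau>(2)[OF v(1)] v fg[OF v(1)] by metis
      show ?thesis
      proof (rule two'[of "b u" "b v"])
        show "adj z (b v)" using ba'[OF v(1)] adj_sym unfolding 1(2) v(2) by blast
        show "b u \<noteq> b v" using bb 1 v \<open>u \<noteq> v\<close> by blast
      qed (use 1 v ab' in auto)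
    next
      case 2
      have "u \<noteq> \<tau> u" using \<tau>(2)[OF 2(1)] fg[OF 2(1)] by metis
      show ?thesis
      proof (rule two'[of "a u" "a (\<tau> u)"])
        show "adj z (a u)" using ab'[OF 2(1)] adj_sym unfolding 2(2) by blast
        show "adj z (a (\<tau> u))" using ba'[OF 2(1)] unfolding 2(2) .
        show "a u \<noteq> a (\<tau> u)" using aa 2 \<tau>(1) \<open>u \<noteq> \<tau> u\<close> by blast
      qed (use 2 \<tau> in auto)
    qed
  qed
  have R2: "2 \<le> card (?R z)" if z: "z \<in> ?Z" for z
  proof -
    have "card (nbrs ?S z) = card (nbrs (?S - ?Z) z) + card (nbrs ?Z z)"
      by (rule card_nbrs_split[OF finS ZS])
    moreover have "finite (nbrs (?S - ?Z) z)" using finS by simp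
    moreover have "card (nbrs ?S z) \<le> card (M z)" using M z ZS by blast
    ultimately show ?thesis using card_residual[of "?S - ?Z" z M \<kappa>] two[OF z] by linarith
  qed
  have "\<exists>\<sigma>. coloring_on adj ?R ?Z \<sigma>"
  proof (rule even_cycle_colorable[OF finZ _ \<rho>Z, where P = "a ` Y"])
    show "inj_on \<rho> ?Z" by (rule eq_card_imp_inj_on[OF finZ]) (simp only: \<rho>Z)
    show "v = \<rho> u \<or> u = \<rho> v" if uv: "u \<in> ?Z" "v \<in> ?Z" "adj u v" for u v
      using uv(1)
    proof
      assume "u \<in> a ` Y"
      then obtain x where x: "x \<in> Y" "u = a x" by blast
      have "v \<notin> a ` Y" using adjaa x uv(3) by blast
      then obtain y where y: "y \<in> Y" "v = b y" using uv(2) by blast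
      have "y = x \<or> x = \<tau> y" using adjab[OF x(1) y(1)] uv(3) x y by blast
      then show ?thesis using \<rho>a[OF x(1)] \<rho>b[OF y(1)] x y by auto
    next
      assume "u \<in> b ` Y"
      then obtain x where x: "x \<in> Y" "u = b x" by blast
      have "v \<notin> b ` Y" using adjbb x uv(3) by blast
      then obtain y where y: "y \<in> Y" "v = a y" using uv(2) by blast
      have "x = y \<or> y = \<tau> x" using adjab[OF y(1) x(1)] adj_sym[OF uv(3)] x y by blast
      then show ?thesis using \<rho>a[OF y(1)] \<rho>b[OF x(1)] x y by auto
    qed
    show "U = ?Z" if "U \<subseteq> ?Z" "U \<noteq> {}" "\<rho> ` U = U" for U by (rule cyc[OF that])
    show "\<rho> z \<in> a ` Y \<longleftrightarrow> z \<notin> a ` Y" if z: "z \<in> ?Z" for z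
    proof (cases "z \<in> a ` Y")
      case True
      then obtain x where x: "x \<in> Y" "z = a x" by blast
      then have "\<rho> z \<notin> a ` Y" using \<rho>a ab by fastforce
      then show ?thesis using True by blast
    next
      case False
      then obtain x where x: "x \<in> Y" "z = b x" using z by blast
      then have "\<rho> z \<in> a ` Y" using \<rho>b \<tau>(1) by auto
      then show ?thesis using False by blast
    qed
  qed (rule R2)
  then obtain \<sigma> where \<sigma>: "coloring_on adj ?R ?Z \<sigma>" by blast
  have "coloring_on adj M ((?S - ?Z) \<union> ?Z) (\<lambda>v. if v \<in> ?Z then \<sigma> v else \<kappa> v)"
    by (rule coloring_on_override[OF \<kappa> \<sigma>]) blast
  moreover have "(?S - ?Z) \<union> ?Z = ?S" using ZS by blast
  ultimately have "coloring_on adj M ?S (\<lambda>v. if v \<in> ?Z then \<sigma> v else \<kappa> v)" by (simp only:)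
  then show "\<exists>\<sigma>. coloring_on adj M ?S \<sigma>" by blast
qed

end

section \<open>Components of the multigraph without a vertex\<close>

context half_edges
begin

definition comps :: "'b \<Rightarrow> 'b set set" where
  "comps w = mg.component (W X - {w}) ` (W X - {w})"

definition att :: "'b \<Rightarrow> 'b set \<Rightarrow> 'a set" where
  "att w C = {u \<in> star w. other u w \<in> C}"

lemma other_other: "u \<in> X \<Longrightarrow> y \<in> N u \<Longrightarrow> other u (other u y) = y"
  using other[of u y] other_unique[of u "other u y" y] by auto

lemma starD: "u \<in> star w \<Longrightarrow> u \<in> X \<and> w \<in> N u"
  unfolding star_def by blast

lemma N_subset_W: "u \<in> X \<Longrightarrow> N u \<subseteq> W X"
  unfolding W_def by blast

lemma other_star:
  assumes "u \<in> star w"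
  shows "other u w \<in> N u" "other u w \<noteq> w" "other u w \<in> W X - {w}" "link (other u w) w"
proof -
  have u: "u \<in> X" "w \<in> N u" using starD[OF assms] by auto
  show 1: "other u w \<in> N u" "other u w \<noteq> w" using other[OF u] by auto
  show "other u w \<in> W X - {w}" using 1 N_subset_W[OF u(1)] by blast
  show "link (other u w) w" unfolding link_def using 1 u by blast
qed

lemma comps:
  assumes "C \<in> comps w"
  shows "C \<subseteq> W X - {w}" "C \<noteq> {}" "connected_set link C" "finite C" "w \<notin> C"
proof -
  obtain y where y: "y \<in> W X - {w}" "C = mg.component (W X - {w}) y" using assms unfolding comps_def by blast
  show 1: "C \<subseteq> W X - {w}" unfolding y(2) by (rule mg.component_subset)
  show "C \<noteq> {}" using mg.component_self[OF y(1)] unfolding y(2) by blast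
  show "connected_set link C" unfolding y(2) by (rule mg.component_connected)
  show "finite C" by (rule finite_subset[OF 1]) (use finite_W[OF subset_refl] in simp)
  show "w \<notin> C" using 1 by blast
qed

lemma comps_component: "C \<in> comps w \<Longrightarrow> y \<in> C \<Longrightarrow> C = mg.component (W X - {w}) y"
  unfolding comps_def using mg.component_eq by blast

lemma comps_closed: "C \<in> comps w \<Longrightarrow> y \<in> C \<Longrightarrow> z \<in> W X - {w} \<Longrightarrow> link y z \<Longrightarrow> z \<in> C"
  unfolding comps_def using mg.component_closed by blast

lemma comps_eq: "C \<in> comps w \<Longrightarrow> D \<in> comps w \<Longrightarrow> y \<in> C \<Longrightarrow> y \<in> D \<Longrightarrow> C = D"
  using comps_component[of C w y] comps_component[of D w y] by simp

lemma comps_disjoint: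
  assumes "C \<in> comps w" "D \<in> comps w" "C \<noteq> D"
  shows "C \<inter> D = {}" "\<And>y z. y \<in> C \<Longrightarrow> z \<in> D \<Longrightarrow> \<not> link y z"
proof -
  show d: "C \<inter> D = {}" using comps_eq assms by blast
  show "\<not> link y z" if "y \<in> C" "z \<in> D" for y z
    using comps_closed[OF assms(1) that(1)] comps(1)[OF assms(2)] that d by blast
qed

lemma comps_cover:
  assumes "y \<in> W X - {w}"
  shows "\<exists>C\<in>comps w. y \<in> C"
proof
  show "y \<in> mg.component (W X - {w}) y" by (rule mg.component_self[OF assms])
  show "mg.component (W X - {w}) y \<in> comps w" unfolding comps_def using assms by (rule imageI)
qed

lemma edge_at_comp:
  assumes C: "C \<in> comps w" and u: "u \<in> X" "y \<in> N u" "y \<in> C"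
  shows "u \<in> inner_edges C \<union> att w C"
proof (cases "w \<in> N u")
  case True
  have "y \<noteq> w" using u comps(5)[OF C] by blast
  then have "y = other u w" by (rule other_unique[OF u(1) True u(2)])
  then show ?thesis using True u unfolding att_def star_def by blast
next
  case False
  have o: "N u = {y, other u y}" "other u y \<noteq> y" "other u y \<in> N u" using other[OF u(1,2)] by auto
  have "link y (other u y)" unfolding link_def using o(2,3) u(1,2) by auto
  moreover have "other u y \<in> W X - {w}" using o(3) False N_subset_W[OF u(1)] by blast
  ultimately have "other u y \<in> C" using comps_closed[OF C u(3)] by blast
  then have "N u \<subseteq> C" using o(1) u(3) by auto
  then show ?thesis using u(1) unfolding inner_edges_def by blast
qed

lemma inner_att_disjoint: "C \<in> comps w \<Longrightarrow> inner_edges C \<inter> att w C = {}"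
  using comps(5)[of C w] unfolding inner_edges_def att_def star_def by blast

lemma finite_inner: "finite (inner_edges C)" unfolding inner_edges_def using finite_X by simp

lemma finite_att: "finite (att w C)" unfolding att_def using finite_star by simp

lemma att_subset: "att w C \<subseteq> star w" unfolding att_def by blast

lemma att_disjoint: "C \<in> comps w \<Longrightarrow> D \<in> comps w \<Longrightarrow> C \<noteq> D \<Longrightarrow> att w C \<inter> att w D = {}"
  unfolding att_def using comps_eq by blast

lemma att_cover: "u \<in> star w \<Longrightarrow> \<exists>C\<in>comps w. u \<in> att w C"
  using comps_cover[OF other_star(3)] unfolding att_def by blast

end

text \<open>The clique \<open>K\<close> consists of the half edges at \<open>w\<close> in directions \<open>U\<close>; removing the mate of
  the half edge in direction \<open>s\<close> leaves that half edge without neighbours outside \<open>K\<close>.\<close>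

locale pruned_star = half_edges adj X N h
  for adj :: "'v \<Rightarrow> 'v \<Rightarrow> bool" and X :: "'a set" and N :: "'a \<Rightarrow> 'b set" and h +
  fixes w :: 'b and \<C> :: "'b set set" and U :: "'a set" and s :: 'a
  assumes C_comps: "\<C> \<subseteq> comps w" and U_star: "U \<subseteq> star w" and s_U: "s \<in> U" and card_U: "4 \<le> card U"
    and C_att: "\<And>C. C \<in> \<C> \<Longrightarrow> \<exists>u\<in>U - {s}. other u w \<in> C"
begin

definition K :: "'v set" where "K = (\<lambda>u. h u w) ` U"

definition pruned :: "'b set \<Rightarrow> 'v set" where "pruned C = halves C - {h s (other s w)}"

lemma U_X: "u \<in> U \<Longrightarrow> u \<in> X \<and> w \<in> N u \<and> other u w \<in> N u"
  using U_star starD other_star(1) by blast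

lemma h_w_eq: "u \<in> U \<Longrightarrow> v \<in> U \<Longrightarrow> h u w = h v w \<longleftrightarrow> u = v"
  using h_eq U_X by blast

lemma h_mate_eq: "u \<in> U \<Longrightarrow> v \<in> U \<Longrightarrow> h u (other u w) = h v (other v w) \<longleftrightarrow> u = v"
  using h_eq[of u v "other u w" "other v w"] U_X by blast

lemma card_h_w: "A \<subseteq> U \<Longrightarrow> card ((\<lambda>u. h u w) ` A) = card A"
  by (intro card_image inj_onI) (use h_w_eq in blast)

lemma finite_U: "finite U" using card_U by (metis card.infinite not_numeral_le_zero)

lemma w_C: "C \<in> \<C> \<Longrightarrow> w \<notin> C" using comps(5) C_comps by blast

lemma adj_pruned:
  assumes "u \<in> U" "C \<in> \<C>" "t \<in> halves C"
  shows "adj (h u w) t \<longleftrightarrow> t = h u (other u w)"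
  using adj_halves[of u w t C] assms U_X w_C by blast

lemma clique_K: "a \<in> K \<Longrightarrow> b \<in> K \<Longrightarrow> a \<noteq> b \<Longrightarrow> adj a b"
  unfolding K_def using adj_h U_X by blast

lemma K_disjoint: "C \<in> \<C> \<Longrightarrow> K \<inter> halves C = {}"
  unfolding K_def using h_halves_iff U_X w_C by blast

text \<open>The removed halves have their mates at \<open>w\<close>, outside \<open>C\<close>, and
  are therefore simplicial.\<close>

lemma pruned_remove_connected:
  assumes "C \<in> \<C>" "u \<in> U"
  shows "connected_set adj (pruned C)" "connected_set adj (pruned C - {h u (other u w)})"
proof -
  have C: "C \<in> comps w" using assms C_comps by blast
  have H: "connected_set adj (halves C)"
    by (rule halves_connected) (use comps[OF C] in auto)
  have no: "h v (other v (other v w)) \<notin> halves C" if "v \<in> U" for v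
    using other_other[of v w] U_X[OF that] h_halves_iff[of v w C] w_C[OF assms(1)] by simp
  show P: "connected_set adj (pruned C)" unfolding pruned_def
    by (rule halves_connected_remove[OF H subset_refl]) (use U_X[OF s_U] no[OF s_U] in auto)
  show "connected_set adj (pruned C - {h u (other u w)})"
    by (rule halves_connected_remove[OF P, of C])
      (use U_X[OF assms(2)] no[OF assms(2)] in \<open>auto simp: pruned_def\<close>)
qed

lemma mate_pruned:
  assumes "u \<in> U - {s}" "other u w \<in> C" "C \<in> \<C>"
  shows "h u (other u w) \<in> pruned C" "adj (h u w) (h u (other u w))"
proof -
  have uU: "u \<in> U" "u \<noteq> s" using assms by auto
  have 1: "h u (other u w) \<in> halves C" by (rule halvesI) (use U_X[OF uU(1)] assms in auto)
  then show "h u (other u w) \<in> pruned C" unfolding pruned_def using h_mate_eq[OF uU(1) s_U] uU by blast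
  show "adj (h u w) (h u (other u w))" using adj_pruned[OF uU(1) assms(3) 1] by blast
qed

lemma finite_K: "finite K" unfolding K_def using finite_U by simp

lemma card_K: "card K = card U" unfolding K_def by (rule card_h_w) simp

lemma finite_pruned: "finite (\<Union>(pruned ` \<C>))"
proof (rule finite_subset[OF _ finite_halves[of UNIV]])
  show "\<Union>(pruned ` \<C>) \<subseteq> halves UNIV" unfolding pruned_def halves_def by blast
qed

text \<open>An instance of \<open>branched_clique\<close> with the pruned components as branches: a
  branch is attached to the halves at \<open>w\<close> of those chosen edges, other than
  \<open>s\<close>, that end in its component.\<close>

lemma pruned_swappable:
  assumes single: "\<And>C. C \<in> \<C> \<Longrightarrow> card {u \<in> U - {s}. other u w \<in> C} = 1 \<Longrightarrow> degree_colorable adj TYPE('c) (pruned C)"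
    and big: "3 \<le> card {u \<in> U - {s}. other u w \<in> \<Union>\<C>} \<or>
      2 \<le> card {u \<in> U - {s}. other u w \<in> \<Union>\<C>} \<and> (\<forall>C\<in>\<C>. degree_colorable adj TYPE('c) (pruned C))"
  shows "degree_swappable adj TYPE('c) (K \<union> \<Union>(pruned ` \<C>))"
  unfolding degree_swappable_def
proof (intro allI impI)
  fix M :: "'v \<Rightarrow> 'c set"
  let ?S = "K \<union> \<Union>(pruned ` \<C>)"
  assume M: "\<forall>v\<in>?S. card (nbrs ?S v) \<le> card (M v)"
  have sub: "pruned C \<subseteq> halves C" for C unfolding pruned_def by blast
  interpret bc: branched_clique adj M K "pruned ` \<C>" "h s w"
  proof unfold_locales
    show "finite K" "finite (\<Union>(pruned ` \<C>))" by (rule finite_K finite_pruned)+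
    show "adj u v" if "u \<in> K" "v \<in> K" "u \<noteq> v" for u v using clique_K that by blast
    show "4 \<le> card K" using card_K card_U by simp
    show "h s w \<in> K" unfolding K_def using s_U by blast
    show "K \<inter> \<Union>(pruned ` \<C>) = {}" using K_disjoint sub by blast
    show "connected_set adj B" if "B \<in> pruned ` \<C>" for B using pruned_remove_connected(1) s_U that by blast
    show "B \<inter> B' = {} \<and> (\<forall>a\<in>B. \<forall>b\<in>B'. \<not> adj a b)" if B: "B \<in> pruned ` \<C>" "B' \<in> pruned ` \<C>" "B \<noteq> B'" for B B'
    proof -
      obtain C D where CD: "C \<in> \<C>" "D \<in> \<C>" "B = pruned C" "B' = pruned D" "C \<noteq> D" using B by blast
      have cc: "C \<in> comps w" "D \<in> comps w" using CD C_comps by auto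
      note d = comps_disjoint[OF cc CD(5)]
      show ?thesis using halves_disjoint[OF d(1)] halves_nonadjacent[OF _ _ d] sub CD(3,4) by blast
    qed
    show "\<not> adj (h s w) t" if t: "t \<in> \<Union>(pruned ` \<C>)" for t
      using t adj_pruned[OF s_U] unfolding pruned_def by blast
    show "card {t \<in> \<Union>(pruned ` \<C>). adj v t} \<le> 1" if v: "v \<in> K" for v
    proof -
      obtain u where u: "u \<in> U" "v = h u w" using v unfolding K_def by blast
      have "{t \<in> \<Union>(pruned ` \<C>). adj v t} \<subseteq> {h u (other u w)}"
        using adj_pruned[OF u(1)] sub unfolding u(2) by blast
      then have "card {t \<in> \<Union>(pruned ` \<C>). adj v t} \<le> card {h u (other u w)}" by (rule card_mono[rotated]) simp
      then show ?thesis by simp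
    qed
    show "\<exists>v\<in>K. \<exists>t\<in>B. adj v t" if B: "B \<in> pruned ` \<C>" for B
    proof -
      obtain C where C: "C \<in> \<C>" "B = pruned C" using B by blast
      obtain u where u: "u \<in> U - {s}" "other u w \<in> C" using C_att[OF C(1)] by blast
      have "h u w \<in> K" unfolding K_def using u by blast
      then show ?thesis using mate_pruned[OF u C(1)] C(2) by blast
    qed
    show "card (nbrs ?S v) \<le> card (M v)" if "v \<in> ?S" for v using M that by blast
  qed
  have att: "bc.att (pruned C) = (\<lambda>u. h u w) ` {u \<in> U - {s}. other u w \<in> C}" if C: "C \<in> \<C>" for C
  proof
    show "bc.att (pruned C) \<subseteq> (\<lambda>u. h u w) ` {u \<in> U - {s}. other u w \<in> C}"
    proof
      fix v assume "v \<in> bc.att (pruned C)"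
      then obtain t where t: "v \<in> K" "t \<in> pruned C" "adj v t" unfolding bc.att_def by blast
      obtain u where u: "u \<in> U" "v = h u w" using t unfolding K_def by blast
      have tu: "t = h u (other u w)" "t \<in> halves C" using adj_pruned[OF u(1) C] t u sub by blast+
      have "u \<noteq> s" using tu t(2) unfolding pruned_def by blast
      moreover have "other u w \<in> C" using tu h_halves_iff U_X[OF u(1)] by blast
      ultimately show "v \<in> (\<lambda>u. h u w) ` {u \<in> U - {s}. other u w \<in> C}" using u by blast
    qed
    show "(\<lambda>u. h u w) ` {u \<in> U - {s}. other u w \<in> C} \<subseteq> bc.att (pruned C)"
    proof
      fix v assume "v \<in> (\<lambda>u. h u w) ` {u \<in> U - {s}. other u w \<in> C}"
      then obtain u where u: "u \<in> U - {s}" "other u w \<in> C" "v = h u w" by blast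
      have "v \<in> K" unfolding K_def using u by blast
      then show "v \<in> bc.att (pruned C)" unfolding bc.att_def using mate_pruned[OF u(1,2) C] u(3) by blast
    qed
  qed
  have att_all: "\<Union>(bc.att ` pruned ` \<C>) = (\<lambda>u. h u w) ` {u \<in> U - {s}. other u w \<in> \<Union>\<C>}"
    using att by auto
  show "swappable adj M ?S"
  proof (rule bc.branched_clique_swappable)
    show "bc.free B" if B: "B \<in> pruned ` \<C>" "card (bc.att B) = 1" for B
    proof -
      obtain C where C: "C \<in> \<C>" "B = pruned C" using B by blast
      have "card {u \<in> U - {s}. other u w \<in> C} = 1"
        using B(2) unfolding C(2) att[OF C(1)] by (subst (asm) card_h_w) auto
      then show ?thesis using single[OF C(1)] C(2) unfolding bc.free_def by simp
    qed
    have c: "card (\<Union>(bc.att ` pruned ` \<C>)) = card {u \<in> U - {s}. other u w \<in> \<Union>\<C>}"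
      unfolding att_all by (rule card_h_w) blast
    show "3 \<le> card (\<Union>(bc.att ` pruned ` \<C>)) \<or> 2 \<le> card (\<Union>(bc.att ` pruned ` \<C>)) \<and> (\<forall>B\<in>pruned ` \<C>. bc.free B)"
      unfolding c bc.free_def using big by simp
  qed
qed

text \<open>Star configuration around the half of \<open>p\<close> at \<open>w\<close>: the half of
  \<open>s\<close> and the mate of \<open>p\<close> are nonadjacent neighbors of it. The second edge
  \<open>q\<close> keeps \<open>C0\<close> attached when the half of \<open>p\<close> or its mate is
  taken out.\<close>

lemma pruned_extendable:
  assumes C0: "C0 \<in> \<C>" and p: "p \<in> U - {s}" "other p w \<in> C0" and q: "q \<in> U - {s}" "other q w \<in> C0" and pq: "p \<noteq> q"
  shows "degree_extendable adj TYPE('c) (K \<union> \<Union>(pruned ` \<C>))"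
proof -
  let ?S = "K \<union> \<Union>(pruned ` \<C>)" and ?t = "h p (other p w)"
  have pU: "p \<in> U" "p \<noteq> s" and qU: "q \<in> U" "q \<noteq> s" using p q by auto
  have sub: "pruned C \<subseteq> halves C" for C unfolding pruned_def by blast
  have hK: "h u w \<in> K" if "u \<in> U" for u unfolding K_def using that by blast
  have nP: "h u w \<notin> \<Union>(pruned ` \<C>)" if "u \<in> U" for u using K_disjoint hK[OF that] sub by blast
  have tP: "?t \<in> pruned C0" "adj (h p w) ?t" using mate_pruned[OF p C0] by auto
  have tK: "?t \<notin> K" using K_disjoint[OF C0] tP(1) sub by blast
  have connK: "connected_set adj A" if "A \<subseteq> K" for A
    by (rule connected_set_clique) (use clique_K that in blast)
  have attach: "\<exists>u\<in>U - {s, p}. other u w \<in> C" if C: "C \<in> \<C>" for C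
  proof (cases "C = C0")
    case True
    then show ?thesis using q pq by blast
  next
    case False
    obtain u where u: "u \<in> U - {s}" "other u w \<in> C" using C_att[OF C] by blast
    have "u \<noteq> p" using u(2) p(2) comps_eq[of C w C0 "other p w"] C C0 C_comps False by blast
    then show ?thesis using u by blast
  qed
  have ne: "h u (other u w) \<noteq> ?t" if "u \<in> U" "u \<noteq> p" for u using h_mate_eq[OF that(1) pU(1)] that(2) by blast
  show ?thesis
  proof (rule degree_extendable_star[where p = "h p w" and b = "h s w" and t = ?t])
    show "finite ?S" using finite_K finite_pruned by blast
    show "h p w \<in> ?S" "h s w \<in> ?S" using hK pU s_U by auto
    show "?t \<in> ?S" using tP C0 by blast
    show "adj (h p w) (h s w)" using clique_K[OF hK hK] h_w_eq pU s_U by blast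
    show "adj (h p w) ?t" by (rule tP(2))
    show "\<not> adj (h s w) ?t" using adj_pruned[OF s_U C0, of ?t] ne[OF s_U] pU(2) subsetD[OF sub tP(1)] by auto
    show "h s w \<noteq> ?t" using tK hK[OF s_U] by auto
    have e1: "?S - {h p w} = (K - {h p w}) \<union> \<Union>(pruned ` \<C>)" using nP[OF pU(1)] by blast
    show "connected_set adj (?S - {h p w})"
      unfolding e1
    proof (rule connected_set_Union)
      show "connected_set adj (K - {h p w})" by (rule connK) blast
      fix B assume "B \<in> pruned ` \<C>"
      then obtain C where C: "C \<in> \<C>" "B = pruned C" by blast
      obtain u where u: "u \<in> U - {s, p}" "other u w \<in> C" using attach[OF C(1)] by blast
      have uu: "u \<in> U - {s}" "u \<in> U" "u \<noteq> p" using u(1) by auto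
      have "h u w \<in> K - {h p w}" using hK[OF uu(2)] h_w_eq[OF uu(2) pU(1)] uu(3) by blast
      then show "connected_set adj B \<and> (\<exists>a\<in>K - {h p w}. \<exists>b\<in>B. adj a b)"
        using pruned_remove_connected(1)[OF C(1) s_U] mate_pruned[OF uu(1) u(2) C(1)] C(2) by blast
    qed
    have e2: "?S - {h s w, ?t} = (K - {h s w}) \<union> \<Union>((\<lambda>C. pruned C - {?t}) ` \<C>)"
      using nP[OF s_U] tK by blast
    show "connected_set adj (?S - {h s w, ?t})"
      unfolding e2
    proof (rule connected_set_Union)
      show "connected_set adj (K - {h s w})" by (rule connK) blast
      fix B assume "B \<in> (\<lambda>C. pruned C - {?t}) ` \<C>"
      then obtain C where C: "C \<in> \<C>" "B = pruned C - {?t}" by blast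
      obtain u where u: "u \<in> U - {s, p}" "other u w \<in> C" using attach[OF C(1)] by blast
      have uu: "u \<in> U - {s}" "u \<in> U" "u \<noteq> p" "u \<noteq> s" using u(1) by auto
      have "h u w \<in> K - {h s w}" using hK[OF uu(2)] h_w_eq[OF uu(2) s_U] uu(4) by blast
      moreover have "h u (other u w) \<in> B" using mate_pruned(1)[OF uu(1) u(2) C(1)] ne[OF uu(2,3)] C(2) by blast
      ultimately show "connected_set adj B \<and> (\<exists>a\<in>K - {h s w}. \<exists>b\<in>B. adj a b)"
        using pruned_remove_connected(2)[OF C(1) pU(1)] mate_pruned(2)[OF uu(1) u(2) C(1)] C(2) by blast
    qed
    have "K - {h p w} \<subseteq> nbrs ?S (h p w)" using clique_K hK[OF pU(1)] by blast
    moreover have "finite (nbrs ?S (h p w))" by (rule finite_subset[OF _ finite_UnI[OF finite_K finite_pruned]]) blast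
    ultimately have "card (K - {h p w}) \<le> card (nbrs ?S (h p w))" by (intro card_mono)
    then show "3 \<le> card (nbrs ?S (h p w))" using card_K card_U finite_K hK[OF pU(1)] by simp
  qed
qed

lemma pruned_nonempty: "K \<union> \<Union>(pruned ` \<C>) \<noteq> {}"
  unfolding K_def using s_U by blast

lemma pruned_subset: "K \<union> \<Union>(pruned ` \<C>) \<subseteq> halves (W X)"
proof -
  have "K \<subseteq> halves (W X)" unfolding K_def using U_X N_subset_W halvesI by blast
  moreover have "pruned C \<subseteq> halves (W X)" if "C \<in> \<C>" for C
    using halves_mono[of C "W X"] comps(1)[of C w] C_comps that unfolding pruned_def by blast
  ultimately show ?thesis by blast
qed

end

context half_edges
begin

definition reducible :: "'c itself \<Rightarrow> bool" where
  "reducible _ \<longleftrightarrow> (\<exists>S. S \<noteq> {} \<and> S \<subseteq> halves (W X) \<and>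
     degree_swappable adj TYPE('c) S \<and> degree_extendable adj TYPE('c) S)"

lemma halves_pruned:
  assumes "u \<in> X" "w \<in> N u" "other u w \<notin> C"
  shows "halves C - {h u (other u w)} = halves C"
  using h_halves_iff[of u "other u w" C] other(3)[of u w] assms by blast

text \<open>Translates the requirements into edge counts: a component with as many inner edges as
  vertices is degree-choosable as long as \<open>s\<close> does not prune it, and \<open>C0\<close>
  with two chosen edges gives extendability.\<close>

lemma reducible_star:
  assumes star: "\<C> \<subseteq> comps w" "U \<subseteq> star w" "s \<in> U" "4 \<le> card U"
      "\<And>C. C \<in> \<C> \<Longrightarrow> \<exists>u\<in>U - {s}. other u w \<in> C"
    and single: "\<And>C. C \<in> \<C> \<Longrightarrow> card {u \<in> U - {s}. other u w \<in> C} = 1 \<Longrightarrow> other s w \<notin> C \<and> card C \<le> card (inner_edges C)"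
    and big: "3 \<le> card {u \<in> U - {s}. other u w \<in> \<Union>\<C>} \<or>
      2 \<le> card {u \<in> U - {s}. other u w \<in> \<Union>\<C>} \<and> (\<forall>C\<in>\<C>. other s w \<notin> C \<and> card C \<le> card (inner_edges C))"
    and C0: "C0 \<in> \<C>" "2 \<le> card {u \<in> U - {s}. other u w \<in> C0}"
  shows "reducible TYPE('c)"
proof -
  interpret pruned_star adj X N h w \<C> U s
    by unfold_locales (use star in auto)
  have free: "degree_colorable adj TYPE('c) (pruned C)" if C: "C \<in> \<C>" "other s w \<notin> C \<and> card C \<le> card (inner_edges C)" for C
  proof -
    have cc: "C \<in> comps w" using C star(1) by blast
    have "degree_colorable adj TYPE('c) (halves C)"
      by (rule halves_degree_colorable) (use comps[OF cc] C(2) in auto)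
    moreover have "pruned C = halves C" unfolding pruned_def by (rule halves_pruned) (use U_X[OF s_U] C(2) in auto)
    ultimately show ?thesis by simp
  qed
  have sw: "degree_swappable adj TYPE('c) (K \<union> \<Union>(pruned ` \<C>))"
    by (rule pruned_swappable) (use single big free in blast)+
  obtain A where A: "A \<subseteq> {u \<in> U - {s}. other u w \<in> C0}" "card A = 2"
    by (rule obtain_subset_with_card_n[OF C0(2)])
  then obtain p q where pq: "A = {p, q}" "p \<noteq> q" by (auto simp: card_2_iff)
  have "degree_extendable adj TYPE('c) (K \<union> \<Union>(pruned ` \<C>))"
    by (rule pruned_extendable[OF C0(1), of p q]) (use A(1) pq in auto)
  then show ?thesis unfolding reducible_def
    by (intro exI[of _ "K \<union> \<Union>(pruned ` \<C>)"] conjI pruned_nonempty pruned_subset sw)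
qed

end

section \<open>Minimal multigraphs of density above 3/2\<close>

locale critical_half_edges = half_edges adj X N h
  for adj :: "'v \<Rightarrow> 'v \<Rightarrow> bool" and X :: "'a set" and N :: "'a \<Rightarrow> 'b set" and h +
  assumes dense: "3 * card (W X) < 2 * card X"
    and critical: "\<And>Z. Z \<subset> X \<Longrightarrow> 2 * card Z \<le> 3 * card (W Z)"
begin

text \<open>Deleting \<open>C\<close> with all edges at it leaves a proper subset of
  \<open>X\<close>, which is not dense; its inequality is subtracted from \<open>dense\<close>, and
  strictness contributes the \<open>1\<close>.\<close>

lemma comp_count:
  assumes C: "C \<in> comps w"
  shows "3 * card C + 1 \<le> 2 * card (inner_edges C) + 2 * card (att w C)"
proof -
  let ?R = "inner_edges C \<union> att w C"
  have RX: "?R \<subseteq> X" unfolding inner_edges_def att_def star_def by blast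
  have finR: "finite ?R" using finite_inner finite_att by blast
  have cR: "card ?R = card (inner_edges C) + card (att w C)"
    by (rule card_Un_disjoint[OF finite_inner finite_att inner_att_disjoint[OF C]])
  have WR: "W (X - ?R) \<subseteq> W X - C"
  proof
    fix y assume "y \<in> W (X - ?R)"
    then obtain u where u: "u \<in> X" "u \<notin> ?R" "y \<in> N u" unfolding W_def by blast
    then show "y \<in> W X - C" using edge_at_comp[OF C u(1,3)] N_subset_W[OF u(1)] by blast
  qed
  have finW: "finite (W X)" by (rule finite_W[OF subset_refl])
  have "?R \<noteq> {}"
  proof -
    obtain y where y: "y \<in> C" using comps(2)[OF C] by blast
    then have "y \<in> W X" using comps(1)[OF C] by blast
    then obtain u where "u \<in> X" "y \<in> N u" unfolding W_def by blast
    then show ?thesis using edge_at_comp[OF C _ _ y] by blast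
  qed
  then have "X - ?R \<subset> X" using RX by blast
  then have "2 * card (X - ?R) \<le> 3 * card (W (X - ?R))" by (rule critical)
  moreover have "card (W (X - ?R)) \<le> card (W X - C)" using finW by (intro card_mono WR) simp
  moreover have "card (W X - C) = card (W X) - card C" "card C \<le> card (W X)"
    using comps(1,4)[OF C] finW by (auto intro!: card_Diff_subset card_mono)
  moreover have "card (X - ?R) = card X - card ?R" "card ?R \<le> card X"
    using finR RX finite_X by (auto intro!: card_Diff_subset card_mono)
  ultimately show ?thesis using dense cR by linarith
qed

text \<open>Without an edge to \<open>w\<close>, the inner edges of \<open>C\<close> would be dense
  by \<open>comp_count\<close>, although they form a proper subset of \<open>X\<close>.\<close>

lemma att_nonempty:
  assumes w: "w \<in> W X" and C: "C \<in> comps w"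
  shows "1 \<le> card (att w C)"
proof (rule ccontr)
  assume "\<not> ?thesis"
  then have 0: "card (att w C) = 0" by simp
  obtain u where u: "u \<in> X" "w \<in> N u" using w unfolding W_def by blast
  have "u \<notin> inner_edges C" using u comps(5)[OF C] unfolding inner_edges_def by blast
  then have "inner_edges C \<subset> X" using u unfolding inner_edges_def by blast
  then have "2 * card (inner_edges C) \<le> 3 * card (W (inner_edges C))" by (rule critical)
  moreover have "card (W (inner_edges C)) \<le> card C"
    by (rule card_mono[OF comps(4)[OF C]]) (auto simp: W_def inner_edges_def)
  ultimately show False using comp_count[OF C] 0 by linarith
qed

text \<open>With one attaching edge, \<open>comp_count\<close> reads
  \<open>3 * card C \<le> 2 * card (inner_edges C) + 1\<close>.\<close>

lemma single_free:
  assumes "C \<in> comps w" "card (att w C) = 1"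
  shows "card C \<le> card (inner_edges C)"
proof -
  have "1 \<le> card C" using comps(2,4)[OF assms(1)] by (simp add: Suc_le_eq card_gt_0_iff)
  then show ?thesis using comp_count[OF assms(1)] assms(2) by linarith
qed

text \<open>The average degree \<open>2 * card X / card (W X)\<close> exceeds 3.\<close>

lemma exists_branching: "\<exists>w\<in>W X. 4 \<le> card (star w)"
proof (rule ccontr)
  assume "\<not> ?thesis"
  then have le: "card (star y) \<le> 3" if "y \<in> W X" for y using that by fastforce
  have "(\<Sum>y\<in>W X. card (star y)) \<le> 3 * card (W X)"
    using sum_mono[of "W X" "\<lambda>y. card (star y)" "\<lambda>_. 3"] le by simp
  then show False using sum_degrees_W[OF subset_refl] dense unfolding star_def by simp
qed

text \<open>Otherwise, with \<open>n = card C + card D\<close>, there are at most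
  \<open>n - 2 + 4\<close> edges and at least \<open>n + 1\<close> vertices, and
  \<open>dense\<close> would give \<open>n < 1\<close>.\<close>

lemma two_comps_free:
  assumes w: "w \<in> W X" and C: "C \<in> comps w" and D: "D \<in> comps w" "C \<noteq> D"
    and n: "card (att w C) = 2" "card (att w D) = 2" and s: "star w = att w C \<union> att w D"
  shows "card C \<le> card (inner_edges C) \<or> card D \<le> card (inner_edges D)"
proof (rule ccontr)
  assume c: "\<not> ?thesis"
  have cs: "comps w \<subseteq> {C, D}"
  proof
    fix B assume B: "B \<in> comps w"
    have "att w B \<noteq> {}" using att_nonempty[OF w B] by auto
    then obtain u where u: "u \<in> att w B" by blast
    then have "u \<in> att w C \<or> u \<in> att w D" using att_subset s by blast
    then show "B \<in> {C, D}" using u att_disjoint[OF B C] att_disjoint[OF B D(1)] by blast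
  qed
  have W: "W X \<subseteq> insert w (C \<union> D)"
  proof
    fix y assume y: "y \<in> W X"
    show "y \<in> insert w (C \<union> D)"
    proof (cases "y = w")
      case False
      then obtain B where "B \<in> comps w" "y \<in> B" using comps_cover[of y w] y by blast
      then show ?thesis using cs by blast
    qed simp
  qed
  have X: "X \<subseteq> inner_edges C \<union> inner_edges D \<union> star w"
  proof
    fix u assume u: "u \<in> X"
    show "u \<in> inner_edges C \<union> inner_edges D \<union> star w"
    proof (cases "w \<in> N u")
      case True
      then show ?thesis using u unfolding star_def by blast
    next
      case False
      have "N u \<noteq> {}" using card_N[OF u] by auto
      then obtain y where y: "y \<in> N u" by blast
      then have "y \<in> W X - {w}" using N_subset_W[OF u] False by blast
      then obtain B where B: "B \<in> comps w" "y \<in> B" using comps_cover by blast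
      have "u \<in> inner_edges B" using edge_at_comp[OF B(1) u y B(2)] False unfolding att_def star_def by blast
      then show ?thesis using cs B(1) by blast
    qed
  qed
  have finW: "finite (insert w (C \<union> D))" using comps(4) C D by simp
  have "card X \<le> card (inner_edges C \<union> inner_edges D \<union> star w)"
    by (rule card_mono[OF _ X]) (use finite_inner finite_star in simp)
  also have "\<dots> \<le> card (inner_edges C) + card (inner_edges D) + card (star w)"
    using card_Un_le[of "inner_edges C \<union> inner_edges D" "star w"] card_Un_le[of "inner_edges C" "inner_edges D"] by linarith
  finally have X': "card X \<le> card (inner_edges C) + card (inner_edges D) + card (star w)" .
  have s4: "card (star w) \<le> 4" using card_Un_le[of "att w C" "att w D"] n s by simp
  have wCD: "insert w (C \<union> D) \<subseteq> W X" using w comps(1)[OF C] comps(1)[OF D(1)] by blast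
  have "card (insert w (C \<union> D)) = 1 + card C + card D"
    using comps(4,5)[OF C] comps(4,5)[OF D(1)] comps_disjoint(1)[OF C D] by (simp add: card_Un_disjoint)
  then have W': "1 + card C + card D \<le> card (W X)"
    using card_mono[OF finite_W[OF subset_refl] wCD] by linarith
  have "1 \<le> card C" "1 \<le> card D" using comps(2,4)[OF C] comps(2,4)[OF D(1)] by (simp_all add: Suc_le_eq card_gt_0_iff)
  then show False using X' s4 W' dense c by linarith
qed

text \<open>A component with three edges to \<open>w\<close> suffices together with any further edge
  as \<open>s\<close>. One with exactly two must have enough inner edges, or be helped by a second
  component \<open>D\<close> while \<open>s\<close> avoids both. Such an \<open>s\<close> is missing
  only for degree 4 split as 2 + 2, and there \<open>two_comps_free\<close> makes \<open>D\<close>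
  suffice.\<close>

lemma reducible_multi:
  assumes w: "w \<in> W X" and s4: "4 \<le> card (star w)" and C: "C \<in> comps w" and n: "2 \<le> card (att w C)"
  shows "reducible TYPE('c)"
proof -
  have three: "reducible TYPE('c)" if D: "D \<in> comps w" "3 \<le> card (att w D)" for D
  proof -
    obtain A where A: "A \<subseteq> att w D" "card A = 3" "finite A" by (rule obtain_subset_with_card_n[OF D(2)])
    have "\<not> star w \<subseteq> A" using card_mono[OF A(3), of "star w"] A(2) s4 by linarith
    then obtain s where s: "s \<in> star w" "s \<notin> A" by blast
    have e: "{u \<in> insert s A - {s}. other u w \<in> D} = A" using A(1) s(2) unfolding att_def by blast
    show ?thesis
    proof (rule reducible_star[where \<C> = "{D}" and U = "insert s A" and s = s and w = w and ?C0.0 = D])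
      show "insert s A \<subseteq> star w" using s A(1) att_subset by blast
      show "4 \<le> card (insert s A)" using A s by simp
      have "A \<noteq> {}" using A(2) by auto
      then show "\<exists>u\<in>insert s A - {s}. other u w \<in> C'" if "C' \<in> {D}" for C' using that e by blast
      show "3 \<le> card {u \<in> insert s A - {s}. other u w \<in> \<Union>{D}} \<or> 2 \<le> card {u \<in> insert s A - {s}. other u w \<in> \<Union>{D}} \<and>
         (\<forall>C\<in>{D}. other s w \<notin> C \<and> card C \<le> card (inner_edges C))" using e A(2) by simp
      show "other s w \<notin> C' \<and> card C' \<le> card (inner_edges C')"
        if "C' \<in> {D}" "card {u \<in> insert s A - {s}. other u w \<in> C'} = 1" for C' using that e A(2) by simp
      show "2 \<le> card {u \<in> insert s A - {s}. other u w \<in> D}" unfolding e using A(2) by simp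
    qed (use D in auto)
  qed
  have free: "reducible TYPE('c)" if D: "D \<in> comps w" "card (att w D) = 2" "card D \<le> card (inner_edges D)" for D
  proof -
    have "card (star w - att w D) = card (star w) - card (att w D)"
      by (rule card_Diff_subset[OF finite_att att_subset])
    then have "2 \<le> card (star w - att w D)" using s4 D(2) by linarith
    then obtain A where A: "A \<subseteq> star w - att w D" "card A = 2" "finite A" by (rule obtain_subset_with_card_n)
    then obtain s r where sr: "A = {s, r}" "s \<noteq> r" by (auto simp: card_2_iff)
    let ?U = "att w D \<union> A"
    have s: "s \<in> star w" "s \<notin> att w D" "r \<in> star w" "r \<notin> att w D" using A(1) sr(1) by auto
    have sD: "other s w \<notin> D" "other r w \<notin> D" using s unfolding att_def by auto
    have e: "{u \<in> ?U - {s}. other u w \<in> D} = att w D" using sr(1) sD s unfolding att_def by blast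
    have cU: "card ?U = 4" using card_Un_disjoint[OF finite_att A(3), of w D] A(1,2) D(2) by auto
    show ?thesis
    proof (rule reducible_star[where \<C> = "{D}" and U = ?U and s = s and w = w and ?C0.0 = D])
      show "?U \<subseteq> star w" using A(1) att_subset by blast
      show "4 \<le> card ?U" using cU by simp
      have "att w D \<noteq> {}" using D(2) by auto
      then show "\<exists>u\<in>?U - {s}. other u w \<in> C'" if "C' \<in> {D}" for C' using that e by blast
      show "3 \<le> card {u \<in> ?U - {s}. other u w \<in> \<Union>{D}} \<or> 2 \<le> card {u \<in> ?U - {s}. other u w \<in> \<Union>{D}} \<and>
         (\<forall>C\<in>{D}. other s w \<notin> C \<and> card C \<le> card (inner_edges C))" using e D sD by simp
      show "other s w \<notin> C' \<and> card C' \<le> card (inner_edges C')"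
        if "C' \<in> {D}" "card {u \<in> ?U - {s}. other u w \<in> C'} = 1" for C' using that sD D(3) by blast
      show "2 \<le> card {u \<in> ?U - {s}. other u w \<in> D}" unfolding e using D(2) by simp
      show "s \<in> ?U" using sr(1) by blast
    qed (use D in auto)
  qed
  show ?thesis
  proof (cases "3 \<le> card (att w C) \<or> card C \<le> card (inner_edges C)")
    case True
    then show ?thesis using three[OF C] free[OF C] n by linarith
  next
    case False
    then have n2: "card (att w C) = 2" and nf: "\<not> card C \<le> card (inner_edges C)" using n by auto
    have "\<not> star w \<subseteq> att w C" using card_mono[OF finite_att, of "star w" w C] n2 s4 by linarith
    then obtain r where r: "r \<in> star w" "r \<notin> att w C" by blast
    obtain D where D: "D \<in> comps w" "r \<in> att w D" using att_cover[OF r(1)] by blast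
    have CD: "C \<noteq> D" using r D by blast
    have disj: "att w C \<inter> att w D = {}" by (rule att_disjoint[OF C D(1) CD])
    have nD: "1 \<le> card (att w D)" by (rule att_nonempty[OF w D(1)])
    have pair: "reducible TYPE('c)"
      if A: "A \<subseteq> att w D" "A \<noteq> {}" and single: "card A = 1 \<Longrightarrow> A = att w D" and s: "s \<in> star w" "s \<notin> att w C \<union> A" for A s
    proof -
      let ?U = "insert s (att w C \<union> A)"
      have finA: "finite A" by (rule finite_subset[OF A(1) finite_att])
      have A1: "1 \<le> card A" using A(2) finA by (simp add: Suc_le_eq card_gt_0_iff)
      have cA: "card (att w C \<union> A) = 2 + card A"
        using card_Un_disjoint[OF finite_att finA, of w C] disj A(1) n2 by fastforce
      have Cu: "other u w \<in> C" if "u \<in> att w C" for u using that unfolding att_def by blast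
      have Du: "other u w \<in> D" if "u \<in> att w D" for u using that unfolding att_def by blast
      have CDd: "C \<inter> D = {}" by (rule comps_disjoint(1)[OF C D(1) CD])
      have Us: "?U - {s} = att w C \<union> A" using s by blast
      have eC: "{u \<in> ?U - {s}. other u w \<in> C} = att w C" unfolding Us using Cu Du A(1) CDd by blast
      have eD: "{u \<in> ?U - {s}. other u w \<in> D} = A" unfolding Us using Cu Du A(1) CDd by blast
      have eU: "{u \<in> ?U - {s}. other u w \<in> \<Union>{C, D}} = att w C \<union> A" unfolding Us using Cu Du A(1) by blast
      show ?thesis
      proof (rule reducible_star[where \<C> = "{C, D}" and U = ?U and s = s and w = w and ?C0.0 = C])
        show "?U \<subseteq> star w" using s A(1) att_subset by blast
        show "4 \<le> card ?U" using cA A1 s(2) finA finite_att by simp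
        show "{C, D} \<subseteq> comps w" using C D(1) by blast
        show "\<exists>u\<in>?U - {s}. other u w \<in> C'" if C': "C' \<in> {C, D}" for C'
        proof -
          have "att w C \<noteq> {}" using n2 by auto
          then obtain u v where "u \<in> {u \<in> ?U - {s}. other u w \<in> C}" "v \<in> {u \<in> ?U - {s}. other u w \<in> D}"
            using A(2) unfolding eC eD by blast
          then show ?thesis using C'(1) by blast
        qed
        show "3 \<le> card {u \<in> ?U - {s}. other u w \<in> \<Union>{C, D}} \<or> 2 \<le> card {u \<in> ?U - {s}. other u w \<in> \<Union>{C, D}} \<and>
           (\<forall>C\<in>{C, D}. other s w \<notin> C \<and> card C \<le> card (inner_edges C))" unfolding eU using cA A1 by simp
        show "other s w \<notin> C' \<and> card C' \<le> card (inner_edges C')"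
          if C': "C' \<in> {C, D}" "card {u \<in> ?U - {s}. other u w \<in> C'} = 1" for C'
        proof -
          have "C' \<noteq> C"
          proof
            assume "C' = C"
            then show False using C'(2) eC n2 by (simp only:)
          qed
          then have CD': "C' = D" using C'(1) by blast
          then have "card A = 1" using C'(2) eD by simp
          then have AD: "A = att w D" "card (att w D) = 1" using single by auto
          then have "other s w \<notin> D" using s unfolding att_def by blast
          then show ?thesis using single_free[OF D(1) AD(2)] CD' by blast
        qed
        show "2 \<le> card {u \<in> ?U - {s}. other u w \<in> C}" unfolding eC using n2 by simp
      qed auto
    qed
    consider "3 \<le> card (att w D)" | "card (att w D) = 1" | "card (att w D) = 2" using nD by linarith
    then show ?thesis
    proof cases
      case 1
      then show ?thesis by (rule three[OF D(1)])
    next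
      case 2
      have "card (att w C \<union> att w D) = 3" using card_Un_disjoint[OF finite_att finite_att disj] n2 2 by simp
      then have "\<not> star w \<subseteq> att w C \<union> att w D"
        using card_mono[of "att w C \<union> att w D" "star w"] finite_att s4 by fastforce
      then obtain s where "s \<in> star w" "s \<notin> att w C \<union> att w D" by blast
      then show ?thesis using D(2) by (intro pair[of "att w D" s]) auto
    next
      case 3
      show ?thesis
      proof (cases "star w = att w C \<union> att w D")
        case True
        then have "card D \<le> card (inner_edges D)" using two_comps_free[OF w C D(1) CD n2 3] nf by blast
        then show ?thesis by (rule free[OF D(1) 3])
      next
        case False
        then obtain s where "s \<in> star w" "s \<notin> att w C \<union> att w D" using att_subset by blast
        then show ?thesis using D(2) 3 by (intro pair[of "att w D" s]) auto
      qed
    qed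
  qed
qed

text \<open>A vertex \<open>z\<close> that is neither a cut vertex nor the attachment has three
  inner edges \<open>a\<close>, \<open>b\<close>, \<open>c\<close>, whose halves at \<open>z\<close>
  form a triangle. The half of \<open>a\<close> is the center of a star configuration with the half
  of \<open>b\<close> and the mate of \<open>a\<close>; the half of \<open>c\<close> keeps the
  remainder connected.\<close>

lemma cubic_extendable:
  assumes w: "w \<in> W X" and C: "C \<in> comps w" and n: "card (att w C) = 1"
    and cubic: "\<And>y. y \<in> C \<Longrightarrow> card (star y) = 3"
  shows "degree_extendable adj TYPE('c) (halves C)"
proof -
  obtain u0 where u0: "att w C = {u0}" using n by (auto simp: card_1_singleton_iff)
  let ?y = "other u0 w"
  have u0': "u0 \<in> star w" "?y \<in> C" using u0 unfolding att_def by auto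
  have innerI: "u \<in> inner_edges C" if "u \<in> star y" "y \<in> C" "u \<noteq> u0" for u y
    using edge_at_comp[OF C _ _ that(2)] starD[OF that(1)] u0 that(3) by blast
  have "C \<noteq> {?y}"
  proof
    assume eq: "C = {?y}"
    have "\<not> star ?y \<subseteq> {u0}" using card_mono[of "{u0}" "star ?y"] cubic[OF u0'(2)] by fastforce
    then obtain u where u: "u \<in> star ?y" "u \<noteq> u0" by blast
    have "N u \<subseteq> {?y}" using innerI[OF u(1) u0'(2) u(2)] eq unfolding inner_edges_def by blast
    then have "card (N u) \<le> card {?y}" by (intro card_mono) auto
    then show False using card_N starD[OF u(1)] by fastforce
  qed
  then obtain z where z: "z \<in> C" "z \<noteq> ?y" "connected_set link (C - {z})"
    using mg.connected_set_remove_noncut[OF comps(4,3)[OF C] u0'(2)] by blast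
  obtain a b c where abc: "star z = {a, b, c}" "a \<noteq> b" "a \<noteq> c" "b \<noteq> c"
    using cubic[OF z(1)] by (auto simp: card_3_iff)
  have zw: "z \<noteq> w" using z(1) comps(5)[OF C] by blast
  have no0: "u0 \<notin> star z"
  proof
    assume "u0 \<in> star z"
    then have "z = ?y" using other_unique[of u0 w z] starD[of u0 z] starD[OF u0'(1)] zw by blast
    then show False using z(2) by blast
  qed
  have st: "u \<in> X" "z \<in> N u" "other u z \<in> N u" "other u z \<in> C - {z}" if u: "u \<in> star z" for u
  proof -
    show 1: "u \<in> X" "z \<in> N u" using starD[OF u] by auto
    show 2: "other u z \<in> N u" using other(3)[OF 1] .
    have "u \<noteq> u0" using no0 u by blast
    then have "N u \<subseteq> C" using innerI[OF u z(1)] unfolding inner_edges_def by blast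
    then have "other u z \<in> C" by (rule subsetD[OF _ 2])
    then show "other u z \<in> C - {z}" using other(2)[OF 1] by simp
  qed
  have abc': "a \<in> star z" "b \<in> star z" "c \<in> star z" using abc(1) by auto
  let ?H = "halves (C - {z})" and ?t = "h a (other a z)"
  have mH: "h u (other u z) \<in> ?H" "adj (h u z) (h u (other u z))" if u: "u \<in> star z" for u
  proof -
    show 1: "h u (other u z) \<in> ?H" by (rule halvesI) (use st[OF u] in auto)
    show "adj (h u z) (h u (other u z))" using adj_halves[OF st(1,2)[OF u] 1] by blast
  qed
  have zH: "h u z \<notin> ?H" if u: "u \<in> star z" for u by (simp add: h_halves_iff[OF st(1,2)[OF u]])
  have heq: "h u z = h v z \<longleftrightarrow> u = v" if "u \<in> star z" "v \<in> star z" for u v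
    by (simp add: h_eq[OF st(1)[OF that(1)] st(1)[OF that(2)] st(2)[OF that(1)] st(2)[OF that(2)]])
  have hadj: "adj (h u z) (h v z)" if "u \<in> star z" "v \<in> star z" "u \<noteq> v" for u v
    by (simp add: adj_h[OF st(1)[OF that(1)] st(1)[OF that(2)] st(2)[OF that(1)] st(2)[OF that(2)]] that(3))
  have meq: "h u (other u z) \<noteq> ?t" if "u \<in> star z" "u \<noteq> a" for u
    by (simp add: h_eq[OF st(1)[OF that(1)] st(1)[OF abc'(1)] st(3)[OF that(1)] st(3)[OF abc'(1)]] that(2))
  have split: "halves C = ?H \<union> {h a z, h b z, h c z}"
  proof
    show "halves C \<subseteq> ?H \<union> {h a z, h b z, h c z}"
    proof
      fix t assume "t \<in> halves C"
      then obtain u y where t: "t = h u y" "u \<in> X" "y \<in> N u" "y \<in> C" by (rule halvesE)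
      show "t \<in> ?H \<union> {h a z, h b z, h c z}"
      proof (cases "y = z")
        case True
        then have "u \<in> star z" using t unfolding star_def by blast
        then show ?thesis using abc(1) t True by auto
      next
        case False
        then show ?thesis using t halvesI[of u y "C - {z}"] by blast
      qed
    qed
    show "?H \<union> {h a z, h b z, h c z} \<subseteq> halves C"
      using halves_mono[of "C - {z}" C] halvesI[OF st(1,2) z(1)] abc' by blast
  qed
  have CW: "C - {z} \<subseteq> W X" using comps(1)[OF C] by blast
  have connH: "connected_set adj ?H" by (rule halves_connected[OF z(3) CW])
  have connHt: "connected_set adj (?H - {?t})"
  proof (rule halves_connected_remove[OF connH subset_refl])
    show "a \<in> X" "other a z \<in> N a" using st[OF abc'(1)] by auto
    show "h a (other a (other a z)) \<notin> ?H" using other_other[OF st(1,2)[OF abc'(1)]] zH[OF abc'(1)] by simp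
  qed
  have tne: "?t \<noteq> h u z" if "u \<in> star z" for u using mH(1)[OF abc'(1)] zH[OF that] by metis
  show ?thesis
  proof (rule degree_extendable_star[where p = "h a z" and b = "h b z" and t = ?t])
    show "finite (halves C)" by (rule finite_halves)
    show "h a z \<in> halves C" "h b z \<in> halves C" "?t \<in> halves C" unfolding split using mH(1)[OF abc'(1)] by auto
    show "adj (h a z) (h b z)" by (rule hadj[OF abc'(1,2) abc(2)])
    show "adj (h a z) ?t" by (rule mH(2)[OF abc'(1)])
    show "\<not> adj (h b z) ?t"
      using adj_halves[OF st(1,2)[OF abc'(2)] mH(1)[OF abc'(1)]] meq[OF abc'(2)] abc(2) by auto
    show "h b z \<noteq> ?t" using tne[OF abc'(2)] by simp
    have e1: "halves C - {h a z} = ?H \<union> \<Union>{{h b z, h c z}}"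
      unfolding split using zH[OF abc'(1)] heq[OF abc'(1,2)] heq[OF abc'(1,3)] abc(2,3) by auto
    show "connected_set adj (halves C - {h a z})"
      unfolding e1
    proof (rule connected_set_Union[OF connH])
      fix B assume B: "B \<in> {{h b z, h c z}}"
      have "connected_set adj {h b z, h c z}"
        by (rule connected_set_clique) (use hadj[OF abc'(2,3) abc(4)] adj_sym in auto)
      then show "connected_set adj B \<and> (\<exists>a\<in>?H. \<exists>b\<in>B. adj a b)"
        using B mH[OF abc'(2)] adj_sym by blast
    qed
    have e2: "halves C - {h b z, ?t} = (?H - {?t}) \<union> \<Union>{{h a z, h c z}}"
      unfolding split using zH[OF abc'(2)] heq[OF abc'(2,1)] heq[OF abc'(2,3)] abc(2,4) tne[OF abc'(1)] tne[OF abc'(3)] by auto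
    show "connected_set adj (halves C - {h b z, ?t})"
      unfolding e2
    proof (rule connected_set_Union[OF connHt])
      fix B assume B: "B \<in> {{h a z, h c z}}"
      have 1: "connected_set adj {h a z, h c z}"
        by (rule connected_set_clique) (use hadj[OF abc'(1,3) abc(3)] adj_sym in auto)
      have "h c (other c z) \<in> ?H - {?t}" using mH(1)[OF abc'(3)] meq[OF abc'(3)] abc(3) by auto
      then show "connected_set adj B \<and> (\<exists>a\<in>?H - {?t}. \<exists>b\<in>B. adj a b)"
        using B 1 mH(2)[OF abc'(3)] adj_sym by blast
    qed
    have "{h b z, h c z, ?t} \<subseteq> nbrs (halves C) (h a z)"
      unfolding split using hadj[OF abc'(1,2) abc(2)] hadj[OF abc'(1,3) abc(3)] mH[OF abc'(1)] by auto
    then have "card {h b z, h c z, ?t} \<le> card (nbrs (halves C) (h a z))" using finite_halves by (intro card_mono) auto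
    moreover have "card {h b z, h c z, ?t} = 3"
      using heq[OF abc'(2,3)] abc(4) tne[OF abc'(2)] tne[OF abc'(3)] by auto
    ultimately show "3 \<le> card (nbrs (halves C) (h a z))" by simp
  qed
qed

text \<open>No component offers the two edges that \<open>pruned_extendable\<close> asks for.
  Choosing a largest component \<open>B\<close> over all branching vertices, with \<open>s\<close>
  its edge, makes the other components at \<open>w\<close> cubic; these are extendable by themselves
  and are colored after the clique.\<close>

lemma reducible_single:
  assumes all: "\<And>w C. w \<in> W X \<Longrightarrow> 4 \<le> card (star w) \<Longrightarrow> C \<in> comps w \<Longrightarrow> card (att w C) = 1"
  shows "reducible TYPE('c)"
proof -
  let ?P = "\<lambda>(w, B). w \<in> W X \<and> 4 \<le> card (star w) \<and> B \<in> comps w"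
  have finW: "finite (W X)" by (rule finite_W[OF subset_refl])
  obtain w0 where w0: "w0 \<in> W X" "4 \<le> card (star w0)" using exists_branching by blast
  then have "star w0 \<noteq> {}" by auto
  then obtain B0 where "B0 \<in> comps w0" using att_cover by blast
  then have P0: "?P (w0, B0)" using w0 by simp
  have "card (snd x) < Suc (card (W X))" if "?P x" for x
  proof -
    have "snd x \<subseteq> W X" using that comps(1)[of "snd x" "fst x"] by (auto simp: case_prod_beta)
    then show ?thesis using card_mono[OF finW] by (simp add: less_Suc_eq_le)
  qed
  then have bound: "\<forall>x. ?P x \<longrightarrow> card (snd x) < Suc (card (W X))" by blast
  have "\<exists>x. ?P x \<and> (\<forall>y. ?P y \<longrightarrow> card (snd y) \<le> card (snd x))"
    by (rule ex_has_greatest_nat[OF P0 bound])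
  then obtain w B where w: "w \<in> W X" "4 \<le> card (star w)" and B: "B \<in> comps w"
    and max: "\<And>v D. v \<in> W X \<Longrightarrow> 4 \<le> card (star v) \<Longrightarrow> D \<in> comps v \<Longrightarrow> card D \<le> card B"
    by (auto simp: case_prod_beta)
  obtain s where s: "att w B = {s}" using all[OF w B] by (auto simp: card_1_singleton_iff)
  have sw: "s \<in> star w" "other s w \<in> B" using s unfolding att_def by auto
  have cubic: "card (star y) = 3" if C: "C \<in> comps w" "C \<noteq> B" and y: "y \<in> C" for C y
  proof -
    have le: "card (star v) \<le> 3" if v: "v \<in> C" for v
    proof (rule ccontr)
      assume "\<not> ?thesis"
      then have v4: "4 \<le> card (star v)" by simp
      have vW: "v \<in> W X" "v \<noteq> w" "v \<notin> B"
        using v comps(1)[OF C(1)] comps_disjoint(1)[OF C(1) B C(2)] by auto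
      \<comment> \<open>Seen from \<open>v\<close>, the vertex \<open>w\<close> and all of
        \<open>B\<close> lie in one component, which is larger than \<open>B\<close>.\<close>
      let ?D = "mg.component (W X - {v}) w"
      have wv: "w \<in> W X - {v}" using w vW by blast
      then have D: "?D \<in> comps v" unfolding comps_def by (rule imageI)
      have conn: "connected_set link (insert w B)"
        by (rule mg.connected_set_insert[OF comps(3)[OF B] sw(2) other_star(4)[OF sw(1)]])
      have "insert w B \<subseteq> W X - {v}" using wv comps(1)[OF B] vW by blast
      then have "insert w B \<subseteq> ?D" using mg.component_maximal[OF conn] by blast
      then have "card (insert w B) \<le> card ?D" by (rule card_mono[OF comps(4)[OF D]])
      then have "Suc (card B) \<le> card ?D" using comps(4,5)[OF B] by simp
      then show False using max[OF vW(1) v4 D] by simp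
    qed
    have finC: "finite C" by (rule comps(4)[OF C(1)])
    have tot: "2 * card (inner_edges C) + card (att w C) \<le> (\<Sum>y\<in>C. card (star y))"
    proof -
      have 1: "(\<Sum>y\<in>C. card (star y)) = (\<Sum>u\<in>X. card (N u \<inter> C))"
        unfolding star_def by (rule sum_degrees[OF subset_refl finC])
      have RX: "inner_edges C \<union> att w C \<subseteq> X" unfolding inner_edges_def att_def star_def by blast
      have "(\<Sum>u\<in>inner_edges C. card (N u \<inter> C)) = (\<Sum>u\<in>inner_edges C. 2)"
      proof (rule sum.cong[OF refl])
        fix u assume "u \<in> inner_edges C"
        then have "u \<in> X" "N u \<inter> C = N u" unfolding inner_edges_def by auto
        then show "card (N u \<inter> C) = 2" using card_N by simp
      qed
      then have i: "(\<Sum>u\<in>inner_edges C. card (N u \<inter> C)) = 2 * card (inner_edges C)" by simp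
      have "(\<Sum>u\<in>att w C. 1) \<le> (\<Sum>u\<in>att w C. card (N u \<inter> C))"
      proof (rule sum_mono)
        fix u assume u: "u \<in> att w C"
        then have "other u w \<in> N u \<inter> C" "u \<in> X" using other_star(1)[of u w] starD[of u w] unfolding att_def by auto
        then show "1 \<le> card (N u \<inter> C)" using finite_N[of u] by (metis One_nat_def Suc_leI card_gt_0_iff empty_iff finite_Int)
      qed
      then have a: "card (att w C) \<le> (\<Sum>u\<in>att w C. card (N u \<inter> C))" by simp
      have "(\<Sum>u\<in>inner_edges C \<union> att w C. card (N u \<inter> C)) \<le> (\<Sum>u\<in>X. card (N u \<inter> C))"
        by (rule sum_mono2[OF finite_X RX]) simp
      moreover have "(\<Sum>u\<in>inner_edges C \<union> att w C. card (N u \<inter> C)) =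
          (\<Sum>u\<in>inner_edges C. card (N u \<inter> C)) + (\<Sum>u\<in>att w C. card (N u \<inter> C))"
        by (rule sum.union_disjoint[OF finite_inner finite_att inner_att_disjoint[OF C(1)]])
      ultimately show ?thesis using 1 i a by linarith
    qed
    have n1: "card (att w C) = 1" by (rule all[OF w C(1)])
    \<comment> \<open>The count of \<open>comp_count\<close> with a single attaching edge reaches
      the upper bound given by degrees at most 3, so equality holds at every vertex.\<close>
    have low: "3 * card C \<le> (\<Sum>y\<in>C. card (star y))" using comp_count[OF C(1)] tot n1 by linarith
    show ?thesis
    proof (rule ccontr)
      assume "card (star y) \<noteq> 3"
      then have lt: "card (star y) < 3" using le[OF y] by simp
      have "(\<Sum>y\<in>C. card (star y)) < (\<Sum>y\<in>C. 3)"
        by (rule sum_strict_mono_ex1[OF finC]) (use le lt y in auto)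
      then show False using low by simp
    qed
  qed
  have "card (star w - {s}) = card (star w) - 1" using sw(1) finite_star by simp
  then have "3 \<le> card (star w - {s})" using w(2) by linarith
  then obtain A where A: "A \<subseteq> star w - {s}" "card A = 3" "finite A" by (rule obtain_subset_with_card_n)
  have Aw: "u \<in> star w" "u \<noteq> s" if "u \<in> A" for u using A(1) that by auto
  define \<C> where "\<C> = {C \<in> comps w. att w C \<inter> A \<noteq> {}}"
  have CB: "C \<noteq> B" if "C \<in> \<C>" for C using that s Aw unfolding \<C>_def by auto
  have Cc: "C \<in> comps w" if "C \<in> \<C>" for C using that unfolding \<C>_def by blast
  have n1: "card (att w C) = 1" if "C \<in> \<C>" for C using all[OF w Cc[OF that]] .
  have sC: "other s w \<notin> C" if "C \<in> \<C>" for C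
    using comps_eq[OF Cc[OF that] B _ sw(2)] CB[OF that] by blast
  let ?U = "insert s A"
  have sA: "s \<notin> A" using A(1) by blast
  have Us: "?U - {s} = A" using sA by blast
  interpret pruned_star adj X N h w \<C> ?U s
  proof unfold_locales
    show "\<C> \<subseteq> comps w" using Cc by blast
    show "?U \<subseteq> star w" using Aw sw by blast
    show "4 \<le> card ?U" using A sA by simp
    show "\<exists>u\<in>?U - {s}. other u w \<in> C" if "C \<in> \<C>" for C
      using that unfolding Us \<C>_def att_def by blast
  qed simp
  have pr: "pruned C = halves C" if "C \<in> \<C>" for C
    unfolding pruned_def by (rule halves_pruned) (use U_X[OF s_U] sC[OF that] in auto)
  have free: "degree_colorable adj TYPE('c) (pruned C)" if C: "C \<in> \<C>" for C
    unfolding pr[OF C]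
    by (rule halves_degree_colorable) (use comps[OF Cc[OF C]] single_free[OF Cc[OF C] n1[OF C]] in auto)
  have cover: "\<exists>C\<in>\<C>. other u w \<in> C" if u: "u \<in> A" for u
  proof -
    obtain C where "C \<in> comps w" "u \<in> att w C" using att_cover[OF Aw(1)[OF u]] by blast
    then show ?thesis using u unfolding \<C>_def att_def by blast
  qed
  have sww: "degree_swappable adj TYPE('c) (K \<union> \<Union>(pruned ` \<C>))"
  proof (rule pruned_swappable)
    have "{u \<in> ?U - {s}. other u w \<in> \<Union>\<C>} = A" unfolding Us using cover by blast
    then show "3 \<le> card {u \<in> ?U - {s}. other u w \<in> \<Union>\<C>} \<or>
      2 \<le> card {u \<in> ?U - {s}. other u w \<in> \<Union>\<C>} \<and> (\<forall>C\<in>\<C>. degree_colorable adj TYPE('c) (pruned C))"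
      using A(2) by simp
  qed (rule free)
  have finC: "finite \<C>"
  proof (rule finite_subset)
    show "\<C> \<subseteq> Pow (W X)" using comps(1) Cc by blast
    show "finite (Pow (W X))" using finW by simp
  qed
  have "A \<noteq> {}" using A(2) by auto
  then obtain u where u: "u \<in> A" by blast
  obtain C where C: "C \<in> \<C>" "other u w \<in> C" using cover[OF u] by blast
  have uU: "u \<in> ?U - {s}" using u Aw by blast
  have "degree_extendable adj TYPE('c) (K \<union> \<Union>(pruned ` \<C>))"
  proof (rule degree_extendable_Un[OF finite_K])
    show "connected_set adj K" by (rule connected_set_clique) (rule clique_K)
    show "K \<inter> \<Union>(pruned ` \<C>) = {}" using K_disjoint unfolding pruned_def by blast
    show "h u w \<in> K" unfolding K_def using u by blast
    show "h u (other u w) \<in> \<Union>(pruned ` \<C>)" using mate_pruned(1)[OF uU C(2,1)] C(1) by blast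
    show "adj (h u w) (h u (other u w))" by (rule mate_pruned(2)[OF uU C(2,1)])
    show "degree_extendable adj TYPE('c) (\<Union>(pruned ` \<C>))"
    proof (rule degree_extendable_Union)
      show "finite (pruned ` \<C>)" using finC by simp
      fix T assume "T \<in> pruned ` \<C>"
      then obtain D where D: "D \<in> \<C>" "T = pruned D" by blast
      show "degree_extendable adj TYPE('c) T"
        unfolding D(2) pr[OF D(1)]
        by (rule cubic_extendable[OF w(1) Cc[OF D(1)] n1[OF D(1)]]) (rule cubic[OF Cc[OF D(1)] CB[OF D(1)]])
    next
      fix T T' assume T: "T \<in> pruned ` \<C>" "T' \<in> pruned ` \<C>" "T \<noteq> T'"
      then obtain D D' where D: "D \<in> \<C>" "D' \<in> \<C>" "T = pruned D" "T' = pruned D'" "D \<noteq> D'" by blast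
      have "halves D \<inter> halves D' = {}" by (rule halves_disjoint[OF comps_disjoint(1)[OF Cc[OF D(1)] Cc[OF D(2)] D(5)]])
      then show "T \<inter> T' = {}" unfolding D(3,4) pr[OF D(1)] pr[OF D(2)] .
    qed
  qed
  then show ?thesis unfolding reducible_def
    by (intro exI[of _ "K \<union> \<Union>(pruned ` \<C>)"] conjI pruned_nonempty pruned_subset sww)
qed

theorem critical_reducible: "reducible TYPE('c)"
proof (cases "\<exists>w\<in>W X. 4 \<le> card (star w) \<and> (\<exists>C\<in>comps w. 2 \<le> card (att w C))")
  case True
  then obtain w C where "w \<in> W X" "4 \<le> card (star w)" "C \<in> comps w" "2 \<le> card (att w C)" by blast
  then show ?thesis by (rule reducible_multi)
next
  case False
  show ?thesis
  proof (rule reducible_single)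
    fix w C assume w: "w \<in> W X" "4 \<le> card (star w)" "C \<in> comps w"
    then have "\<not> 2 \<le> card (att w C)" using False by blast
    then show "card (att w C) = 1" using att_nonempty[OF w(1,3)] by simp
  qed
qed

end

section \<open>Line graphs\<close>

text \<open>Kempe components are flipped one at a time. A component containing a vertex where the
  colorings differ consists of such vertices, since a neighbor keeping its color would clash in
  \<open>\<psi>\<close>. The intermediate coloring takes each value from \<open>\<phi>\<close> or
  \<open>\<psi>\<close>, so it respects the lists, and fewer differences remain.\<close>

lemma kempe_equivalent_swap:
  assumes fin: "finite V" and EV: "\<And>e. e \<in> E \<Longrightarrow> e \<subseteq> V"
    and c: "list_coloring V E L \<phi>" "list_coloring V E L \<psi>" and rel: "swap_related \<alpha> \<beta> V \<phi> \<psi>"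
  shows "kempe_equivalent V E L \<phi> \<psi>"
  using c(1) rel
proof (induction "card {v \<in> V. \<phi> v \<noteq> \<psi> v}" arbitrary: \<phi> rule: less_induct)
  case less
  let ?D = "{v \<in> V. \<phi> v \<noteq> \<psi> v}"
  have proper: "\<phi> x \<noteq> \<phi> y \<and> \<psi> x \<noteq> \<psi> y" if "{x, y} \<in> E" "x \<noteq> y" for x y
    using less.prems(1) c(2) that unfolding list_coloring_def proper_coloring_def by blast
  show ?case
  proof (cases "?D = {}")
    case True
    have "\<phi> = \<psi>"
    proof (rule PiE_ext)
      show "\<phi> \<in> (\<Pi>\<^sub>E v\<in>V. L v)" "\<psi> \<in> (\<Pi>\<^sub>E v\<in>V. L v)" using less.prems(1) c(2) by (simp_all add: list_coloring_def)
      show "\<phi> v = \<psi> v" if "v \<in> V" for v using True that by blast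
    qed
    then show ?thesis by (simp add: kempe_equivalent_def)
  next
    case False
    then obtain v where v: "v \<in> V" "\<phi> v \<noteq> \<psi> v" by blast
    have ab: "\<alpha> \<noteq> \<beta>" using v less.prems(2) unfolding swap_related_def by metis
    let ?S = "{v \<in> V. \<phi> v = \<alpha> \<or> \<phi> v = \<beta>}"
    let ?C = "component_of ?S (induced_edges E ?S) v"
    have DS: "?D \<subseteq> ?S" using less.prems(2) unfolding swap_related_def by auto
    have flip: "\<psi> x = Transposition.transpose \<alpha> \<beta> (\<phi> x)" if "x \<in> ?D" for x
      using less.prems(2) that unfolding swap_related_def by (auto simp: transpose_def)
    have CD: "?C \<subseteq> ?D"
    proof
      fix y assume "y \<in> ?C"
      then have "(v, y) \<in> {(x, y). {x, y} \<in> induced_edges E ?S}\<^sup>*" by (simp add: component_of_def)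
      then show "y \<in> ?D"
      proof (induction rule: rtrancl_induct)
        case base
        then show ?case using v by simp
      next
        case (step x y)
        then have xy: "{x, y} \<in> E" "x \<in> ?S" "y \<in> ?S" by (auto simp: induced_edges_def)
        show ?case
        proof (rule ccontr)
          assume n: "y \<notin> ?D"
          then have eq: "\<psi> y = \<phi> y" and "x \<noteq> y" using xy step.IH by auto
          then have "\<phi> x \<noteq> \<phi> y" "\<psi> x \<noteq> \<phi> y" using proper[OF xy(1)] by auto
          then show False using flip[OF step.IH] xy(2,3) by auto
        qed
      qed
    qed
    have vC: "v \<in> ?C" using v DS unfolding component_of_def by auto
    define \<xi> where "\<xi> = (\<lambda>x. if x \<in> ?C then Transposition.transpose \<alpha> \<beta> (\<phi> x) else \<phi> x)"
    have \<xi>: "\<xi> x = (if x \<in> ?C then \<psi> x else \<phi> x)" for x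
      unfolding \<xi>_def using flip CD by auto
    have closed: "y \<in> ?C" if xy: "{x, y} \<in> E" "x \<in> ?C" "y \<in> ?S" for x y
    proof -
      have "x \<in> ?S" using xy(2) by (simp add: component_of_def)
      then have "{x, y} \<in> induced_edges E ?S" using xy by (auto simp: induced_edges_def)
      then show ?thesis using xy(2,3) unfolding component_of_def by (auto intro: rtrancl_into_rtrancl)
    qed
    have cross: "\<psi> x \<noteq> \<phi> y" if xy: "{x, y} \<in> E" "x \<noteq> y" "x \<in> ?C" "y \<notin> ?C" for x y
    proof
      assume eq: "\<psi> x = \<phi> y"
      have "x \<in> ?D" using CD xy(3) by blast
      then have "\<psi> x = \<alpha> \<or> \<psi> x = \<beta>" using less.prems(2) unfolding swap_related_def by auto
      moreover have "y \<in> V" using EV[OF xy(1)] by simp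
      ultimately have "y \<in> ?S" using eq by auto
      then show False using closed[OF xy(1,3)] xy(4) by blast
    qed
    have "proper_coloring E \<xi>"
      unfolding proper_coloring_def
    proof (intro allI impI)
      fix x y assume xy: "{x, y} \<in> E" "x \<noteq> y"
      have yx: "{y, x} \<in> E" using xy(1) by (simp add: insert_commute)
      show "\<xi> x \<noteq> \<xi> y"
        using proper[OF xy] cross[OF xy] cross[OF yx] xy(2) unfolding \<xi> by auto
    qed
    moreover have "\<xi> \<in> (\<Pi>\<^sub>E v\<in>V. L v)"
    proof (rule PiE_I)
      fix x assume "x \<in> V"
      then show "\<xi> x \<in> L x" using less.prems(1) c(2) unfolding \<xi> list_coloring_def by auto
    next
      fix x assume x: "x \<notin> V"
      then have "x \<notin> ?C" by (simp add: component_of_def)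
      then show "\<xi> x = undefined" using less.prems(1) x unfolding \<xi> list_coloring_def by auto
    qed
    ultimately have c\<xi>: "list_coloring V E L \<xi>" by (simp add: list_coloring_def)
    have "?C \<in> kempe_components V E \<phi> \<alpha> \<beta>"
      unfolding kempe_components_def Let_def components_of_def using v DS by blast
    then have "kempe_swap V E \<phi> \<xi>" unfolding kempe_swap_def \<xi>_def using ab by blast
    then have st: "valid_kempe_swap V E L \<phi> \<xi>" using less.prems(1) c\<xi> by (simp add: valid_kempe_swap_def)
    have "{x \<in> V. \<xi> x \<noteq> \<psi> x} \<subset> ?D" using vC v unfolding \<xi> by auto
    then have lt: "card {x \<in> V. \<xi> x \<noteq> \<psi> x} < card ?D" using fin by (intro psubset_card_mono) auto
    have "swap_related \<alpha> \<beta> V \<xi> \<psi>" using less.prems(2) unfolding swap_related_def \<xi> by auto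
    then have "kempe_equivalent V E L \<xi> \<psi>" by (rule less.hyps[OF lt c\<xi>])
    with st show ?thesis unfolding kempe_equivalent_def by (rule converse_rtranclp_into_rtranclp)
  qed
qed

definition line_adj :: "'a set \<Rightarrow> 'a set \<Rightarrow> bool" where
  "line_adj e f \<longleftrightarrow> e \<noteq> f \<and> e \<inter> f \<noteq> {}"

interpretation line: symmetric_graph line_adj
  by unfold_locales (auto simp: line_adj_def)

lemma line_graph_edges_iff:
  "{e, f} \<in> line_graph_edges E \<longleftrightarrow> e \<in> E \<and> f \<in> E \<and> line_adj e f"
  unfolding line_graph_edges_def line_adj_def by (auto simp: doubleton_eq_iff)

lemma list_coloring_coloring_on:
  "list_coloring E (line_graph_edges E) L \<phi> \<Longrightarrow> coloring_on line_adj L E \<phi>"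
  unfolding list_coloring_def proper_coloring_def coloring_on_def line_graph_edges_iff
  by (fastforce simp: line_adj_def)

lemma coloring_on_list_coloring:
  "coloring_on line_adj L E \<phi> \<Longrightarrow> list_coloring E (line_graph_edges E) L (restrict \<phi> E)"
  unfolding list_coloring_def proper_coloring_def coloring_on_def line_graph_edges_iff
  by auto

text \<open>Colorings in the sense of \<open>coloring_on\<close> are arbitrary outside
  \<open>E\<close>; \<open>restrict\<close> makes them extensional before each move is split into
  Kempe swaps.\<close>

lemma recolorable_kempe_equivalent:
  assumes fin: "finite E" and r: "recolorable line_adj L E \<phi> \<psi>"
  shows "kempe_equivalent E (line_graph_edges E) L (restrict \<phi> E) (restrict \<psi> E)"
  using r unfolding recolorable_def
proof (induction rule: rtranclp_induct)
  case base
  then show ?case by (simp add: kempe_equivalent_def)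
next
  case (step \<eta> \<xi>)
  obtain \<alpha> \<beta> where st: "coloring_on line_adj L E \<eta>" "coloring_on line_adj L E \<xi>" "swap_related \<alpha> \<beta> E \<eta> \<xi>"
    using step.hyps(2) by (auto simp: recolor_step_def)
  have "kempe_equivalent E (line_graph_edges E) L (restrict \<eta> E) (restrict \<xi> E)"
  proof (rule kempe_equivalent_swap[OF fin])
    show "e \<subseteq> E" if "e \<in> line_graph_edges E" for e using that by (auto simp: line_graph_edges_def)
    show "swap_related \<alpha> \<beta> E (restrict \<eta> E) (restrict \<xi> E)" using st(3) by (simp add: swap_related_def)
  qed (use st coloring_on_list_coloring in blast)+
  then show ?case using step.IH unfolding kempe_equivalent_def by (rule rtranclp_trans[rotated])
qed

lemma card_line_nbrs:
  assumes g: "simple_graph V E" and e: "{x, y} \<in> E" "x \<noteq> y"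
  shows "card {f \<in> E. line_adj {x, y} f} + 2 = vertex_degree E x + vertex_degree E y"
proof -
  let ?X = "{f \<in> E. x \<in> f}" and ?Y = "{f \<in> E. y \<in> f}"
  have fin: "finite E" by (rule finite_edges[OF g])
  have f2: "f = {x, y}" if "f \<in> E" "x \<in> f" "y \<in> f" for f
  proof -
    have "card f = 2" using g that(1) by (simp add: simple_graph_def)
    then show ?thesis using that(2,3) e(2) by (auto simp: card_2_iff)
  qed
  have i: "?X \<inter> ?Y = {{x, y}}"
  proof
    show "?X \<inter> ?Y \<subseteq> {{x, y}}"
    proof
      fix f assume "f \<in> ?X \<inter> ?Y"
      then have "f = {x, y}" by (intro f2) auto
      then show "f \<in> {{x, y}}" by simp
    qed
    show "{{x, y}} \<subseteq> ?X \<inter> ?Y" using e(1) by simp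
  qed
  have "{f \<in> E. line_adj {x, y} f} = (?X \<union> ?Y) - {{x, y}}" unfolding line_adj_def by auto
  moreover have "{x, y} \<in> ?X \<union> ?Y" using e by simp
  ultimately have "card {f \<in> E. line_adj {x, y} f} + 1 = card (?X \<union> ?Y)"
    using fin card_Suc_Diff1[of "?X \<union> ?Y" "{x, y}"] by simp
  moreover have "card ?X + card ?Y = card (?X \<union> ?Y) + card (?X \<inter> ?Y)"
    using fin by (intro card_Un_Int) auto
  ultimately show ?thesis unfolding i vertex_degree_def by simp
qed

lemma vertex_degree_mono:
  assumes "finite E" "F \<subseteq> E"
  shows "vertex_degree F v \<le> vertex_degree E v"
  unfolding vertex_degree_def using assms by (intro card_mono) auto

text \<open>By \<open>heavy\<close> both neighbors of a 2-vertex have degree \<open>k\<close>, so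
  2-vertices are edges of a multigraph on \<open>B\<close>, and a half edge has
  \<open>2 + k - 2\<close> neighbors in the line graph. A dense subset \<open>X\<close> of least
  size is critical.\<close>

lemma line_graph_reducible:
  assumes g: "simple_graph V E" and pl: "planar V E" and ne: "E \<noteq> {}" and k: "15 \<le> k"
    and le: "\<And>v. v \<in> V \<Longrightarrow> vertex_degree E v \<le> k"
    and heavy: "\<And>x y. {x, y} \<in> E \<Longrightarrow> k + 2 \<le> vertex_degree E x + vertex_degree E y"
  shows "\<exists>S. S \<noteq> {} \<and> S \<subseteq> E \<and> (\<forall>e\<in>S. card {f \<in> E. line_adj e f} = k) \<and>
    degree_swappable line_adj TYPE('c) S \<and> degree_extendable line_adj TYPE('c) S"
proof -
  let ?d = "vertex_degree E"
  define T where "T = {v \<in> V. ?d v = 2}"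
  define B where "B = {v \<in> V. ?d v = k}"
  define N where "N u = {y. {u, y} \<in> E}" for u
  have finV: "finite V" using g by (simp add: simple_graph_def)
  have EV: "x \<in> V \<and> y \<in> V \<and> x \<noteq> y" if "{x, y} \<in> E" for x y
    using g that by (fastforce simp: simple_graph_def)
  have N: "card (N u) = 2" "N u \<subseteq> B" if u: "u \<in> T" for u
  proof -
    have "(\<lambda>y. {u, y}) ` N u = {e \<in> E. u \<in> e}"
    proof
      show "{e \<in> E. u \<in> e} \<subseteq> (\<lambda>y. {u, y}) ` N u"
      proof
        fix e assume e: "e \<in> {e \<in> E. u \<in> e}"
        then have "card e = 2" using g by (simp add: simple_graph_def)
        then obtain a b where ab: "e = {a, b}" by (auto simp: card_2_iff)
        then obtain y where "e = {u, y}" using e by auto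
        then show "e \<in> (\<lambda>y. {u, y}) ` N u" using e unfolding N_def by blast
      qed
    qed (auto simp: N_def)
    moreover have "inj_on (\<lambda>y. {u, y}) (N u)" by (rule inj_onI) (auto simp: doubleton_eq_iff)
    ultimately have "card (N u) = ?d u" unfolding vertex_degree_def by (metis card_image)
    then show "card (N u) = 2" using u unfolding T_def by simp
    show "N u \<subseteq> B"
    proof
      fix y assume "y \<in> N u"
      then have e: "{u, y} \<in> E" by (simp add: N_def)
      have "?d u = 2" using u by (simp add: T_def)
      then have "k \<le> ?d y" using heavy[OF e] by simp
      then show "y \<in> B" using le[of y] EV[OF e] unfolding B_def by simp
    qed
  qed
  have TB: "T \<inter> B = {}" using k unfolding T_def B_def by auto
  have finT: "finite T" "finite B" using finV by (auto simp: T_def B_def)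
  have "card (\<Union>(N ` T)) \<le> card B" using N(2) finT by (intro card_mono) auto
  moreover have "3 * card B < 2 * card T"
    using many_2_vertices[OF g pl ne k le heavy] unfolding T_def B_def .
  ultimately have "3 * card (\<Union>(N ` T)) < 2 * card T" by linarith
  then have PT: "T \<subseteq> T \<and> 3 * card (\<Union>(N ` T)) < 2 * card T" by simp
  let ?P = "\<lambda>X. X \<subseteq> T \<and> 3 * card (\<Union>(N ` X)) < 2 * card X"
  have "\<exists>X. ?P X \<and> (\<forall>Z. ?P Z \<longrightarrow> card X \<le> card Z)" by (rule ex_has_least_nat[of ?P T card, OF PT])
  then obtain X where X: "X \<subseteq> T" "3 * card (\<Union>(N ` X)) < 2 * card X" and min: "\<And>Z. ?P Z \<Longrightarrow> card X \<le> card Z"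
    by blast
  have finX: "finite X" by (rule finite_subset[OF X(1) finT(1)])
  have ne': "u \<noteq> y" if "u \<in> X" "y \<in> N u'" "u' \<in> X" for u y u'
    using that X(1) N(2)[of u'] TB by blast
  interpret half_edges line_adj X N "\<lambda>u y. {u, y}"
  proof unfold_locales
    show "finite X" by fact
    show "card (N u) = 2" if "u \<in> X" for u using N(1) X(1) that by blast
    fix u u' y y' assume a: "u \<in> X" "u' \<in> X" "y \<in> N u" "y' \<in> N u'"
    have d: "u \<noteq> y" "u \<noteq> y'" "u' \<noteq> y" "u' \<noteq> y'"
      using ne'[OF a(1,3,1)] ne'[OF a(1,4,2)] ne'[OF a(2,3,1)] ne'[OF a(2,4,2)] by auto
    show "{u, y} = {u', y'} \<longleftrightarrow> u = u' \<and> y = y'" using d by (auto simp: doubleton_eq_iff)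
    show "line_adj {u, y} {u', y'} \<longleftrightarrow> (u = u') \<noteq> (y = y')"
      unfolding line_adj_def using d by (auto simp: doubleton_eq_iff)
  qed
  interpret critical_half_edges line_adj X N "\<lambda>u y. {u, y}"
  proof unfold_locales
    show "3 * card (W X) < 2 * card X" unfolding W_def by (rule X(2))
    fix Z assume Z: "Z \<subset> X"
    have "card Z < card X" by (rule psubset_card_mono[OF finX Z])
    then have "\<not> ?P Z" using min[of Z] by linarith
    then show "2 * card Z \<le> 3 * card (W Z)" unfolding W_def using Z X(1) by auto
  qed
  obtain S where S: "S \<noteq> {}" "S \<subseteq> halves (W X)" "degree_swappable line_adj TYPE('c) S" "degree_extendable line_adj TYPE('c) S"
    using critical_reducible[where 'c = 'c] unfolding reducible_def by blast
  have SE: "e \<in> E \<and> card {f \<in> E. line_adj e f} = k" if e: "e \<in> S" for e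
  proof -
    have "e \<in> halves (W X)" using e S(2) by blast
    then obtain u y where uy: "e = {u, y}" "u \<in> X" "y \<in> N u" by (rule halvesE)
    have E: "{u, y} \<in> E" using uy(3) by (simp add: N_def)
    have "?d u = 2" "?d y = k" using uy X(1) N(2)[of u] by (auto simp: T_def B_def)
    then show ?thesis using card_line_nbrs[OF g E] EV[OF E] E unfolding uy(1) by simp
  qed
  show ?thesis by (intro exI[of _ S] conjI S) (use SE in blast)+
qed

text \<open>Deleting edges may lower the maximum degree while the lists keep their size, so the
  induction fixes \<open>k\<close> as an upper bound for the degrees.\<close>

lemma line_swappable:
  fixes L :: "'a set \<Rightarrow> 'c set"
  assumes k: "15 \<le> k"
  shows "simple_graph V E \<Longrightarrow> planar V E \<Longrightarrow> (\<And>v. v \<in> V \<Longrightarrow> vertex_degree E v \<le> k) \<Longrightarrow>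
    (\<And>e. e \<in> E \<Longrightarrow> card (L e) = k) \<Longrightarrow> swappable line_adj L E"
proof (induction "card E" arbitrary: E rule: less_induct)
  case less
  note g = less.prems(1) and pl = less.prems(2) and le = less.prems(3) and L = less.prems(4)
  have fin: "finite E" by (rule finite_edges[OF g])
  have IH: "swappable line_adj L (E - S)" if S: "S \<subseteq> E" "S \<noteq> {}" for S
  proof (rule less.hyps)
    have "E - S \<subset> E" using S by blast
    then show "card (E - S) < card E" by (rule psubset_card_mono[OF fin])
    show "simple_graph V (E - S)" using g by (auto simp: simple_graph_def)
    show "planar V (E - S)" by (rule planar_subgraph[OF pl]) (use g in \<open>auto simp: simple_graph_def\<close>)
    show "vertex_degree (E - S) v \<le> k" if "v \<in> V" for v
      by (rule order_trans[OF vertex_degree_mono[OF fin] le[OF that]]) blast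
    show "card (L e) = k" if "e \<in> E - S" for e using L that by blast
  qed
  consider "E = {}" | x y where "{x, y} \<in> E" "\<not> k + 2 \<le> vertex_degree E x + vertex_degree E y"
    | "E \<noteq> {}" "\<And>x y. {x, y} \<in> E \<Longrightarrow> k + 2 \<le> vertex_degree E x + vertex_degree E y" by blast
  then show ?case
  proof cases
    case 1
    show ?thesis unfolding 1 swappable_def recolorable_def
      by (intro allI impI r_into_rtranclp) (simp add: recolor_step_def coloring_on_def swap_related_def)
  next
    case 2
    have "x \<noteq> y" using g 2(1) by (fastforce simp: simple_graph_def)
    then have lt: "card {f \<in> E. line_adj {x, y} f} < k" using card_line_nbrs[OF g 2(1)] 2(2) by linarith
    show ?thesis
    proof (rule line.swappable_insert[OF 2(1)])
      show "finite {f \<in> E. line_adj {x, y} f}" using fin by simp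
      show "card {f \<in> E. line_adj {x, y} f} < card (L {x, y})" unfolding L[OF 2(1)] by (rule lt)
      show "swappable line_adj L (E - {{x, y}})" by (rule IH) (use 2(1) in simp_all)
    qed
  next
    case 3
    have "\<exists>S. S \<noteq> {} \<and> S \<subseteq> E \<and> (\<forall>e\<in>S. card {f \<in> E. line_adj e f} = k) \<and>
        degree_swappable line_adj TYPE('c) S \<and> degree_extendable line_adj TYPE('c) S"
      by (rule line_graph_reducible[OF g pl 3(1) k le 3(2)])
    then obtain S where S: "S \<noteq> {}" "S \<subseteq> E" "\<forall>e\<in>S. card {f \<in> E. line_adj e f} = k"
      "degree_swappable line_adj TYPE('c) S" "degree_extendable line_adj TYPE('c) S"
      by (elim exE conjE)
    show ?thesis
    proof (rule line.swappable_reduce[OF fin S(2) _ IH[OF S(2,1)] S(4,5)])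
      show "card {f \<in> E. line_adj e f} \<le> card (L e)" if "e \<in> S" for e
        using S(2,3) L that by auto
    qed
  qed
qed

theorem theorem2:
  fixes V :: "'a set" and E :: "'a set set" and L :: "'a set \<Rightarrow> 'c set"
  assumes "simple_graph V E"
    and "planar V E"
    and "max_degree V E \<ge> 15"
    and "list_assignment E (max_degree V E) L"
  shows "\<forall>\<phi> \<psi>. list_coloring E (line_graph_edges E) L \<phi> \<longrightarrow>
                list_coloring E (line_graph_edges E) L \<psi> \<longrightarrow>
                kempe_equivalent E (line_graph_edges E) L \<phi> \<psi>"
proof (intro allI impI)
  fix \<phi> \<psi>
  assume \<phi>: "list_coloring E (line_graph_edges E) L \<phi>" and \<psi>: "list_coloring E (line_graph_edges E) L \<psi>"
  have fin: "finite E" by (rule finite_edges[OF assms(1)])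
  have "vertex_degree E v \<le> max_degree V E" if "v \<in> V" for v
    unfolding max_degree_def using assms(1) that by (intro Max_ge) (auto simp: simple_graph_def)
  then have "swappable line_adj L E"
    using assms(4) by (intro line_swappable[OF assms(3,1,2)]) (auto simp: list_assignment_def)
  then have "recolorable line_adj L E \<phi> \<psi>"
    using list_coloring_coloring_on[OF \<phi>] list_coloring_coloring_on[OF \<psi>] unfolding swappable_def by blast
  then have "kempe_equivalent E (line_graph_edges E) L (restrict \<phi> E) (restrict \<psi> E)"
    by (rule recolorable_kempe_equivalent[OF fin])
  moreover have "restrict \<phi> E = \<phi>" "restrict \<psi> E = \<psi>"
    using \<phi> \<psi> by (auto simp: list_coloring_def PiE_restrict)
  ultimately show "kempe_equivalent E (line_graph_edges E) L \<phi> \<psi>" by simp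
qed

end
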